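(* Let $n\ge 2$. There exist constants $c,c_0>0$, independent of $\kappa$, $t$ and $\omega$, such that the following holds for every $\kappa\ge1$. If $\omega:\mathbb{R}_+\to\mathbb{R}_+$ is a non-decreasing function such that $$\|h\|_{L^2(\mathbb{R}^n)}\le\omega\left(\|F_\kappa(h)\|_{\mathrm{HS}}\right)\quad\text{for all } h\in H^1_{\overline{B}_1}\text{ with }\|h\|_{H^1(\mathbb{R}^n)}\le1,$$ then $$\omega(t)\ge c\,\max\left\{t,\ \kappa^{-1}\left(\log\kappa+\log(1/t)\right)^{-2}\right\}\quad\text{for all } 0<t\le c_0.$$
   Context: $\mathbb{R}_+=[0,\infty)$; $B_1$ is the open unit ball in $\mathbb{R}^n$; $H^1_{\overline{B}_1}=\{f\in H^1(\mathbb{R}^n):\operatorname{supp}(f)\subset\overline{B}_1\}$ with the norm of $H^1(\mathbb{R}^n)$. $\|\cdot\|_{\mathrm{HS}}$ is the Hilbert-Schmidt norm of operators on $L^2(\mathbb{S}^{n-1})$. For $f\in L^2(\mathbb{S}^{n-1})$ and $\kappa>0$, $(P_\kappa f)(x)=\int_{\mathbb{S}^{n-1}}e^{\mathbf{i}\kappa\omega\cdot x}f(\omega)\,\mathrm{d}S(\omega)$ for $x\in\mathbb{R}^n$. For $h\in L^2(\mathbb{R}^n)$ supported in $\overline{B}_1$, $F_\kappa(h)$ is the (Hilbert-Schmidt) operator on $L^2(\mathbb{S}^{n-1})$ determined by $$(F_\kappa(h)f,g)_{L^2(\mathbb{S}^{n-1})}=\kappa^{\frac{n-1}{2}}\int_{B_1}h\,P_\kappa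 f\,\overline{P_\kappa g}\,\mathrm{d}x\quad\text{for } f,g\in L^2(\mathbb{S}^{n-1}).$$ *)

theory Defs
  imports "HOL-Analysis.Analysis"
begin

text \<open>
  Elements of an \<open>L\<^sup>2\<close> space are represented by square-integrable functions; equality in
  \<open>L\<^sup>2(M)\<close> is equality almost everywhere with respect to \<open>M\<close>.
\<close>

definition L2 :: "'a measure \<Rightarrow> ('a \<Rightarrow> complex) set" where
  "L2 M = {f \<in> borel_measurable M. integrable M (\<lambda>x. (cmod (f x))\<^sup>2)}"

definition L2_inner :: "'a measure \<Rightarrow> ('a \<Rightarrow> complex) \<Rightarrow> ('a \<Rightarrow> complex) \<Rightarrow> complex" where
  "L2_inner M f g = (LINT x|M. f x * cnj (g x))"

definition L2_norm :: "'a measure \<Rightarrow> ('a \<Rightarrow> complex) \<Rightarrow> real" where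
  "L2_norm M f = sqrt (LINT x|M. (cmod (f x))\<^sup>2)"

definition orthonormal_basis :: "'a measure \<Rightarrow> ('a \<Rightarrow> complex) set \<Rightarrow> bool" where
  "orthonormal_basis M E \<longleftrightarrow>
     E \<subseteq> L2 M \<and>
     (\<forall>e\<in>E. \<forall>e'\<in>E. L2_inner M e e' = (if e = e' then 1 else 0)) \<and>
     (\<forall>f\<in>L2 M. (\<forall>e\<in>E. L2_inner M f e = 0) \<longrightarrow> (AE x in M. f x = 0))"

text \<open>
  The sum does not depend on the orthonormal basis. It is meaningful for Hilbert--Schmidt
  operators only: for other operators the sum diverges and \<^const>\<open>infsum\<close> returns \<open>0\<close>.
\<close>

definition HS_norm :: "'a measure \<Rightarrow> (('a \<Rightarrow> complex) \<Rightarrow> ('a \<Rightarrow> complex)) \<Rightarrow> real" where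
  "HS_norm M T =
     (let E = (SOME E. orthonormal_basis M E) in sqrt (\<Sum>\<^sub>\<infinity>e\<in>E. (L2_norm M (T e))\<^sup>2))"

definition partial_deriv :: "'n::finite \<Rightarrow> (real^'n \<Rightarrow> complex) \<Rightarrow> real^'n \<Rightarrow> complex" where
  "partial_deriv i f x = frechet_derivative f (at x) (axis i 1)"

primrec C_k :: "nat \<Rightarrow> (real^'n::finite \<Rightarrow> complex) \<Rightarrow> bool" where
  "C_k 0 f \<longleftrightarrow> continuous_on UNIV f"
| "C_k (Suc k) f \<longleftrightarrow> f differentiable_on UNIV \<and> (\<forall>i. C_k k (partial_deriv i f))"

definition test_function :: "(real^'n::finite \<Rightarrow> complex) \<Rightarrow> bool" where
  "test_function \<phi> \<longleftrightarrow> (\<forall>k. C_k k \<phi>) \<and> compact (closure {x. \<phi> x \<noteq> 0})"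

definition is_weak_deriv ::
    "'n::finite \<Rightarrow> (real^'n \<Rightarrow> complex) \<Rightarrow> (real^'n \<Rightarrow> complex) \<Rightarrow> bool" where
  "is_weak_deriv i f g \<longleftrightarrow>
     (\<forall>\<phi>. test_function \<phi> \<longrightarrow>
        (LINT x|lborel. f x * partial_deriv i \<phi> x) = - (LINT x|lborel. g x * \<phi> x))"

definition H1 :: "(real^'n::finite \<Rightarrow> complex) set" where
  "H1 = {f \<in> L2 lborel. \<forall>i. \<exists>g\<in>L2 lborel. is_weak_deriv i f g}"

text \<open>The weak derivative is unique up to a null set.\<close>

definition weak_deriv :: "'n::finite \<Rightarrow> (real^'n \<Rightarrow> complex) \<Rightarrow> real^'n \<Rightarrow> complex" where
  "weak_deriv i f = (SOME g. g \<in> L2 lborel \<and> is_weak_deriv i f g)"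

definition H1_norm :: "(real^'n::finite \<Rightarrow> complex) \<Rightarrow> real" where
  "H1_norm f = sqrt ((L2_norm lborel f)\<^sup>2 + (\<Sum>i\<in>UNIV. (L2_norm lborel (weak_deriv i f))\<^sup>2))"

text \<open>
  The support of a function that is only defined almost everywhere: the complement of the
  largest open set on which it vanishes almost everywhere.
\<close>

definition ess_support :: "(real^'n::finite \<Rightarrow> complex) \<Rightarrow> (real^'n) set" where
  "ess_support f = - \<Union>{U. open U \<and> (AE x in lborel. x \<in> U \<longrightarrow> f x = 0)}"

definition H1_ball :: "(real^'n::finite \<Rightarrow> complex) set" where
  "H1_ball = {f \<in> H1. ess_support f \<subseteq> cball 0 1}"

text \<open>
  Surface measure of the unit sphere, normalised by integration in polar coordinates: the
  surface measure of \<open>A\<close> is \<open>n\<close> times the volume of the cone \<open>{r \<theta> | 0 < r < 1, \<theta> \<in> A}\<close>.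
\<close>

definition sphere_measure :: "(real^'n::finite) measure" where
  "sphere_measure =
     scale_measure (of_nat CARD('n))
       (distr (restrict_space lborel (ball 0 1 - {0})) (restrict_space borel (sphere 0 1))
          (\<lambda>x. x /\<^sub>R norm x))"

definition P_op :: "real \<Rightarrow> (real^'n::finite \<Rightarrow> complex) \<Rightarrow> real^'n \<Rightarrow> complex" where
  "P_op \<kappa> f x = (LINT \<theta>|sphere_measure. exp (\<i> * of_real (\<kappa> * (\<theta> \<bullet> x))) * f \<theta>)"

text \<open>The defining identity determines \<open>F_op \<kappa> h f\<close> up to a null set of the sphere.\<close>

definition F_op :: "real \<Rightarrow> (real^'n::finite \<Rightarrow> complex) \<Rightarrow>
    (real^'n \<Rightarrow> complex) \<Rightarrow> (real^'n \<Rightarrow> complex)" where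
  "F_op \<kappa> h f = (SOME u. u \<in> L2 sphere_measure \<and>
     (\<forall>g\<in>L2 sphere_measure. L2_inner sphere_measure u g =
        of_real (\<kappa> powr ((real CARD('n) - 1) / 2)) *
        (LINT x:ball 0 1|lborel. h x * P_op \<kappa> f x * cnj (P_op \<kappa> g x))))"

end

theory Submission
  imports Defs "HOL-Computational_Algebra.Polynomial"
begin

text \<open>
  The operator \<open>F\<^sub>\<kappa>(h)\<close> has the kernel \<open>\<kappa>\<^bsup>(n-1)/2\<^esup> \<integral> h(x) e\<^bsup>i\<kappa>(\<theta>-y)\<cdot>x\<^esup> dx\<close>, so its Hilbert--Schmidt norm
  only sees the Fourier transform of \<open>h\<close> on the ball of radius \<open>2\<kappa>\<close>. Both lower bounds come from test
  functions \<open>h(x) = \<Prod>\<^sub>j f\<^sub>j(x\<^sub>j)\<close> on a small cube with sine sums \<open>f\<^sub>j\<close>.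

  For the bound \<open>t\<close>, all \<open>f\<^sub>j\<close> are multiples of the first sine. The Fourier transform of \<open>h\<close> is then at most
  \<open>C \<Prod>\<^sub>j (1 + \<xi>\<^sub>j\<^sup>2)\<^bsup>-1/2\<^esup>\<close>, whose square integrates to \<open>O(\<kappa>\<^bsup>-(n-1)\<^esup>)\<close> over the sphere of radius \<open>\<kappa>\<close>
  around any centre; hence \<open>F\<^sub>\<kappa>(h)\<close> is bounded uniformly in \<open>\<kappa>\<close>.

  For the logarithmic bound, one factor is a sum of the first \<open>k + 2\<close> sines whose moments of order at most
  \<open>k\<close> vanish; it exists because there are more coefficients than equations. By Taylor's formula its Fourier
  transform is at most \<open>(2\<kappa>)\<^bsup>k+1\<^esup>/k!\<close> on \<open>[-2\<kappa>, 2\<kappa>]\<close>, while by orthogonality the \<open>H\<^sup>1\<close> norm of \<open>h\<close>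
  exceeds its \<open>L\<^sup>2\<close> norm at most by a factor \<open>O(k)\<close>. It remains to take \<open>k\<close> of size
  \<open>\<kappa> + log \<kappa> + log (1/t)\<close>.
\<close>

section \<open>Square-integrable functions and the Hilbert--Schmidt norm\<close>

text \<open>Since \<omega> is monotone, an \<open>h\<close> with \<open>H1\<close> norm at most 1
  and Hilbert-Schmidt norm at most \<open>t\<close> forces \<omega> at \<open>t\<close> to be at
  least the \<open>L2\<close> norm of \<open>h\<close>. Hence only upper bounds on the
  Hilbert-Schmidt norm are wanted, and Bessel's inequality suffices for them. The operator and the
  weak derivatives are given by choice, so each is compared with an explicit function through its
  norm. Products turn transforms and norms into products over the line. Sines vanish at both ends of
  the interval, so a sine sum extended by zero is Lipschitz and hence weakly differentiable, in
  spite of its kinks; the kinks leave a decay of only 1/|xi| for the transform, whose square is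
  still integrable on the line. In the logarithmic bound more sines allow more vanishing moments but
  cost \<open>H1\<close> norm, linearly in their number. With L = log \<kappa> + log (1/t), about
  \<kappa> + L sines suffice, so the \<open>L2\<close> norm is at least of order 1/(\<kappa> + L).
  The stated form follows because \<kappa> and L are at most \<kappa> L^2 once L is at least 1,
  which the restriction of \<open>t\<close> to at most \<open>exp (- 1)\<close> guarantees.\<close>

lemma cmod_mult_le_squares: "cmod (a * cnj b) \<le> (cmod a)\<^sup>2 + (cmod b)\<^sup>2"
proof -
  have "2 * (cmod a * cmod b) \<le> (cmod a)\<^sup>2 + (cmod b)\<^sup>2"
    using sum_squares_bound[of "cmod a" "cmod b"] by simp
  moreover have "0 \<le> cmod a * cmod b" by simp
  ultimately show ?thesis unfolding norm_mult complex_mod_cnj by linarith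
qed

lemma L2_measurable: "f \<in> L2 M \<Longrightarrow> f \<in> borel_measurable M"
  by (simp add: L2_def)

lemma L2_integrable_mult_cnj:
  assumes "f \<in> L2 M" "g \<in> L2 M"
  shows "integrable M (\<lambda>x. f x * cnj (g x))"
proof (rule Bochner_Integration.integrable_bound)
  show "integrable M (\<lambda>x. (cmod (f x))\<^sup>2 + (cmod (g x))\<^sup>2)"
    using assms by (auto simp: L2_def)
  have [measurable]: "f \<in> borel_measurable M" "g \<in> borel_measurable M"
    using assms by (auto simp: L2_def)
  have [measurable]: "(\<lambda>x. cnj (g x)) \<in> borel_measurable M"
    by (intro borel_measurable_continuous_on[where f=cnj]) (auto intro: continuous_intros)
  show "(\<lambda>x. f x * cnj (g x)) \<in> borel_measurable M" by measurable
  show "AE x in M. norm (f x * cnj (g x)) \<le> norm ((cmod (f x))\<^sup>2 + (cmod (g x))\<^sup>2)"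
    using cmod_mult_le_squares by (auto simp del: complex_mod_cnj norm_mult)
qed

lemma L2_cmult: "f \<in> L2 M \<Longrightarrow> (\<lambda>x. c * f x) \<in> L2 M"
  by (auto simp: L2_def norm_mult power_mult_distrib)

lemma L2_add:
  assumes "f \<in> L2 M" "g \<in> L2 M"
  shows "(\<lambda>x. f x + g x) \<in> L2 M"
proof -
  have [measurable]: "f \<in> borel_measurable M" "g \<in> borel_measurable M"
    using assms by (auto simp: L2_def)
  have "integrable M (\<lambda>x. (cmod (f x + g x))\<^sup>2)"
  proof (rule Bochner_Integration.integrable_bound)
    show "integrable M (\<lambda>x. 2 * (cmod (f x))\<^sup>2 + 2 * (cmod (g x))\<^sup>2)"
      using assms by (auto simp: L2_def)
    have "(cmod (a + b))\<^sup>2 \<le> 2 * (cmod a)\<^sup>2 + 2 * (cmod b)\<^sup>2" for a b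
    proof -
      have "(cmod (a + b))\<^sup>2 \<le> (cmod a + cmod b)\<^sup>2"
        by (intro power_mono norm_triangle_ineq) auto
      then show ?thesis
        using sum_squares_bound[of "cmod a" "cmod b"] by (simp add: power2_sum)
    qed
    then show "AE x in M. norm ((cmod (f x + g x))\<^sup>2) \<le> norm (2 * (cmod (f x))\<^sup>2 + 2 * (cmod (g x))\<^sup>2)"
      by auto
  qed auto
  then show ?thesis by (auto simp: L2_def)
qed

lemma L2_diff: "f \<in> L2 M \<Longrightarrow> g \<in> L2 M \<Longrightarrow> (\<lambda>x. f x - g x) \<in> L2 M"
  using L2_add[of f M "\<lambda>x. - 1 * g x"] L2_cmult[of g M "-1"] by simp

lemma L2_sum: "finite F \<Longrightarrow> (\<And>e. e \<in> F \<Longrightarrow> f e \<in> L2 M) \<Longrightarrow> (\<lambda>x. \<Sum>e\<in>F. f e x) \<in> L2 M"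
proof (induction F rule: finite_induct)
  case empty
  then show ?case by (simp add: L2_def)
next
  case (insert e F)
  then show ?case by (auto intro!: L2_add)
qed

lemma L2_cnj:
  assumes "f \<in> L2 M"
  shows "(\<lambda>x. cnj (f x)) \<in> L2 M"
proof -
  have [measurable]: "f \<in> borel_measurable M"
    using assms by (auto simp: L2_def)
  have "(\<lambda>x. cnj (f x)) \<in> borel_measurable M"
    by (intro borel_measurable_continuous_on[where f=cnj]) (auto intro: continuous_intros)
  then show ?thesis using assms by (auto simp: L2_def)
qed

lemma L2_inner_self: "L2_inner M f f = of_real ((L2_norm M f)\<^sup>2)"
proof -
  have "f x * cnj (f x) = of_real ((cmod (f x))\<^sup>2)" for x
    using complex_norm_square[of "f x"] by simp
  moreover have "0 \<le> (LINT x|M. (cmod (f x))\<^sup>2)" by simp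
  ultimately show ?thesis
    by (simp add: L2_inner_def L2_norm_def del: of_real_power)
qed

lemma L2_norm_nonneg: "0 \<le> L2_norm M f"
  by (simp add: L2_norm_def)

lemma L2_norm_cong_AE:
  assumes "f \<in> borel_measurable M" "g \<in> borel_measurable M" "AE x in M. f x = g x"
  shows "L2_norm M f = L2_norm M g"
  unfolding L2_norm_def
  by (rule arg_cong[where f=sqrt], rule integral_cong_AE) (use assms in auto)

lemma L2_inner_cnj: "cnj (L2_inner M f g) = L2_inner M g f"
proof -
  have "cnj (L2_inner M f g) = (LINT x|M. cnj (f x * cnj (g x)))"
    unfolding L2_inner_def by (rule Bochner_Integration.integral_cnj[symmetric])
  then show ?thesis by (simp add: L2_inner_def mult.commute)
qed

lemma L2_inner_diff_left:
  assumes "f \<in> L2 M" "g \<in> L2 M" "k \<in> L2 M"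
  shows "L2_inner M (\<lambda>x. f x - g x) k = L2_inner M f k - L2_inner M g k"
  unfolding L2_inner_def left_diff_distrib
  by (intro Bochner_Integration.integral_diff L2_integrable_mult_cnj assms)

lemma L2_inner_diff_right:
  assumes "f \<in> L2 M" "g \<in> L2 M" "k \<in> L2 M"
  shows "L2_inner M k (\<lambda>x. f x - g x) = L2_inner M k f - L2_inner M k g"
  unfolding L2_inner_def complex_cnj_diff right_diff_distrib
  by (intro Bochner_Integration.integral_diff L2_integrable_mult_cnj assms)

lemma L2_inner_cmult_left:
  "L2_inner M (\<lambda>x. c * f x) g = c * L2_inner M f g"
  by (simp add: L2_inner_def mult.assoc)

lemma L2_inner_cmult_right:
  "L2_inner M f (\<lambda>x. c * g x) = cnj c * L2_inner M f g"
  by (simp add: L2_inner_def mult.left_commute)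

lemma L2_inner_sum_left:
  assumes "finite F" "\<And>e. e \<in> F \<Longrightarrow> f e \<in> L2 M" "k \<in> L2 M"
  shows "L2_inner M (\<lambda>x. \<Sum>e\<in>F. f e x) k = (\<Sum>e\<in>F. L2_inner M (f e) k)"
  unfolding L2_inner_def sum_distrib_right
  by (rule Bochner_Integration.integral_sum) (intro L2_integrable_mult_cnj assms)

text \<open>The residual of \<open>f\<close> after subtracting its projection \<open>p\<close> onto
  the span of \<open>F\<close> has squared norm \<open>(L2_norm M f)\<^sup>2 - S\<close>, and a
  square is nonnegative.\<close>

lemma Bessel_inequality:
  assumes F: "finite F" "F \<subseteq> L2 M"
    and on: "\<And>e e'. e \<in> F \<Longrightarrow> e' \<in> F \<Longrightarrow> L2_inner M e e' = (if e = e' then 1 else 0)"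
    and f: "f \<in> L2 M"
  shows "(\<Sum>e\<in>F. (cmod (L2_inner M f e))\<^sup>2) \<le> (L2_norm M f)\<^sup>2"
proof -
  define c where "c e = L2_inner M f e" for e
  define p where "p x = (\<Sum>e\<in>F. c e * e x)" for x
  define S where "S = (\<Sum>e\<in>F. (cmod (c e))\<^sup>2)"
  have cL2: "(\<lambda>x. c e * e x) \<in> L2 M" if "e \<in> F" for e
    using that F by (intro L2_cmult) auto
  have pL2: "p \<in> L2 M" unfolding p_def[abs_def] using F cL2 by (intro L2_sum)
  have ep: "L2_inner M p k = (\<Sum>e\<in>F. c e * L2_inner M e k)" if "k \<in> L2 M" for k
    unfolding p_def[abs_def] using F cL2 that
    by (subst L2_inner_sum_left) (auto simp: L2_inner_cmult_left)
  have sq: "z * cnj z = of_real ((cmod z)\<^sup>2)" for z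
    using complex_norm_square[of z] by simp
  have pf: "L2_inner M p f = of_real S"
    unfolding ep[OF f] S_def of_real_sum
    by (rule sum.cong) (simp_all add: c_def L2_inner_cnj[of M f, symmetric] sq del: of_real_power)
  have fp: "L2_inner M f p = of_real S"
    using L2_inner_cnj[of M p f] pf by simp
  have pe: "L2_inner M p e = c e" if "e \<in> F" for e
  proof -
    have "L2_inner M p e = (\<Sum>e'\<in>F. if e' = e then c e' else 0)"
      using that F by (subst ep) (auto intro!: sum.cong simp only: on mult_1_right mult_zero_right if_distrib[of "\<lambda>z. _ * z"])
    then show ?thesis using that F by simp
  qed
  have pp: "L2_inner M p p = of_real S"
    unfolding ep[OF pL2] S_def of_real_sum
    by (rule sum.cong) (simp_all add: L2_inner_cnj[of M p, symmetric] pe sq del: of_real_power)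
  have fpL2: "(\<lambda>x. f x - p x) \<in> L2 M" by (intro L2_diff f pL2)
  have "of_real ((L2_norm M (\<lambda>x. f x - p x))\<^sup>2) = L2_inner M (\<lambda>x. f x - p x) (\<lambda>x. f x - p x)"
    by (simp add: L2_inner_self)
  also have "\<dots> = (of_real ((L2_norm M f)\<^sup>2 - S) :: complex)"
    unfolding L2_inner_diff_left[OF f pL2 fpL2] L2_inner_diff_right[OF f pL2 f]
      L2_inner_diff_right[OF f pL2 pL2] fp pf pp L2_inner_self[of M f] of_real_diff by simp
  finally have "(L2_norm M (\<lambda>x. f x - p x))\<^sup>2 = (L2_norm M f)\<^sup>2 - S"
    unfolding of_real_eq_iff .
  then have "S \<le> (L2_norm M f)\<^sup>2" by (metis diff_ge_0_iff_ge zero_le_power2)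
  then show ?thesis by (simp add: S_def c_def)
qed

lemma L2_norm_eq_0_AE:
  assumes "f \<in> L2 M" "L2_norm M f = 0"
  shows "AE x in M. f x = 0"
proof -
  have "(LINT x|M. (cmod (f x))\<^sup>2) = 0"
    using assms(2) by (simp add: L2_norm_def)
  then have "AE x in M. (cmod (f x))\<^sup>2 = 0"
    using assms(1) by (subst (asm) integral_nonneg_eq_0_iff_AE) (auto simp: L2_def)
  then show ?thesis by auto
qed

text \<open>Guarantees that the choice in \<open>HS_norm\<close> picks a basis. Zorn's lemma gives a
  maximal orthonormal family, and a non-null function orthogonal to it could be normalised and
  adjoined. Using functions instead of classes does no harm: two members that agree almost
  everywhere would have inner product 1 and hence be the same function.\<close>

lemma orthonormal_basis_exists: "\<exists>E. orthonormal_basis M E"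
proof -
  define Os where "Os = {E. E \<subseteq> L2 M \<and> (\<forall>e\<in>E. \<forall>e'\<in>E. L2_inner M e e' = (if e = e' then 1 else 0))}"
  have "\<exists>E\<in>Os. \<forall>X\<in>Os. E \<subseteq> X \<longrightarrow> X = E"
  proof (rule subset_Zorn')
    fix C assume C: "subset.chain Os C"
    have "L2_inner M e e' = (if e = e' then 1 else 0)" if "e \<in> \<Union>C" "e' \<in> \<Union>C" for e e'
    proof -
      from that obtain X Y where "X \<in> C" "Y \<in> C" "e \<in> X" "e' \<in> Y" by auto
      moreover from this C have "X \<subseteq> Y \<or> Y \<subseteq> X" by (meson subset_chain_def)
      ultimately obtain Z where "Z \<in> C" "e \<in> Z" "e' \<in> Z" by blast
      with C show ?thesis unfolding Os_def subset_chain_def by auto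
    qed
    moreover have "\<Union>C \<subseteq> L2 M" using C unfolding Os_def subset_chain_def by auto
    ultimately show "\<Union>C \<in> Os" unfolding Os_def by blast
  qed
  then obtain E where E: "E \<in> Os" and max: "\<And>X. X \<in> Os \<Longrightarrow> E \<subseteq> X \<Longrightarrow> X = E" by blast
  have "AE x in M. f x = 0" if f: "f \<in> L2 M" and orth: "\<forall>e\<in>E. L2_inner M f e = 0" for f
  proof (rule ccontr)
    assume nz: "\<not> (AE x in M. f x = 0)"
    define r where "r = L2_norm M f"
    have r: "r > 0"
      using L2_norm_eq_0_AE[OF f] nz L2_norm_nonneg[of M f] unfolding r_def by fastforce
    define g where "g x = of_real (1 / r) * f x" for x
    have gL2: "g \<in> L2 M" unfolding g_def[abs_def] by (intro L2_cmult f)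
    have gg: "L2_inner M g g = 1"
      unfolding g_def[abs_def] L2_inner_cmult_left L2_inner_cmult_right
      using r by (simp add: L2_inner_self r_def power2_eq_square)
    have ge: "L2_inner M g e = 0" if "e \<in> E" for e
      unfolding g_def[abs_def] L2_inner_cmult_left using orth that by simp
    have eg: "L2_inner M e g = 0" if "e \<in> E" for e
      using ge[OF that] L2_inner_cnj[of M g e] by simp
    have "insert g E \<in> Os"
      using E gL2 gg ge eg unfolding Os_def by auto
    then have "g \<in> E" using max[of "insert g E"] by auto
    then show False using gg ge by auto
  qed
  then have "orthonormal_basis M E"
    using E unfolding orthonormal_basis_def Os_def by blast
  then show ?thesis ..
qed

text \<open>For fixed \<open>y\<close> the values of the integral operator on basis elements are, up
  to conjugation, the coefficients of the conjugate of \<open>K y\<close>, so Bessel bounds the sum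
  of their squares by \<open>C\<close>; integrating over \<open>y\<close> gives the claim.
  Hypothesis \<open>T\<close> compares norms only, because \<open>F_op\<close> is determined only up
  to null sets.\<close>

lemma HS_norm_integral_operator_le:
  assumes "finite_measure M"
    and K: "(\<lambda>(y, x). K y x) \<in> borel_measurable (M \<Otimes>\<^sub>M M)"
    and KL2: "\<And>y. y \<in> space M \<Longrightarrow> K y \<in> L2 M"
    and KC: "\<And>y. y \<in> space M \<Longrightarrow> (LINT x|M. (cmod (K y x))\<^sup>2) \<le> C"
    and T: "\<And>e. e \<in> L2 M \<Longrightarrow> L2_norm M (T e) = L2_norm M (\<lambda>y. LINT x|M. K y x * e x)"
    and "C \<ge> 0"
  shows "HS_norm M T \<le> sqrt (C * measure M (space M))"
proof -
  interpret finite_measure M by fact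
  define E where "E = (SOME E. orthonormal_basis M E)"
  have E: "orthonormal_basis M E"
    unfolding E_def using orthonormal_basis_exists by (rule someI_ex)
  define u where "u e y = (LINT x|M. K y x * e x)" for e y
  have bess: "(\<Sum>e\<in>F. (cmod (u e y))\<^sup>2) \<le> C" if F: "finite F" "F \<subseteq> E" and y: "y \<in> space M" for F y
  proof -
    have "(\<Sum>e\<in>F. (cmod (u e y))\<^sup>2) = (\<Sum>e\<in>F. (cmod (L2_inner M (\<lambda>x. cnj (K y x)) e))\<^sup>2)"
    proof (rule sum.cong[OF refl])
      fix e
      have "L2_inner M (\<lambda>x. cnj (K y x)) e = (LINT x|M. cnj (K y x * e x))"
        by (simp add: L2_inner_def)
      also have "\<dots> = cnj (u e y)" unfolding u_def by (rule Bochner_Integration.integral_cnj)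
      finally show "(cmod (u e y))\<^sup>2 = (cmod (L2_inner M (\<lambda>x. cnj (K y x)) e))\<^sup>2" by simp
    qed
    also have "\<dots> \<le> (L2_norm M (\<lambda>x. cnj (K y x)))\<^sup>2"
      using F E KL2[OF y] by (intro Bessel_inequality L2_cnj) (auto simp: orthonormal_basis_def subset_iff)
    also have "\<dots> = (LINT x|M. (cmod (K y x))\<^sup>2)"
      by (simp add: L2_norm_def)
    also have "\<dots> \<le> C" by (rule KC[OF y])
    finally show ?thesis .
  qed
  have um: "u e \<in> borel_measurable M" if "e \<in> L2 M" for e
  proof -
    have [measurable]: "e \<in> borel_measurable M" using that by (rule L2_measurable)
    have [measurable]: "(\<lambda>z. K (fst z) (snd z)) \<in> borel_measurable (M \<Otimes>\<^sub>M M)"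
      using K by (simp add: case_prod_beta')
    show ?thesis unfolding u_def[abs_def]
      by (rule borel_measurable_lebesgue_integral) (simp add: case_prod_beta')
  qed
  have uint: "integrable M (\<lambda>y. (cmod (u e y))\<^sup>2)" if "e \<in> E" for e
  proof (rule integrable_const_bound[where B=C])
    show "AE y in M. norm ((cmod (u e y))\<^sup>2) \<le> C"
      using bess[of "{e}"] that by auto
    have "u e \<in> borel_measurable M" using that E by (intro um) (auto simp: orthonormal_basis_def)
    then show "(\<lambda>y. (cmod (u e y))\<^sup>2) \<in> borel_measurable M" by measurable
  qed
  \<comment> \<open>Only finite partial sums are bounded, so that sum and integral can be
    exchanged.\<close>
  have fin: "(\<Sum>e\<in>F. (L2_norm M (T e))\<^sup>2) \<le> C * measure M (space M)"
    if F: "finite F" "F \<subseteq> E" for F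
  proof -
    have "(\<Sum>e\<in>F. (L2_norm M (T e))\<^sup>2) = (\<Sum>e\<in>F. LINT y|M. (cmod (u e y))\<^sup>2)"
    proof (rule sum.cong[OF refl])
      fix e assume "e \<in> F"
      then have "e \<in> L2 M" using F E by (auto simp: orthonormal_basis_def)
      from T[OF this] show "(L2_norm M (T e))\<^sup>2 = (LINT y|M. (cmod (u e y))\<^sup>2)"
        by (simp add: u_def[abs_def] L2_norm_def[of _ "\<lambda>y. _ y"])
    qed
    also have "\<dots> = (LINT y|M. (\<Sum>e\<in>F. (cmod (u e y))\<^sup>2))"
      using F uint by (intro Bochner_Integration.integral_sum[symmetric]) auto
    also have "\<dots> \<le> (LINT y|M. C)"
      using F uint bess[OF F]
      by (intro integral_mono Bochner_Integration.integrable_sum) (auto simp: subset_iff)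
    finally show ?thesis by (simp add: mult.commute)
  qed
  have "(\<Sum>\<^sub>\<infinity>e\<in>E. (L2_norm M (T e))\<^sup>2) \<le> C * measure M (space M)"
  proof (cases "(\<lambda>e. (L2_norm M (T e))\<^sup>2) summable_on E")
    case True
    then show ?thesis using fin by (rule infsum_le_finite_sums)
  next
    \<comment> \<open>Here \<open>infsum\<close> has its default value 0.\<close>
    case False
    then show ?thesis using \<open>C \<ge> 0\<close> by (simp add: infsum_not_exists)
  qed
  then show ?thesis
    unfolding HS_norm_def E_def[symmetric] Let_def by simp
qed

section \<open>Surface measure and the kernel of the operator\<close>

lemma (in finite_measure) L2_integrable:
  assumes "f \<in> L2 M"
  shows "integrable M f"
proof (rule Bochner_Integration.integrable_bound)
  show "integrable M (\<lambda>x. 1 + (cmod (f x))\<^sup>2)"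
    using assms by (auto simp: L2_def)
  show "f \<in> borel_measurable M" using assms by (rule L2_measurable)
  have "t \<le> 1 + t\<^sup>2" for t :: real
    using sum_squares_bound[of t 1] by (simp add: power2_eq_square) (smt (verit) zero_le_square)
  then show "AE x in M. norm (f x) \<le> norm (1 + (cmod (f x))\<^sup>2)"
    by (simp add: abs_of_nonneg)
qed

lemma (in finite_measure) L2_bounded:
  assumes "f \<in> borel_measurable M" "\<And>x. cmod (f x) \<le> B"
  shows "f \<in> L2 M"
proof -
  have "(cmod (f x))\<^sup>2 \<le> B\<^sup>2" for x
    using assms(2) by (intro power_mono) auto
  then have "integrable M (\<lambda>x. (cmod (f x))\<^sup>2)"
    using assms(1) by (intro integrable_const_bound[where B="B\<^sup>2"]) auto
  then show ?thesis using assms(1) by (simp add: L2_def)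
qed

lemma (in pair_sigma_finite) integrable_bounded_kernel:
  fixes f :: "_ \<Rightarrow> complex" and g :: "_ \<Rightarrow> complex"
  assumes f: "integrable M1 f" and g: "integrable M2 g"
    and k: "(\<lambda>(x, y). k x y) \<in> borel_measurable (M1 \<Otimes>\<^sub>M M2)"
    and kB: "\<And>x y. cmod (k x y) \<le> B"
  shows "integrable (M1 \<Otimes>\<^sub>M M2) (\<lambda>(x, y). f x * k x y * g y)"
proof -
  have [measurable]: "f \<in> borel_measurable M1" "g \<in> borel_measurable M2"
    using f g by auto
  have [measurable]: "(\<lambda>z. k (fst z) (snd z)) \<in> borel_measurable (M1 \<Otimes>\<^sub>M M2)"
    using k by (simp add: case_prod_beta')
  have fg: "integrable (M1 \<Otimes>\<^sub>M M2) (\<lambda>z. f (fst z) * g (snd z))"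
    by (rule Fubini_integrable) (use f g in \<open>auto simp: norm_mult\<close>)
  show ?thesis
  proof (rule Bochner_Integration.integrable_bound)
    show "integrable (M1 \<Otimes>\<^sub>M M2) (\<lambda>z. of_real B * (f (fst z) * g (snd z)))"
      using fg by auto
    have "0 \<le> B" using kB[of undefined undefined] norm_ge_zero order_trans by blast
    have "cmod (f x) * cmod (k x y) * cmod (g y) \<le> B * (cmod (f x) * cmod (g y))" for x y
      using mult_right_mono[OF kB[of x y], of "cmod (f x) * cmod (g y)"] by (simp add: mult_ac)
    then show "AE z in M1 \<Otimes>\<^sub>M M2. norm (case z of (x, y) \<Rightarrow> f x * k x y * g y)
        \<le> norm (of_real B * (f (fst z) * g (snd z)))"
      using \<open>0 \<le> B\<close> by (auto simp: norm_mult)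
  qed (simp add: case_prod_beta')
qed

text \<open>Applied with the oscillating exponential as \<open>k\<close>, to exchange the integral
  over space with the one over the sphere.\<close>

lemma (in pair_sigma_finite) Fubini_bounded_kernel:
  fixes f :: "_ \<Rightarrow> complex" and g :: "_ \<Rightarrow> complex"
  assumes f: "integrable M1 f" and g: "integrable M2 g"
    and k: "(\<lambda>(x, y). k x y) \<in> borel_measurable (M1 \<Otimes>\<^sub>M M2)"
    and kB: "\<And>x y. cmod (k x y) \<le> B"
  shows "(LINT x|M1. f x * (LINT y|M2. k x y * g y)) = (LINT y|M2. (LINT x|M1. f x * k x y) * g y)"
proof -
  have "(LINT x|M1. f x * (LINT y|M2. k x y * g y)) = (LINT x|M1. LINT y|M2. f x * k x y * g y)"
    by (simp add: mult.assoc)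
  also have "\<dots> = (LINT y|M2. LINT x|M1. f x * k x y * g y)"
    by (rule Fubini_integral[OF integrable_bounded_kernel[OF assms], symmetric])
  also have "\<dots> = (LINT y|M2. (LINT x|M1. f x * k x y) * g y)"
    by simp
  finally show ?thesis .
qed

lemma space_sphere_measure: "space sphere_measure = sphere 0 1"
  by (simp add: sphere_measure_def space_scale_measure)

lemma sets_sphere_measure: "sets sphere_measure = sets (restrict_space borel (sphere 0 1))"
  by (simp add: sphere_measure_def)

lemma borel_measurable_sphere_measure:
  "f \<in> borel_measurable borel \<Longrightarrow> f \<in> borel_measurable sphere_measure"
  unfolding measurable_cong_sets[OF sets_sphere_measure refl] by (rule measurable_restrict_space1)

lemma normalize_measurable_sphere:
  "(\<lambda>x::real^'n. x /\<^sub>R norm x) \<in>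
     restrict_space lborel (ball 0 1 - {0}) \<rightarrow>\<^sub>M restrict_space borel (sphere 0 1)"
proof (rule measurable_restrict_space2)
  show "(\<lambda>x::real^'n. x /\<^sub>R norm x) \<in> borel_measurable (restrict_space lborel (ball 0 1 - {0}))"
    by (rule measurable_restrict_space1) simp
qed (auto simp: space_restrict_space)

lemma nn_integral_sphere_measure:
  fixes f :: "real^'n \<Rightarrow> ennreal"
  assumes [measurable]: "f \<in> borel_measurable borel"
  shows "(\<integral>\<^sup>+\<theta>. f \<theta> \<partial>sphere_measure) =
    of_nat CARD('n) * (\<integral>\<^sup>+x. f (x /\<^sub>R norm x) * indicator (ball 0 1 - {0}) x \<partial>lborel)"
proof -
  have "f \<in> borel_measurable (restrict_space borel (sphere 0 1))"
    by (rule measurable_restrict_space1) simp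
  then have "(\<integral>\<^sup>+\<theta>. f \<theta> \<partial>sphere_measure) = of_nat CARD('n) *
      (\<integral>\<^sup>+x. f (x /\<^sub>R norm x) \<partial>restrict_space lborel (ball 0 1 - {0}))"
    unfolding sphere_measure_def
    by (subst nn_integral_scale_measure, simp)
      (subst nn_integral_distr[OF normalize_measurable_sphere], simp_all)
  then show ?thesis by (simp add: nn_integral_restrict_space)
qed

lemma finite_measure_sphere_measure: "finite_measure (sphere_measure :: (real^'n) measure)"
proof
  have "emeasure (sphere_measure :: (real^'n) measure) (space sphere_measure)
      = (\<integral>\<^sup>+\<theta>. 1 \<partial>(sphere_measure :: (real^'n) measure))" by simp
  also have "\<dots> = of_nat CARD('n) * emeasure lborel (ball 0 1 - {0} :: (real^'n) set)"
    by (subst nn_integral_sphere_measure) auto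
  also have "\<dots> \<le> of_nat CARD('n) * emeasure lborel (ball 0 1 :: (real^'n) set)"
    by (intro mult_left_mono emeasure_mono) auto
  also have "\<dots> < \<infinity>"
    using emeasure_lborel_ball_finite[of "0::real^'n" 1]
    by (simp add: ennreal_mult_less_top of_nat_less_top)
  finally show "emeasure (sphere_measure :: (real^'n) measure) (space sphere_measure) \<noteq> \<infinity>" by simp
qed

definition F_kernel :: "real \<Rightarrow> (real^'n::finite \<Rightarrow> complex) \<Rightarrow> real^'n \<Rightarrow> real^'n \<Rightarrow> complex" where
  "F_kernel \<kappa> h y \<theta> = of_real (\<kappa> powr ((real CARD('n) - 1) / 2)) *
     (LINT x|lborel. h x * exp (\<i> * of_real (\<kappa> * ((\<theta> - y) \<bullet> x))))"

lemma borel_measurable_F_kernel: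
  assumes "integrable lborel h"
  shows "(\<lambda>(y, \<theta>). F_kernel \<kappa> h y \<theta>) \<in> borel_measurable (borel \<Otimes>\<^sub>M borel)"
proof -
  have [measurable]: "h \<in> borel_measurable borel" using assms by auto
  have "(\<lambda>z. LINT x|lborel. h x * exp (\<i> * of_real (\<kappa> * ((snd z - fst z) \<bullet> x))))
      \<in> borel_measurable (borel \<Otimes>\<^sub>M borel)"
    by (rule lborel.borel_measurable_lebesgue_integral) (simp add: case_prod_beta')
  then show ?thesis by (simp add: F_kernel_def case_prod_beta')
qed

text \<open>By Fubini the integral operator with kernel \<open>F_kernel\<close> solves the defining
  identity, so the choice in \<open>F_op\<close> yields a solution. Two solutions have the same
  inner product with every member of \<open>L2\<close>, in particular with each other, and hence the
  same norm.\<close>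

lemma F_op_norm:
  fixes h :: "real^'n \<Rightarrow> complex"
  assumes h: "integrable lborel h" and supp: "\<And>x. x \<notin> ball 0 1 \<Longrightarrow> h x = 0"
    and f: "f \<in> L2 sphere_measure"
  shows "L2_norm sphere_measure (F_op \<kappa> h f) =
    L2_norm sphere_measure (\<lambda>y. LINT \<theta>|sphere_measure. F_kernel \<kappa> h y \<theta> * f \<theta>)"
proof -
  interpret S: finite_measure "sphere_measure :: (real^'n) measure"
    by (rule finite_measure_sphere_measure)
  interpret P: pair_sigma_finite "lborel :: (real^'n) measure" "sphere_measure :: (real^'n) measure" ..
  define c where "c = (of_real (\<kappa> powr ((real CARD('n) - 1) / 2)) :: complex)"
  define E where "E \<theta> x = exp (\<i> * of_real (\<kappa> * (\<theta> \<bullet> x)))" for \<theta> x :: "real^'n"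
  have E1: "cmod (E \<theta> x) = 1" for \<theta> x by (simp add: E_def)
  have cE: "cnj (E \<theta> x) = E (-\<theta>) x" for \<theta> x
    by (simp add: E_def exp_cnj)
  have Ed: "E (\<theta> - y) x = E (-y) x * E \<theta> x" for \<theta> y x
    by (simp add: E_def algebra_simps inner_diff_left flip: exp_add)
  have idm: "(\<lambda>x. x) \<in> (sphere_measure :: (real^'n) measure) \<rightarrow>\<^sub>M borel"
    by (rule borel_measurable_sphere_measure) simp
  have Em[measurable]: "(\<lambda>z. E (fst z) (snd z)) \<in> borel_measurable (borel \<Otimes>\<^sub>M borel)"
    "(\<lambda>z. E (- fst z) (snd z)) \<in> borel_measurable (borel \<Otimes>\<^sub>M borel)"
    unfolding E_def by measurable
  have pairm: "(\<lambda>z. (snd z, fst z)) \<in> (lborel :: (real^'n) measure) \<Otimes>\<^sub>M (sphere_measure :: (real^'n) measure) \<rightarrow>\<^sub>M borel \<Otimes>\<^sub>M borel"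
    using measurable_compose[OF measurable_snd idm] by (intro measurable_Pair) auto
  have E1m: "(\<lambda>(x, \<theta>). E \<theta> x) \<in> borel_measurable (lborel \<Otimes>\<^sub>M sphere_measure)"
    using measurable_compose[OF pairm Em(1)] by (simp add: case_prod_beta')
  have E2m: "(\<lambda>(x, \<theta>). E (-\<theta>) x) \<in> borel_measurable (lborel \<Otimes>\<^sub>M sphere_measure)"
    using measurable_compose[OF pairm Em(2)] by (simp add: case_prod_beta')
  have [measurable]: "h \<in> borel_measurable borel" using h by auto
  have hE: "integrable lborel (\<lambda>x. h x * E y x)" for y
    by (rule Bochner_Integration.integrable_bound[OF h]) (auto simp: norm_mult E1 E_def[abs_def])
  have Peq: "P_op \<kappa> g x = (LINT \<theta>|sphere_measure. E \<theta> x * g \<theta>)" for g x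
    by (simp add: P_op_def E_def)
  have fint: "integrable sphere_measure f" by (rule S.L2_integrable[OF f])
  define u where "u y = (LINT \<theta>|sphere_measure. F_kernel \<kappa> h y \<theta> * f \<theta>)" for y
  have u_eq: "u y = c * (LINT x|lborel. h x * P_op \<kappa> f x * E (-y) x)" for y
  proof -
    have "u y = (LINT \<theta>|sphere_measure. c * ((LINT x|lborel. (h x * E (-y) x) * E \<theta> x) * f \<theta>))"
      by (simp only: u_def F_kernel_def c_def[symmetric] E_def[symmetric] Ed mult.assoc)
    also have "\<dots> = c * (LINT \<theta>|sphere_measure. (LINT x|lborel. (h x * E (-y) x) * E \<theta> x) * f \<theta>)"
      by simp
    also have "\<dots> = c * (LINT x|lborel. (h x * E (-y) x) * (LINT \<theta>|sphere_measure. E \<theta> x * f \<theta>))"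
      by (subst P.Fubini_bounded_kernel[OF hE fint E1m, of 1]) (auto simp: E1)
    finally show ?thesis by (simp add: Peq mult_ac)
  qed
  have Pbound: "cmod (P_op \<kappa> f x) \<le> (LINT \<theta>|sphere_measure. cmod (f \<theta>))" for x
    unfolding Peq by (rule order_trans[OF integral_norm_bound]) (simp add: norm_mult E1)
  have Pm: "P_op \<kappa> f \<in> borel_measurable lborel"
  proof -
    have [measurable]: "f \<in> borel_measurable sphere_measure" using f by (rule L2_measurable)
    have [measurable]: "(\<lambda>z. E (snd z) (fst z)) \<in> borel_measurable (lborel \<Otimes>\<^sub>M sphere_measure)"
      using E1m by (simp add: case_prod_beta')
    show ?thesis unfolding Peq[abs_def]
      by (rule S.borel_measurable_lebesgue_integral) (simp add: case_prod_beta')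
  qed
  have hP: "integrable lborel (\<lambda>x. h x * P_op \<kappa> f x)"
  proof (rule Bochner_Integration.integrable_bound)
    let ?B = "LINT \<theta>|sphere_measure. cmod (f \<theta>)"
    show "integrable lborel (\<lambda>x. of_real ?B * h x)" using h by auto
    show "AE x in lborel. norm (h x * P_op \<kappa> f x) \<le> norm (of_real ?B * h x)"
      using mult_left_mono[OF Pbound norm_ge_zero] by (auto simp: norm_mult mult.commute)
    show "(\<lambda>x. h x * P_op \<kappa> f x) \<in> borel_measurable lborel" using Pm by measurable
  qed
  have inner_u: "L2_inner sphere_measure u g =
      c * (LINT x:ball 0 1|lborel. h x * P_op \<kappa> f x * cnj (P_op \<kappa> g x))"
    if g: "g \<in> L2 sphere_measure" for g
  proof -
    have gint: "integrable sphere_measure (\<lambda>y. cnj (g y))"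
      using S.L2_integrable[OF g] by simp
    have "L2_inner sphere_measure u g =
        (LINT y|sphere_measure. c * ((LINT x|lborel. (h x * P_op \<kappa> f x) * E (-y) x) * cnj (g y)))"
      by (simp add: L2_inner_def u_eq mult.assoc)
    also have "\<dots> = c * (LINT y|sphere_measure. (LINT x|lborel. (h x * P_op \<kappa> f x) * E (-y) x) * cnj (g y))"
      by simp
    also have "\<dots> = c * (LINT x|lborel. (h x * P_op \<kappa> f x) * (LINT y|sphere_measure. E (-y) x * cnj (g y)))"
      by (subst P.Fubini_bounded_kernel[OF hP gint E2m, of 1]) (auto simp: E1)
    also have "(\<lambda>x. LINT y|sphere_measure. E (-y) x * cnj (g y)) = (\<lambda>x. cnj (P_op \<kappa> g x))"
      unfolding Peq Bochner_Integration.integral_cnj[symmetric] complex_cnj_mult cE ..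
    also have "(LINT x|lborel. (h x * P_op \<kappa> f x) * cnj (P_op \<kappa> g x)) =
        (LINT x:ball 0 1|lborel. h x * P_op \<kappa> f x * cnj (P_op \<kappa> g x))"
      unfolding set_lebesgue_integral_def
      by (rule Bochner_Integration.integral_cong) (auto simp: indicator_def supp)
    finally show ?thesis .
  qed
  have uL2: "u \<in> L2 sphere_measure"
  proof -
    have "u \<in> borel_measurable sphere_measure"
    proof -
      have [measurable]: "P_op \<kappa> f \<in> borel_measurable borel" using Pm by simp
      have "(\<lambda>z. (fst z, snd z)) \<in> (sphere_measure :: (real^'n) measure) \<Otimes>\<^sub>M (lborel :: (real^'n) measure) \<rightarrow>\<^sub>M borel \<Otimes>\<^sub>M borel"
        using measurable_compose[OF measurable_fst idm] by (intro measurable_Pair) auto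
      from measurable_compose[OF this Em(2)]
      have [measurable]: "(\<lambda>z. E (- fst z) (snd z)) \<in> borel_measurable (sphere_measure \<Otimes>\<^sub>M lborel)" by simp
      have "(\<lambda>y. LINT x|lborel. h x * P_op \<kappa> f x * E (-y) x) \<in> borel_measurable sphere_measure"
        by (rule lborel.borel_measurable_lebesgue_integral) (simp add: case_prod_beta')
      then show ?thesis unfolding u_eq[abs_def] by measurable
    qed
    moreover have "cmod (u y) \<le> cmod c * (LINT x|lborel. cmod (h x * P_op \<kappa> f x))" for y
      unfolding u_eq norm_mult[of c]
      by (intro mult_left_mono order_trans[OF integral_norm_bound]) (auto simp: norm_mult E1)
    ultimately show ?thesis by (rule S.L2_bounded)
  qed
  define v where "v = F_op \<kappa> h f"
  have v: "v \<in> L2 sphere_measure \<and> (\<forall>g\<in>L2 sphere_measure. L2_inner sphere_measure v g =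
      c * (LINT x:ball 0 1|lborel. h x * P_op \<kappa> f x * cnj (P_op \<kappa> g x)))"
    unfolding v_def F_op_def c_def[symmetric]
    by (rule someI[of _ u]) (use uL2 inner_u in auto)
  have vu: "L2_inner sphere_measure v g = L2_inner sphere_measure u g"
    if "g \<in> L2 sphere_measure" for g
    using v inner_u that by simp
  \<comment> \<open>Replace \<open>v\<close> by \<open>u\<close> in one argument at a time;
    conjugation brings the other argument to the left.\<close>
  have "L2_inner sphere_measure v v = L2_inner sphere_measure u v" using vu v by blast
  also have "\<dots> = cnj (L2_inner sphere_measure v u)" by (simp add: L2_inner_cnj)
  also have "\<dots> = cnj (L2_inner sphere_measure u u)" using vu uL2 by simp
  also have "\<dots> = L2_inner sphere_measure u u" by (simp add: L2_inner_cnj)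
  finally have "(L2_norm sphere_measure v)\<^sup>2 = (L2_norm sphere_measure u)\<^sup>2"
    unfolding L2_inner_self of_real_eq_iff .
  then have "L2_norm sphere_measure v = L2_norm sphere_measure u"
    by (simp add: L2_norm_nonneg)
  then show ?thesis unfolding v_def u_def[abs_def] .
qed

lemma HS_norm_F_op_le:
  fixes h :: "real^'n \<Rightarrow> complex"
  assumes h: "integrable lborel h" and supp: "\<And>x. x \<notin> ball 0 1 \<Longrightarrow> h x = 0"
    and C: "\<And>y. y \<in> sphere 0 1 \<Longrightarrow> (LINT \<theta>|sphere_measure. (cmod (F_kernel \<kappa> h y \<theta>))\<^sup>2) \<le> C"
    and "C \<ge> 0"
  shows "HS_norm sphere_measure (F_op \<kappa> h) \<le>
    sqrt (C * measure (sphere_measure :: (real^'n) measure) (sphere 0 1))"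
proof -
  interpret S: finite_measure "sphere_measure :: (real^'n) measure"
    by (rule finite_measure_sphere_measure)
  have idm: "(\<lambda>x. x) \<in> (sphere_measure :: (real^'n) measure) \<rightarrow>\<^sub>M borel"
    by (rule borel_measurable_sphere_measure) simp
  have Km: "(\<lambda>z. F_kernel \<kappa> h (fst z) (snd z)) \<in> borel_measurable (borel \<Otimes>\<^sub>M borel)"
    using borel_measurable_F_kernel[OF h] by (simp add: case_prod_beta')
  have "(\<lambda>z. (fst z, snd z)) \<in> (sphere_measure :: (real^'n) measure) \<Otimes>\<^sub>M (sphere_measure :: (real^'n) measure) \<rightarrow>\<^sub>M borel \<Otimes>\<^sub>M borel"
    using measurable_compose[OF measurable_fst idm] measurable_compose[OF measurable_snd idm]
    by (intro measurable_Pair) auto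
  from measurable_compose[OF this Km]
  have K: "(\<lambda>(y, \<theta>). F_kernel \<kappa> h y \<theta>) \<in> borel_measurable (sphere_measure \<Otimes>\<^sub>M sphere_measure)"
    by (simp add: case_prod_beta')
  have KL2: "F_kernel \<kappa> h y \<in> L2 sphere_measure" for y
  proof -
    have "F_kernel \<kappa> h y \<in> borel_measurable borel"
      using measurable_compose[OF _ Km, of "\<lambda>\<theta>. (y, \<theta>)"] by simp
    then have [measurable]: "F_kernel \<kappa> h y \<in> borel_measurable sphere_measure"
      by (rule borel_measurable_sphere_measure)
    define B where "B = \<kappa> powr ((real CARD('n) - 1) / 2) * (LINT x|lborel. cmod (h x))"
    have "cmod (F_kernel \<kappa> h y \<theta>) \<le> B" for \<theta>
      unfolding F_kernel_def norm_mult B_def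
      by (intro mult_mono order_trans[OF integral_norm_bound]) (auto simp: norm_mult)
    then show ?thesis by (intro S.L2_bounded) auto
  qed
  have "HS_norm sphere_measure (F_op \<kappa> h) \<le>
      sqrt (C * measure (sphere_measure :: (real^'n) measure) (space sphere_measure))"
    by (rule HS_norm_integral_operator_le[OF S.finite_measure_axioms K KL2])
      (use C \<open>C \<ge> 0\<close> F_op_norm[OF h supp] in \<open>auto simp: space_sphere_measure\<close>)
  then show ?thesis by (simp add: space_sphere_measure)
qed

section \<open>Test functions and uniqueness of weak derivatives\<close>

text \<open>The function exp(-1/x), extended by zero and multiplied by a polynomial in 1/x. All
  derivatives of exp(-1/x) have this form, so carrying the polynomial along makes the family closed
  under differentiation.\<close>

definition flat :: "real poly \<Rightarrow> real \<Rightarrow> real" where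
  "flat p x = (if x > 0 then poly p (1 / x) * exp (- (1 / x)) else 0)"

lemma poly_times_exp_minus_tendsto_0: "((\<lambda>y. poly p y * exp (- y)) \<longlongrightarrow> (0::real)) at_top"
proof -
  have "((\<lambda>y. \<Sum>i\<le>degree p. coeff p i * (y ^ i / exp y)) \<longlongrightarrow> (\<Sum>i\<le>degree p. coeff p i * 0)) at_top"
    by (intro tendsto_intros tendsto_power_div_exp_0)
  moreover have "(\<Sum>i\<le>degree p. coeff p i * (y ^ i / exp y)) = poly p y * exp (- y)" for y
    by (simp add: poly_altdef sum_distrib_right exp_minus divide_inverse mult.assoc)
  ultimately show ?thesis by simp
qed

lemma flat_tendsto_0: "(flat p \<longlongrightarrow> 0) (at 0)"
proof (rule filterlim_split_at)
  have "((\<lambda>x. poly p (inverse x) * exp (- inverse x)) \<longlongrightarrow> 0) (at_right 0)"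
    by (rule filterlim_compose[OF poly_times_exp_minus_tendsto_0 filterlim_inverse_at_top_right])
  then show "(flat p \<longlongrightarrow> 0) (at_right 0)"
    by (rule Lim_transform_eventually) (auto simp: flat_def eventually_at_filter inverse_eq_divide)
  show "(flat p \<longlongrightarrow> 0) (at_left 0)"
    by (rule Lim_transform_eventually[OF tendsto_const]) (auto simp: flat_def eventually_at_filter)
qed

text \<open>In terms of y = 1/x the chain rule turns p into y^2 (p - p'). At 0 the division in the
  difference quotient is absorbed into the polynomial, and the quotient tends to 0 because exp(-y)
  beats every polynomial.\<close>

lemma flat_has_real_derivative:
  "(flat p has_real_derivative flat (monom 1 2 * (p - pderiv p)) x) (at x)"
proof (cases "x = 0")
  case True
  have "(\<lambda>h. (flat p (0 + h) - flat p 0) / h) = flat (pCons 0 p)"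
    by (auto simp: flat_def fun_eq_iff field_simps)
  then show ?thesis
    using flat_tendsto_0[of "pCons 0 p"] True unfolding has_field_derivative_iff
    by (simp add: flat_def)
next
  case False
  show ?thesis
  proof (cases "x > 0")
    case True
    have "((\<lambda>x. poly p (1 / x) * exp (- (1 / x))) has_real_derivative
        flat (monom 1 2 * (p - pderiv p)) x) (at x)"
      using True
      by (auto intro!: derivative_eq_intros DERIV_chain2[of "poly p"] poly_DERIV
          simp: flat_def poly_monom field_simps power2_eq_square)
    then show ?thesis
      by (rule has_field_derivative_transform_within_open[where S="{0<..}"])
        (use True in \<open>auto simp: flat_def\<close>)
  next
    case nonpos: False
    have "((\<lambda>x. 0) has_real_derivative flat (monom 1 2 * (p - pderiv p)) x) (at x)"
      using nonpos by (auto simp: flat_def)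
    then show ?thesis
      by (rule has_field_derivative_transform_within_open[where S="{..<0}"])
        (use False nonpos in \<open>auto simp: flat_def\<close>)
  qed
qed

text \<open>An algebra with one-variable generators that is closed under partial derivatives.
  Membership therefore gives \<open>C_k\<close> for every \<open>k\<close> by induction, without
  formulas for higher derivatives. The affine argument allows shifts, scalings and
  reflections.\<close>

inductive_set flat_algebra :: "(real^'n::finite \<Rightarrow> complex) set" where
  const: "(\<lambda>x. c) \<in> flat_algebra"
| flat: "(\<lambda>x. of_real (flat p (a * x $ i + b))) \<in> flat_algebra"
| add: "f \<in> flat_algebra \<Longrightarrow> g \<in> flat_algebra \<Longrightarrow> (\<lambda>x. f x + g x) \<in> flat_algebra"
| mult: "f \<in> flat_algebra \<Longrightarrow> g \<in> flat_algebra \<Longrightarrow> (\<lambda>x. f x * g x) \<in> flat_algebra"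

lemma flat_algebra_has_derivative:
  fixes f :: "real^'n \<Rightarrow> complex"
  assumes "f \<in> flat_algebra"
  shows "\<exists>f'. (\<forall>x. (f has_derivative f' x) (at x)) \<and> (\<forall>j. (\<lambda>x. f' x (axis j 1)) \<in> flat_algebra)"
  using assms
proof induction
  case (const c)
  show ?case
    by (rule exI[of _ "\<lambda>x v. 0"]) (auto intro: flat_algebra.const)
next
  case (flat p a i b)
  define q where "q = monom 1 2 * (p - pderiv p)"
  have "((\<lambda>x. of_real (flat p (a * x $ i + b))) has_derivative
      (\<lambda>v. of_real (flat q (a * x $ i + b)) * of_real (a * v $ i))) (at x)" for x :: "real^'n"
  proof -
    have 1: "(flat p has_derivative (\<lambda>v. flat q (a * x $ i + b) * v)) (at (a * x $ i + b))"
      using flat_has_real_derivative[of p "a * x $ i + b"] by (simp only: q_def has_field_derivative_def)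
    have 2: "((\<lambda>x. a * x $ i + b) has_derivative (\<lambda>v. a * v $ i)) (at x)"
      by (auto intro!: derivative_eq_intros bounded_linear_imp_has_derivative bounded_linear_vec_nth)
    have "((\<lambda>x. flat p (a * x $ i + b)) has_derivative (\<lambda>v. flat q (a * x $ i + b) * (a * v $ i))) (at x)"
      using has_derivative_compose[OF 2 1] by simp
    from has_derivative_of_real[OF this] show ?thesis by simp
  qed
  moreover have "(\<lambda>x. of_real (flat q (a * x $ i + b)) * of_real (a * (axis j 1 :: real^'n) $ i)) \<in> flat_algebra" for j
    by (intro flat_algebra.intros)
  ultimately show ?case
    by (intro exI[of _ "\<lambda>x v. of_real (flat q (a * x $ i + b)) * of_real (a * v $ i)"]) blast
next
  case (add f g)
  then obtain f' g' where
    "\<And>x. (f has_derivative f' x) (at x)" "\<And>j. (\<lambda>x. f' x (axis j 1)) \<in> flat_algebra"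
    "\<And>x. (g has_derivative g' x) (at x)" "\<And>j. (\<lambda>x. g' x (axis j 1)) \<in> flat_algebra" by blast
  then show ?case
    by (intro exI[of _ "\<lambda>x v. f' x v + g' x v"])
      (auto intro: flat_algebra.add has_derivative_add)
next
  case (mult f g)
  then obtain f' g' where
    "\<And>x. (f has_derivative f' x) (at x)" "\<And>j. (\<lambda>x. f' x (axis j 1)) \<in> flat_algebra"
    "\<And>x. (g has_derivative g' x) (at x)" "\<And>j. (\<lambda>x. g' x (axis j 1)) \<in> flat_algebra" by blast
  with mult.hyps show ?case
    by (intro exI[of _ "\<lambda>x v. f x * g' x v + f' x v * g x"] conjI allI has_derivative_mult
        flat_algebra.add flat_algebra.mult)
qed

lemma flat_algebra_C_k: "f \<in> flat_algebra \<Longrightarrow> C_k k f"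
proof (induction k arbitrary: f)
  case 0
  then obtain f' where "\<And>x. (f has_derivative f' x) (at x)"
    using flat_algebra_has_derivative by blast
  then show ?case
    by (auto intro!: continuous_at_imp_continuous_on has_derivative_continuous)
next
  case (Suc k)
  then obtain f' where f': "\<And>x. (f has_derivative f' x) (at x)"
    "\<And>j. (\<lambda>x. f' x (axis j 1)) \<in> flat_algebra"
    using flat_algebra_has_derivative by blast
  have "partial_deriv j f = (\<lambda>x. f' x (axis j 1))" for j
    using frechet_derivative_at[OF f'(1)] by (auto simp: partial_deriv_def fun_eq_iff)
  then show ?case
    using Suc.IH f' by (auto simp: differentiable_on_def differentiable_def intro: has_derivative_at_withinI)
qed

lemma flat_algebra_prod:
  "finite I \<Longrightarrow> (\<And>i. i \<in> I \<Longrightarrow> f i \<in> flat_algebra) \<Longrightarrow> (\<lambda>x. \<Prod>i\<in>I. f i x) \<in> flat_algebra"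
  by (induction I rule: finite_induct) (auto intro: flat_algebra.const flat_algebra.mult)

text \<open>Nonzero exactly inside the box. The factor \<open>Suc m\<close> steepens the walls, so
  that the bumps tend to the indicator of the box as \<open>m\<close> grows. The arguments are
  spelled out as affine functions of a coordinate to match the generators of
  \<open>flat_algebra\<close>.\<close>

definition box_bump :: "nat \<Rightarrow> real^'n \<Rightarrow> real^'n \<Rightarrow> real^'n::finite \<Rightarrow> complex" where
  "box_bump m a b x = (\<Prod>i\<in>UNIV. of_real (flat 1 (real (Suc m) * x $ i + (- real (Suc m) * a $ i))) *
     of_real (flat 1 (- real (Suc m) * x $ i + real (Suc m) * b $ i)))"

lemma flat_1_bounds: "0 \<le> flat 1 x" "flat 1 x \<le> 1"
  by (auto simp: flat_def)

lemma box_bump_outside: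
  assumes "x \<notin> box a b"
  shows "box_bump m a b x = 0"
proof -
  obtain i where "x $ i \<le> a $ i \<or> b $ i \<le> x $ i"
    using assms by (auto simp: mem_box_cart not_less)
  then have "real (Suc m) * x $ i \<le> real (Suc m) * a $ i \<or> real (Suc m) * b $ i \<le> real (Suc m) * x $ i"
    by (auto intro: mult_left_mono)
  then have "flat 1 (real (Suc m) * x $ i + (- real (Suc m) * a $ i)) = 0 \<or>
      flat 1 (- real (Suc m) * x $ i + real (Suc m) * b $ i) = 0"
    by (auto simp: flat_def simp del: of_nat_Suc)
  then show ?thesis
    unfolding box_bump_def by (intro prod_zero) (auto simp del: of_nat_Suc)
qed

lemma box_bump_le_1: "cmod (box_bump m a b x) \<le> 1"
  unfolding box_bump_def prod_norm[symmetric] norm_mult norm_of_real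
  by (intro prod_le_1) (auto intro!: mult_le_one simp: flat_1_bounds abs_of_nonneg simp del: of_nat_Suc)

lemma test_function_box_bump: "test_function (box_bump m a b)"
proof -
  have "box_bump m a b \<in> flat_algebra"
    unfolding box_bump_def[abs_def] by (intro flat_algebra_prod flat_algebra.intros) auto
  moreover have "{x. box_bump m a b x \<noteq> 0} \<subseteq> box a b"
    using box_bump_outside by blast
  then have "compact (closure {x. box_bump m a b x \<noteq> 0})"
    using bounded_box bounded_subset compact_closure by blast
  ultimately show ?thesis
    unfolding test_function_def using flat_algebra_C_k by blast
qed

lemma flat_scaled_tendsto:
  assumes "y > 0"
  shows "(\<lambda>m. flat 1 (real (Suc m) * y)) \<longlonglongrightarrow> 1"
proof -
  have "(\<lambda>m. exp (- (inverse (real (Suc m)) * (1 / y)))) \<longlonglongrightarrow> exp (- (0 * (1 / y)))"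
    by (intro tendsto_intros LIMSEQ_inverse_real_of_nat)
  moreover have "flat 1 (real (Suc m) * y) = exp (- (inverse (real (Suc m)) * (1 / y)))" for m
  proof -
    have "0 < real (Suc m) * y" using assms by simp
    then show ?thesis by (simp add: flat_def field_simps del: of_nat_Suc)
  qed
  ultimately show ?thesis by simp
qed

lemma box_bump_tendsto: "(\<lambda>m. box_bump m a b x) \<longlonglongrightarrow> indicator (box a b) x"
proof (cases "x \<in> box a b")
  case True
  have "(\<lambda>m. of_real (flat 1 (real (Suc m) * x $ i + (- real (Suc m) * a $ i))) *
     of_real (flat 1 (- real (Suc m) * x $ i + real (Suc m) * b $ i)) :: complex) \<longlonglongrightarrow> of_real 1 * of_real 1" for i
  proof (intro tendsto_mult tendsto_of_real)
    show "(\<lambda>m. flat 1 (real (Suc m) * x $ i + (- real (Suc m) * a $ i))) \<longlonglongrightarrow> 1"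
      using flat_scaled_tendsto[of "x $ i - a $ i"] True
      by (simp add: mem_box_cart algebra_simps)
    show "(\<lambda>m. flat 1 (- real (Suc m) * x $ i + real (Suc m) * b $ i)) \<longlonglongrightarrow> 1"
      using flat_scaled_tendsto[of "b $ i - x $ i"] True
      by (simp add: mem_box_cart algebra_simps)
  qed
  then have "(\<lambda>m. box_bump m a b x) \<longlonglongrightarrow> (\<Prod>i\<in>(UNIV::'a set). of_real 1 * of_real 1)"
    unfolding box_bump_def by (intro tendsto_prod) auto
  then show ?thesis using True by simp
qed (simp add: box_bump_outside)

section \<open>Square-integrable functions orthogonal to all test functions\<close>

lemma indicator_L2: "A \<in> sets M \<Longrightarrow> emeasure M A < \<infinity> \<Longrightarrow> (indicator A :: _ \<Rightarrow> complex) \<in> L2 M"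
proof -
  assume *: "A \<in> sets M" "emeasure M A < \<infinity>"
  have "(\<lambda>x. (cmod (indicator A x))\<^sup>2) = (indicator A :: _ \<Rightarrow> real)"
    by (auto simp: indicator_def fun_eq_iff)
  then show ?thesis using * by (auto simp: L2_def)
qed

text \<open>Boxes are stable under intersection and generate the Borel sets, so vanishing integrals
  pass from boxes to all Borel sets, which forces the function to vanish almost everywhere. The
  argument is run on the bounded boxes \<open>B R\<close>, since an \<open>L2\<close> function on
  the whole space may fail to be integrable; countably many of them cover the space.\<close>

lemma AE_0_if_box_integrals_0:
  fixes d :: "real^'n \<Rightarrow> complex"
  assumes dL2: "d \<in> L2 lborel"
    and box0: "\<And>a b. (LINT x|lborel. indicator (box a b) x * d x) = 0"
  shows "AE x in lborel. d x = 0"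
proof -
  define B where "B R = (box (- (real R *\<^sub>R One)) (real R *\<^sub>R One) :: (real^'n) set)" for R
  have dm[measurable]: "d \<in> borel_measurable borel" using L2_measurable[OF dL2] by simp
  have "AE x in lborel. indicator (B R) x * d x = 0" for R
  proof (rule sigma_finite_measure.density_zero[OF lborel.sigma_finite_measure_axioms])
    let ?f = "\<lambda>x. indicator (B R) x * d x :: complex"
    have "integrable lborel (\<lambda>x. d x * cnj (indicator (B R) x))"
      unfolding B_def by (intro L2_integrable_mult_cnj dL2 indicator_L2)
        (auto simp: emeasure_lborel_box_eq)
    moreover have "d x * cnj (indicator (B R) x) = ?f x" for x by (simp add: indicator_def)
    ultimately show f: "integrable lborel ?f" by simp
    have f0: "integral\<^sup>L lborel ?f = 0" unfolding B_def by (rule box0)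
    fix A :: "(real^'n) set" assume "A \<in> sets lborel"
    then have "A \<in> sets borel" by simp
    then have A: "A \<in> sigma_sets UNIV (range (\<lambda>(a, b). box a b))"
      unfolding borel_eq_box by simp
    have sets: "X \<in> sets lborel" if "X \<in> sigma_sets UNIV (range (\<lambda>(a, b). box a b :: (real^'n) set))" for X
      using that unfolding sets_lborel borel_eq_box by simp
    have "Int_stable (range (\<lambda>(a, b). box a b :: (real^'n) set))"
      by (auto simp: Int_stable_def box_Int_box)
    moreover have "range (\<lambda>(a, b). box a b :: (real^'n) set) \<subseteq> Pow UNIV" by auto
    ultimately show "set_lebesgue_integral lborel A ?f = 0"
      using A
    proof (induction rule: sigma_sets_induct_disjoint)
      case (basic X)
      then obtain a b where X: "X = box a b" by auto
      obtain c e where "box a b \<inter> B R = box c e" unfolding B_def box_Int_box by blast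
      then have "indicator X x *\<^sub>R ?f x = indicator (box c e) x * d x" for x
        unfolding X by (auto simp: indicator_def)
      then show ?case unfolding set_lebesgue_integral_def by (simp add: box0)
    next
      case empty
      then show ?case by (simp add: set_lebesgue_integral_def)
    next
      case (compl X)
      have "indicator (UNIV - X) x *\<^sub>R ?f x = ?f x - indicator X x *\<^sub>R ?f x" for x
        by (simp add: indicator_def)
      moreover have "integrable lborel (\<lambda>x. indicator X x *\<^sub>R ?f x)"
        by (intro integrable_mult_indicator f sets compl)
      ultimately show ?case
        using compl f f0 unfolding set_lebesgue_integral_def by simp
    next
      case (union X)
      have "(LINT x:(\<Union>i. X i)|lborel. ?f x) = (\<Sum>i. LINT x:X i|lborel. ?f x)"
      proof (rule lebesgue_integral_countable_add)
        show "X i \<in> sets lborel" for i using union by (intro sets) auto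
        then show "set_integrable lborel (\<Union>i. X i) ?f"
          unfolding set_integrable_def by (intro integrable_mult_indicator f) auto
      qed (use union in \<open>auto simp: disjoint_family_on_def\<close>)
      then show ?case using union by simp
    qed
  qed
  then have "AE x in lborel. \<forall>R. indicator (B R) x * d x = 0" unfolding AE_all_countable ..
  then show ?thesis
  proof eventually_elim
    case (elim x)
    have "x \<in> (\<Union>R. B R)" unfolding B_def UN_box_eq_UNIV by simp
    then obtain R where "x \<in> B R" by blast
    then show ?case using elim[rule_format, of R] by simp
  qed
qed

text \<open>The bumps are bounded by 1 and converge to the indicator of a box, so dominated
  convergence, with |d| on the box as majorant, reduces the claim to integrals over boxes.\<close>

lemma AE_0_if_test_integrals_0:
  fixes d :: "real^'n \<Rightarrow> complex"
  assumes dL2: "d \<in> L2 lborel"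
    and d0: "\<And>\<phi>. test_function \<phi> \<Longrightarrow> (LINT x|lborel. d x * \<phi> x) = 0"
  shows "AE x in lborel. d x = 0"
proof (rule AE_0_if_box_integrals_0[OF dL2])
  fix a b :: "real^'n"
  have dm[measurable]: "d \<in> borel_measurable borel" using L2_measurable[OF dL2] by simp
  have bm[measurable]: "box_bump m a b \<in> borel_measurable borel" for m
    using test_function_box_bump[of m a b] unfolding test_function_def
    by (metis C_k.simps(1) borel_measurable_continuous_onI)
  have "(\<lambda>m. LINT x|lborel. d x * box_bump m a b x) \<longlonglongrightarrow> (LINT x|lborel. d x * indicator (box a b) x)"
  proof (rule integral_dominated_convergence)
    show "integrable lborel (\<lambda>x. cmod (d x * cnj (indicator (box a b) x)))"
      by (intro integrable_norm L2_integrable_mult_cnj dL2 indicator_L2) (auto simp: emeasure_lborel_box_eq)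
    show "AE x in lborel. (\<lambda>m. d x * box_bump m a b x) \<longlonglongrightarrow> d x * indicator (box a b) x"
      by (intro AE_I2 tendsto_intros box_bump_tendsto)
    show "AE x in lborel. norm (d x * box_bump m a b x) \<le> cmod (d x * cnj (indicator (box a b) x))" for m
    proof (intro AE_I2)
      fix x
      show "norm (d x * box_bump m a b x) \<le> cmod (d x * cnj (indicator (box a b) x))"
        using mult_left_mono[OF box_bump_le_1[of m a b x] norm_ge_zero[of "d x"]]
        by (cases "x \<in> box a b") (auto simp: norm_mult box_bump_outside)
    qed
  qed auto
  moreover have "(LINT x|lborel. d x * box_bump m a b x) = 0" for m
    by (intro d0 test_function_box_bump)
  ultimately have "(LINT x|lborel. d x * indicator (box a b) x) = 0"
    by (simp add: LIMSEQ_const_iff)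
  then show "(LINT x|lborel. indicator (box a b) x * d x) = 0"
    by (simp add: mult.commute)
qed

lemma test_function_L2:
  fixes \<phi> :: "real^'n \<Rightarrow> complex"
  assumes "test_function \<phi>"
  shows "\<phi> \<in> L2 lborel" "integrable lborel \<phi>"
proof -
  have cont: "continuous_on UNIV \<phi>"
    using assms unfolding test_function_def by (metis C_k.simps(1))
  define S where "S = closure {x. \<phi> x \<noteq> 0}"
  have S: "compact S" using assms by (simp add: test_function_def S_def)
  have 0: "\<phi> x = 0" if "x \<notin> S" for x
    using that closure_subset[of "{x. \<phi> x \<noteq> 0}"] by (auto simp: S_def)
  have c: "continuous_on S \<phi>" using cont continuous_on_subset by blast
  have "integrable lborel (\<lambda>x. indicator S x *\<^sub>R \<phi> x)"
    using borel_integrable_compact[OF S c] by (simp add: set_integrable_def)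
  moreover have "indicator S x *\<^sub>R \<phi> x = \<phi> x" for x using 0 by (auto simp: indicator_def)
  ultimately show "integrable lborel \<phi>" by simp
  have "continuous_on S (\<lambda>x. (cmod (\<phi> x))\<^sup>2)" by (intro continuous_intros c)
  from borel_integrable_compact[OF S this]
  have "integrable lborel (\<lambda>x. indicator S x *\<^sub>R (cmod (\<phi> x))\<^sup>2)"
    by (simp add: set_integrable_def)
  moreover have "(\<lambda>x. indicator S x *\<^sub>R (cmod (\<phi> x))\<^sup>2) = (\<lambda>x. (cmod (\<phi> x))\<^sup>2)"
    using 0 by (auto simp: indicator_def fun_eq_iff)
  ultimately have "integrable lborel (\<lambda>x. (cmod (\<phi> x))\<^sup>2)" by (simp only:)
  then show "\<phi> \<in> L2 lborel"
    using cont by (auto simp: L2_def borel_measurable_continuous_onI)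
qed

text \<open>Frees weak derivatives from the choice in \<open>weak_deriv\<close>: two candidates
  differ by a function orthogonal to all test functions.\<close>

lemma L2_norm_weak_deriv:
  fixes f g :: "real^'n \<Rightarrow> complex"
  assumes g: "g \<in> L2 lborel" "is_weak_deriv i f g"
  shows "L2_norm lborel (weak_deriv i f) = L2_norm lborel g"
proof -
  define w where "w = weak_deriv i f"
  have "w \<in> L2 lborel \<and> is_weak_deriv i f w"
    unfolding w_def weak_deriv_def by (rule someI[of _ g]) (use g in auto)
  then have w: "w \<in> L2 lborel" "is_weak_deriv i f w" by auto
  have "AE x in lborel. w x - g x = 0"
  proof (rule AE_0_if_test_integrals_0)
    show "(\<lambda>x. w x - g x) \<in> L2 lborel" by (intro L2_diff w g)
    fix \<phi> :: "real^'n \<Rightarrow> complex" assume \<phi>: "test_function \<phi>"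
    have int: "integrable lborel (\<lambda>x. u x * \<phi> x)" if "u \<in> L2 lborel" for u
      using L2_integrable_mult_cnj[OF that L2_cnj[OF test_function_L2(1)[OF \<phi>]]] by simp
    have "(LINT x|lborel. w x * \<phi> x) = (LINT x|lborel. g x * \<phi> x)"
      using w(2) g(2) \<phi> unfolding is_weak_deriv_def by (metis neg_equal_iff_equal)
    then show "(LINT x|lborel. (w x - g x) * \<phi> x) = 0"
      by (simp add: left_diff_distrib int w g)
  qed
  then have "AE x in lborel. w x = g x" by auto
  then show ?thesis unfolding w_def[symmetric]
    by (intro L2_norm_cong_AE L2_measurable w g)
qed

section \<open>Integration of products and decay on the sphere\<close>

lemma prod_Basis_cart: "(\<Prod>b\<in>(Basis :: (real^'n) set). g b) = (\<Prod>i\<in>UNIV. g (axis i 1))"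
proof -
  have B: "(Basis :: (real^'n) set) = (\<lambda>i. axis i 1) ` UNIV"
    by (auto simp: Basis_vec_def)
  have "inj (\<lambda>i. axis i 1 :: real^'n)"
    by (auto simp: inj_on_def axis_eq_axis)
  then show ?thesis unfolding B by (subst prod.reindex) auto
qed

lemma integral_lborel_cart_prod:
  fixes f :: "'n::finite \<Rightarrow> real \<Rightarrow> 'a::{real_normed_field,banach,second_countable_topology}"
  assumes int: "\<And>i. integrable lborel (f i)"
  shows "(LINT x|lborel. (\<Prod>i\<in>UNIV. f i ((x::real^'n) $ i))) = (\<Prod>i\<in>UNIV. (LINT t|lborel. f i t))"
proof -
  interpret P: product_sigma_finite "\<lambda>b::real^'n. lborel :: real measure" ..
  define F where "F b = f (axis_index b)" for b :: "real^'n"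
  define T where "T = (\<lambda>u. \<Sum>b\<in>(Basis :: (real^'n) set). u b *\<^sub>R b :: real^'n)"
  have [measurable]: "f i \<in> borel_measurable borel" for i
    using int[of i] by auto
  have T[measurable]: "T \<in> (\<Pi>\<^sub>M b\<in>Basis. lborel) \<rightarrow>\<^sub>M borel"
    unfolding T_def by measurable
  have eq: "(\<Prod>i\<in>UNIV. f i (x $ i)) = (\<Prod>b\<in>Basis. F b (x \<bullet> b))" for x :: "real^'n"
    unfolding prod_Basis_cart by (simp add: F_def inner_axis)
  have TF: "(\<Prod>b\<in>Basis. F b (T u \<bullet> b)) = (\<Prod>b\<in>Basis. F b (u b))" for u
    by (rule prod.cong) (auto simp: T_def inner_sum_left_Basis)
  have Fint: "integrable lborel (F b)" for b unfolding F_def by (rule int)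
  have m: "(\<lambda>x::real^'n. \<Prod>i\<in>UNIV. f i (x $ i)) \<in> borel_measurable borel" by measurable
  have l: "(lborel :: (real^'n) measure) = distr (\<Pi>\<^sub>M b\<in>Basis. lborel) borel T"
    unfolding T_def by (rule lborel_eq)
  have "(LINT x|lborel. (\<Prod>i\<in>UNIV. f i ((x::real^'n) $ i))) = (\<Prod>b\<in>Basis. (LINT t|lborel. F b t))"
    by (subst l, subst integral_distr[OF T m], unfold eq TF)
      (intro P.product_integral_prod Fint finite_Basis)
  then show ?thesis unfolding prod_Basis_cart by (simp add: F_def)
qed

section \<open>A product weight and its integral over the sphere\<close>

lemma nn_integral_inverse_1_plus_square_le:
  "(\<integral>\<^sup>+x. ennreal (1 / (1 + x\<^sup>2)) \<partial>lborel) \<le> ennreal pi"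
proof -
  let ?f = "\<lambda>x::real. 1 / (1 + x\<^sup>2)"
  have half: "(\<integral>\<^sup>+x. ennreal (?f x) * indicator {0..} x \<partial>lborel) = ennreal (pi / 2)"
  proof -
    have "(arctan has_real_derivative ?f x) (at x)" for x
      using DERIV_arctan[of x] by (simp add: inverse_eq_divide)
    then show ?thesis
      using nn_integral_FTC_atLeast[of ?f 0 arctan "pi/2"] tendsto_arctan_at_top by simp
  qed
  have "(\<integral>\<^sup>+x. ennreal (?f x) * indicator {..0} x \<partial>lborel) =
      (\<integral>\<^sup>+x. ennreal (?f x) * indicator {0..} x \<partial>lborel)"
    by (subst nn_integral_real_affine[of _ "-1" 0]) (auto intro!: nn_integral_cong simp: indicator_def)
  with half have half': "(\<integral>\<^sup>+x. ennreal (?f x) * indicator {..0} x \<partial>lborel) = ennreal (pi / 2)" by simp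
  have "(\<integral>\<^sup>+x. ennreal (?f x) \<partial>lborel) \<le>
      (\<integral>\<^sup>+x. ennreal (?f x) * indicator {0..} x + ennreal (?f x) * indicator {..0} x \<partial>lborel)"
    by (intro nn_integral_mono) (auto simp: indicator_def)
  also have "\<dots> = ennreal (pi / 2) + ennreal (pi / 2)"
    by (subst nn_integral_add) (auto simp: half half')
  also have "\<dots> = ennreal pi" by (subst ennreal_plus[symmetric]) auto
  finally show ?thesis .
qed

text \<open>Multiplying the bounds of \<open>fourier_sine_decay\<close> at the coordinates of
  \<kappa> (x - y) gives this weight up to a constant. It is defined on the whole space so that its
  integral over the sphere can be compared with a volume integral.\<close>

definition decay :: "real \<Rightarrow> real^'n \<Rightarrow> real^'n::finite \<Rightarrow> real" where
  "decay \<kappa> y x = (\<Prod>i\<in>UNIV. 1 / (1 + (\<kappa> * (x $ i - y $ i))\<^sup>2))"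

lemma decay_nonneg: "0 \<le> decay \<kappa> y x"
  unfolding decay_def by (intro prod_nonneg) auto

lemma decay_le_1: "decay \<kappa> y x \<le> 1"
  unfolding decay_def by (intro prod_le_1) (auto simp: divide_le_eq_1 add_pos_nonneg)

lemma decay_measurable[measurable]: "decay \<kappa> y \<in> borel_measurable borel"
  unfolding decay_def[abs_def] by measurable

lemma nn_integral_decay_le:
  fixes y :: "real^'n"
  assumes "\<kappa> > 0"
  shows "(\<integral>\<^sup>+x. ennreal (decay \<kappa> y x) \<partial>lborel) \<le> ennreal ((pi / \<kappa>) ^ CARD('n))"
proof -
  have 1: "(\<integral>\<^sup>+s. ennreal (1 / (1 + (\<kappa> * (s - a))\<^sup>2)) \<partial>lborel) \<le> ennreal (pi / \<kappa>)" for a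
  proof -
    have "(\<integral>\<^sup>+s. ennreal (1 / (1 + (\<kappa> * (s - a))\<^sup>2)) \<partial>lborel) =
        ennreal (1 / \<kappa>) * (\<integral>\<^sup>+x. ennreal (1 / (1 + x\<^sup>2)) \<partial>lborel)"
      using assms by (subst nn_integral_real_affine[of _ "1 / \<kappa>" a]) (auto intro!: nn_integral_cong)
    also have "\<dots> \<le> ennreal (1 / \<kappa>) * ennreal pi"
      by (intro mult_left_mono nn_integral_inverse_1_plus_square_le) auto
    also have "\<dots> = ennreal (pi / \<kappa>)"
      using assms by (subst ennreal_mult[symmetric]) auto
    finally show ?thesis .
  qed
  have "(\<integral>\<^sup>+x. ennreal (decay \<kappa> y x) \<partial>lborel) =
      (\<integral>\<^sup>+x. (\<Prod>b\<in>Basis. ennreal (1 / (1 + (\<kappa> * (x \<bullet> b - y \<bullet> b))\<^sup>2))) \<partial>lborel)"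
    by (intro nn_integral_cong) (simp add: decay_def prod_Basis_cart inner_axis prod_ennreal)
  also have "\<dots> = (\<Prod>b\<in>Basis. \<integral>\<^sup>+s. ennreal (1 / (1 + (\<kappa> * (s - y \<bullet> b))\<^sup>2)) \<partial>lborel)"
    by (rule nn_integral_lborel_prod) auto
  also have "\<dots> \<le> (\<Prod>b\<in>(Basis :: (real^'n) set). ennreal (pi / \<kappa>))"
    by (intro prod_mono_ennreal 1)
  also have "\<dots> = ennreal ((pi / \<kappa>) ^ CARD('n))"
    using assms by (simp add: ennreal_power)
  finally show ?thesis .
qed

lemma nn_integral_lborel_scale:
  fixes f :: "real^'n \<Rightarrow> ennreal"
  assumes [measurable]: "f \<in> borel_measurable borel" and "c > 0"
  shows "(\<integral>\<^sup>+x. f x \<partial>lborel) = ennreal (c ^ CARD('n)) * (\<integral>\<^sup>+x. f (c *\<^sub>R x) \<partial>lborel)"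
proof -
  have "(\<integral>\<^sup>+x. f x \<partial>lborel) =
      (\<integral>\<^sup>+x. f x \<partial>density (distr lborel borel (\<lambda>x. 0 + c *\<^sub>R x)) (\<lambda>_. ennreal (\<bar>c\<bar> ^ DIM(real^'n))))"
    using assms(2) by (subst lborel_affine[of c 0]) auto
  also have "\<dots> = ennreal (c ^ CARD('n)) * (\<integral>\<^sup>+x. f (c *\<^sub>R x) \<partial>lborel)"
    using assms(2) by (simp add: nn_integral_density nn_integral_distr nn_integral_cmult)
  finally show ?thesis .
qed

text \<open>Projecting a point of the shell to the sphere moves it by at most 1/\<kappa>, so each
  scaled coordinate changes by at most 1. If |A - B| is at most 1, then 1 + A^2 is at most 3 (1 +
  B^2); this gives one factor 3 per coordinate.\<close>

lemma decay_normalize_le: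
  fixes x y :: "real^'n"
  assumes "\<kappa> > 0" "1 \<le> norm x" "norm x < 1 + 1 / \<kappa>"
  shows "decay \<kappa> y (x /\<^sub>R norm x) \<le> 3 ^ CARD('n) * decay \<kappa> y x"
proof -
  let ?z = "x /\<^sub>R norm x"
  have "norm x \<noteq> 0" using assms by linarith
  have "x - ?z = (1 - inverse (norm x)) *\<^sub>R x" by (simp add: scaleR_left_diff_distrib)
  then have "norm (x - ?z) = \<bar>1 - inverse (norm x)\<bar> * norm x" by simp
  also have "\<dots> = (1 - inverse (norm x)) * norm x"
    using assms by (simp add: inverse_le_1_iff)
  also have "\<dots> = norm x - 1" using \<open>norm x \<noteq> 0\<close> by (simp only: left_diff_distrib left_inverse[of "norm x"] mult_1 not_False_eq_True)
  finally have nz: "norm (x - ?z) \<le> 1 / \<kappa>" using assms by simp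
  have "1 / (1 + (\<kappa> * (?z $ i - y $ i))\<^sup>2) \<le> 3 * (1 / (1 + (\<kappa> * (x $ i - y $ i))\<^sup>2))" for i
  proof -
    define A B where "A = \<kappa> * (x $ i - y $ i)" and "B = \<kappa> * (?z $ i - y $ i)"
    have "\<bar>x $ i - ?z $ i\<bar> \<le> 1 / \<kappa>"
      using component_le_norm_cart[of "x - ?z" i] nz by simp
    then have "\<kappa> * \<bar>x $ i - ?z $ i\<bar> \<le> 1" using assms by (simp add: field_simps)
    moreover have "\<bar>A - B\<bar> = \<kappa> * \<bar>x $ i - ?z $ i\<bar>"
      using assms by (simp add: A_def B_def abs_mult flip: right_diff_distrib)
    ultimately have u: "(A - B)\<^sup>2 \<le> 1" by (simp add: abs_square_le_1)
    have "A\<^sup>2 = (A - B)\<^sup>2 + B\<^sup>2 + 2 * (A - B) * B" using power2_sum[of "A - B" B] by simp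
    then have "1 + A\<^sup>2 \<le> 3 * (1 + B\<^sup>2)"
      using u sum_squares_bound[of "A - B" B] zero_le_power2[of B]
      unfolding distrib_left by linarith
    moreover have "0 < 1 + A\<^sup>2" "0 < 1 + B\<^sup>2" by (auto intro: add_pos_nonneg)
    ultimately show ?thesis unfolding A_def[symmetric] B_def[symmetric] by (simp add: field_simps)
  qed
  then have "decay \<kappa> y ?z \<le> (\<Prod>i\<in>(UNIV::'n set). 3 * (1 / (1 + (\<kappa> * (x $ i - y $ i))\<^sup>2)))"
    unfolding decay_def by (intro prod_mono) auto
  then show ?thesis by (simp only: decay_def prod.distrib prod_constant)
qed

text \<open>
  By homogeneity, the integral over the sphere is \<open>\<kappa>\<close> times an integral over a shell of width
  about \<open>1/\<kappa>\<close>, and \<^const>\<open>decay\<close> is essentially constant at that scale.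
\<close>

lemma nn_integral_sphere_decay_le:
  fixes y :: "real^'n"
  assumes "\<kappa> > 0"
  shows "(\<integral>\<^sup>+\<theta>. ennreal (decay \<kappa> y \<theta>) \<partial>sphere_measure) \<le> ennreal (\<kappa> * (3 * pi / \<kappa>) ^ CARD('n))"
proof -
  let ?n = "CARD('n)"
  define G where "G x = ennreal (decay \<kappa> y (x /\<^sub>R norm x))" for x :: "real^'n"
  \<comment> \<open>\<open>G\<close> is constant along rays, so \<open>J R\<close> scales like the
    n-th power of \<open>R\<close>, and n times \<open>J 1\<close> is the integral over the
    sphere.\<close>
  define J where "J R = (\<integral>\<^sup>+x. G x * indicator (ball 0 R - {0}) x \<partial>lborel)" for R
  have Gm[measurable]: "G \<in> borel_measurable borel" unfolding G_def by measurable
  have J_scale: "J R = ennreal (R ^ ?n) * J 1" if "R > 0" for R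
  proof -
    have "G (R *\<^sub>R x) * indicator (ball 0 R - {0}) (R *\<^sub>R x) = G x * indicator (ball 0 1 - {0}) x" for x
    proof -
      have "(R *\<^sub>R x) /\<^sub>R norm (R *\<^sub>R x) = x /\<^sub>R norm x" using that by simp
      then have "G (R *\<^sub>R x) = G x" unfolding G_def by (simp only:)
      then show ?thesis using that by (auto simp: indicator_def)
    qed
    moreover have "(\<lambda>x. G x * indicator (ball 0 R - {0}) x) \<in> borel_measurable borel"
      by (intro borel_measurable_times_ennreal Gm borel_measurable_indicator) auto
    ultimately show ?thesis unfolding J_def
      using that by (subst nn_integral_lborel_scale[of _ R]) auto
  qed
  have "J 1 \<le> (\<integral>\<^sup>+x. indicator (ball 0 1) (x::real^'n) \<partial>lborel)"
    unfolding J_def using decay_le_1[of \<kappa> y]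
    by (intro nn_integral_mono) (auto simp: indicator_def G_def ennreal_le_1)
  also have "\<dots> < \<infinity>" using emeasure_lborel_ball_finite[of "0::real^'n" 1] by simp
  \<comment> \<open>Finiteness of \<open>J 1\<close> permits subtracting it below.\<close>
  finally obtain j where j: "J 1 = ennreal j" "0 \<le> j" by (cases "J 1") auto
  let ?R = "1 + 1 / \<kappa>"
  have R: "?R > 0" using assms by (simp add: add_pos_pos)
  have "J ?R \<le> (\<integral>\<^sup>+x. G x * indicator (ball 0 1 - {0}) x +
      ennreal (3 ^ ?n) * ennreal (decay \<kappa> y x) \<partial>lborel)"
    unfolding J_def
  proof (intro nn_integral_mono)
    fix x :: "real^'n"
    show "G x * indicator (ball 0 ?R - {0}) x \<le>
      G x * indicator (ball 0 1 - {0}) x + ennreal (3 ^ ?n) * ennreal (decay \<kappa> y x)"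
    proof (cases "1 \<le> norm x \<and> norm x < ?R")
      case True
      then have "G x \<le> ennreal (3 ^ ?n * decay \<kappa> y x)"
        unfolding G_def using assms by (intro ennreal_leI decay_normalize_le) auto
      then show ?thesis using True by (auto simp: indicator_def ennreal_mult decay_nonneg)
    qed (auto simp: indicator_def)
  qed
  also have "\<dots> = J 1 + ennreal (3 ^ ?n) * (\<integral>\<^sup>+x. ennreal (decay \<kappa> y x) \<partial>lborel)"
    unfolding J_def by (subst nn_integral_add)
      (auto simp: nn_integral_cmult intro!: borel_measurable_times_ennreal borel_measurable_indicator)
  also have "\<dots> \<le> J 1 + ennreal (3 ^ ?n) * ennreal ((pi / \<kappa>) ^ ?n)"
    by (intro add_left_mono mult_left_mono nn_integral_decay_le assms) auto
  also have "\<dots> = ennreal (j + (3 * pi / \<kappa>) ^ ?n)"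
    using j assms by (simp add: ennreal_mult[symmetric] ennreal_plus[symmetric] power_mult_distrib[symmetric]
        del: ennreal_plus)
  finally have "ennreal (?R ^ ?n * j) \<le> ennreal (j + (3 * pi / \<kappa>) ^ ?n)"
    unfolding J_scale[OF R] j(1) using R j(2) by (simp add: ennreal_mult)
  then have le: "?R ^ ?n * j \<le> j + (3 * pi / \<kappa>) ^ ?n"
    using j(2) assms by (simp add: ennreal_le_iff del: ennreal_plus)
  \<comment> \<open>The shell contributes \<open>(?R ^ ?n - 1) * j\<close>, which by Bernoulli is at
    least n j / \<kappa>; multiplying by \<kappa> recovers the integral over the sphere.\<close>
  have "1 + real ?n * (1 / \<kappa>) \<le> ?R ^ ?n"
    by (rule Bernoulli_inequality) (use assms in \<open>simp add: order_trans[of _ 0]\<close>)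
  then have "(1 + real ?n * (1 / \<kappa>)) * j \<le> ?R ^ ?n * j"
    using j(2) by (rule mult_right_mono)
  with le have "real ?n * j / \<kappa> \<le> (3 * pi / \<kappa>) ^ ?n" by (simp add: algebra_simps)
  then have "real ?n * j \<le> \<kappa> * (3 * pi / \<kappa>) ^ ?n" using assms by (simp add: pos_divide_le_eq mult.commute)
  moreover have "(\<integral>\<^sup>+\<theta>. ennreal (decay \<kappa> y \<theta>) \<partial>sphere_measure) = ennreal (real ?n * j)"
    using j by (subst nn_integral_sphere_measure) (auto simp: J_def G_def ennreal_mult ennreal_of_nat_eq_real_of_nat)
  ultimately show ?thesis by (simp add: ennreal_leI)
qed

lemma integral_sphere_decay_le:
  fixes y :: "real^'n"
  assumes "\<kappa> > 0"
  shows "(LINT \<theta>|sphere_measure. decay \<kappa> y \<theta>) \<le> \<kappa> * (3 * pi / \<kappa>) ^ CARD('n)"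
    and "integrable sphere_measure (decay \<kappa> y)"
proof -
  interpret S: finite_measure "sphere_measure :: (real^'n) measure"
    by (rule finite_measure_sphere_measure)
  have m: "decay \<kappa> y \<in> borel_measurable sphere_measure"
    by (rule borel_measurable_sphere_measure) simp
  show int: "integrable sphere_measure (decay \<kappa> y)"
    using m decay_nonneg[of \<kappa> y] decay_le_1[of \<kappa> y] by (intro S.integrable_const_bound[where B=1]) auto
  have "ennreal (LINT \<theta>|sphere_measure. decay \<kappa> y \<theta>) = (\<integral>\<^sup>+\<theta>. ennreal (decay \<kappa> y \<theta>) \<partial>sphere_measure)"
    by (rule nn_integral_eq_integral[symmetric]) (use int decay_nonneg in auto)
  also have "\<dots> \<le> ennreal (\<kappa> * (3 * pi / \<kappa>) ^ CARD('n))" by (rule nn_integral_sphere_decay_le[OF assms])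
  finally show "(LINT \<theta>|sphere_measure. decay \<kappa> y \<theta>) \<le> \<kappa> * (3 * pi / \<kappa>) ^ CARD('n)"
    using assms by (subst (asm) ennreal_le_iff) auto
qed

section \<open>Weak derivatives of products\<close>

definition tensor :: "('n::finite \<Rightarrow> real \<Rightarrow> real) \<Rightarrow> real^'n \<Rightarrow> real" where
  "tensor f x = (\<Prod>j\<in>UNIV. f j (x $ j))"

lemma tensor_split: "tensor f x = f i (x $ i) * (\<Prod>j\<in>UNIV - {i}. f j (x $ j))"
  unfolding tensor_def by (subst prod.remove[of UNIV i]) auto

lemma tensor_upd: "tensor (f(i := g)) x = g (x $ i) * (\<Prod>j\<in>UNIV - {i}. f j (x $ j))"
  by (subst tensor_split[of _ _ i]) (auto intro!: prod.cong)

lemma tensor_measurable: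
  assumes [measurable]: "\<And>j. f j \<in> borel_measurable borel"
  shows "tensor f \<in> borel_measurable borel"
  unfolding tensor_def[abs_def] by measurable

lemma tensor_outside:
  assumes supp: "\<And>j t. t \<notin> {0..r} \<Longrightarrow> f j t = 0" and "x \<notin> cbox 0 (vec r)"
  shows "tensor f x = 0"
proof -
  obtain j where "x $ j \<notin> {0..r}"
    using assms(2) by (auto simp: mem_box_cart)
  then have "f j (x $ j) = 0" by (rule supp)
  then show ?thesis unfolding tensor_def by (intro prod_zero) auto
qed

lemma tensor_bounded:
  fixes f :: "'n::finite \<Rightarrow> real \<Rightarrow> real"
  assumes "\<And>j t. \<bar>f j t\<bar> \<le> M"
  shows "\<bar>tensor f x\<bar> \<le> M ^ CARD('n)"
proof -
  have "\<bar>tensor f x\<bar> \<le> (\<Prod>j\<in>(UNIV::'n set). M)"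
    unfolding tensor_def abs_prod by (intro prod_mono) (use assms in auto)
  then show ?thesis by simp
qed

lemma tensor_integrable:
  fixes f :: "'n::finite \<Rightarrow> real \<Rightarrow> real"
  assumes "\<And>j. f j \<in> borel_measurable borel" "\<And>j t. \<bar>f j t\<bar> \<le> M"
    and supp: "\<And>j t. t \<notin> {0..r} \<Longrightarrow> f j t = 0"
  shows "integrable lborel (tensor f)"
proof (rule Bochner_Integration.integrable_bound)
  let ?C = "cbox 0 (vec r) :: (real^'n) set"
  show "integrable lborel (\<lambda>x. M ^ CARD('n) * indicator ?C x :: real)"
    by (intro integrable_mult_right integrable_real_indicator) (use emeasure_lborel_cbox_finite in auto)
  show "tensor f \<in> borel_measurable lborel" using tensor_measurable[of f] assms(1) by simp
  have "\<bar>tensor f x\<bar> \<le> M ^ CARD('n) * indicator ?C x" for x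
    using tensor_bounded[of f M x] tensor_outside[of r f x, OF supp] assms(2) by (cases "x \<in> ?C") auto
  moreover have "0 \<le> M ^ CARD('n)"
    using order_trans[OF abs_ge_zero assms(2)] by simp
  ultimately show "AE x in lborel. norm (tensor f x) \<le> norm (M ^ CARD('n) * indicator ?C x :: real)"
    by (auto simp: abs_mult)
qed

lemma tensor_L2:
  fixes f :: "'n::finite \<Rightarrow> real \<Rightarrow> real"
  assumes m: "\<And>j. f j \<in> borel_measurable borel" and b: "\<And>j t. \<bar>f j t\<bar> \<le> M"
    and supp: "\<And>j t. t \<notin> {0..r} \<Longrightarrow> f j t = 0"
  shows "(\<lambda>x. of_real (tensor f x)) \<in> L2 lborel"
proof -
  have [measurable]: "f j \<in> borel_measurable borel" for j by (rule m)
  have "integrable lborel (tensor (\<lambda>j t. (f j t)\<^sup>2))"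
  proof (rule tensor_integrable[where M="M\<^sup>2"])
    show "\<bar>(f j t)\<^sup>2\<bar> \<le> M\<^sup>2" for j t
      using power_mono[OF b[of j t], of 2] by simp
    show "(f j t)\<^sup>2 = 0" if "t \<notin> {0..r}" for j t using supp[OF that] by simp
  qed measurable
  moreover have "tensor (\<lambda>j t. (f j t)\<^sup>2) = (\<lambda>x. (cmod (of_real (tensor f x)))\<^sup>2)"
    unfolding norm_of_real power2_abs by (simp add: fun_eq_iff tensor_def prod_power_distrib)
  ultimately have "integrable lborel (\<lambda>x. (cmod (of_real (tensor f x)))\<^sup>2)" by (simp only:)
  then show ?thesis using tensor_measurable[of f] m by (simp add: L2_def)
qed

lemma lborel_integral_translate:
  fixes F :: "real^'n \<Rightarrow> complex"
  assumes [measurable]: "F \<in> borel_measurable borel"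
  shows "(LINT x|lborel. F (c + x)) = (LINT x|lborel. F x)"
proof -
  have "(LINT x|lborel. F x) = (LINT x|distr lborel borel ((+) c). F x)"
    by (subst lborel_distr_plus) simp
  also have "\<dots> = (LINT x|lborel. F (c + x))"
    by (subst integral_distr) auto
  finally show ?thesis by simp
qed

lemma difference_quotient_tendsto_partial_deriv:
  assumes "\<phi> differentiable (at x)" and \<epsilon>: "\<epsilon> \<longlonglongrightarrow> 0" "\<And>m. \<epsilon> m > 0"
  shows "(\<lambda>m. (\<phi> (x + \<epsilon> m *\<^sub>R axis i 1) - \<phi> x) / of_real (\<epsilon> m)) \<longlonglongrightarrow> partial_deriv i \<phi> x"
proof -
  let ?e = "axis i 1 :: real^'a"
  define D where "D = frechet_derivative \<phi> (at x)"
  have D: "(\<phi> has_derivative D) (at x)"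
    unfolding D_def using assms(1) by (simp add: frechet_derivative_works)
  then interpret bounded_linear D by (rule has_derivative_bounded_linear)
  have "((\<lambda>y. norm (\<phi> y - \<phi> x - D (y - x)) / norm (y - x)) \<longlongrightarrow> 0) (at x)"
    using D by (simp add: has_derivative_iff_norm)
  moreover have "filterlim (\<lambda>m. x + \<epsilon> m *\<^sub>R ?e) (at x) sequentially"
    unfolding filterlim_at
  proof
    show "\<forall>\<^sub>F m in sequentially. x + \<epsilon> m *\<^sub>R ?e \<in> UNIV \<and> x + \<epsilon> m *\<^sub>R ?e \<noteq> x"
      using \<epsilon>(2) by (auto simp: axis_eq_0_iff less_imp_neq[THEN not_sym])
    have "(\<lambda>m. x + \<epsilon> m *\<^sub>R ?e) \<longlonglongrightarrow> x + 0 *\<^sub>R ?e" by (intro tendsto_intros \<epsilon>)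
    then show "(\<lambda>m. x + \<epsilon> m *\<^sub>R ?e) \<longlonglongrightarrow> x" by simp
  qed
  ultimately have "(\<lambda>m. norm (\<phi> (x + \<epsilon> m *\<^sub>R ?e) - \<phi> x - D (x + \<epsilon> m *\<^sub>R ?e - x)) /
      norm (x + \<epsilon> m *\<^sub>R ?e - x)) \<longlonglongrightarrow> 0"
    by (rule filterlim_compose)
  moreover have "norm (\<phi> (x + \<epsilon> m *\<^sub>R ?e) - \<phi> x - D (x + \<epsilon> m *\<^sub>R ?e - x)) / norm (x + \<epsilon> m *\<^sub>R ?e - x) =
      norm ((\<phi> (x + \<epsilon> m *\<^sub>R ?e) - \<phi> x) / of_real (\<epsilon> m) - D ?e)" for m
  proof -
    have "D (x + \<epsilon> m *\<^sub>R ?e - x) = of_real (\<epsilon> m) * D ?e"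
      using scaleR[of "\<epsilon> m" ?e] by (simp add: scaleR_conv_of_real[of _ "D _"])
    then have "(\<phi> (x + \<epsilon> m *\<^sub>R ?e) - \<phi> x) / of_real (\<epsilon> m) - D ?e =
        (\<phi> (x + \<epsilon> m *\<^sub>R ?e) - \<phi> x - D (x + \<epsilon> m *\<^sub>R ?e - x)) / of_real (\<epsilon> m)"
      using \<epsilon>(2)[of m] by (simp add: diff_divide_distrib)
    then show ?thesis using \<epsilon>(2)[of m] by (simp add: norm_divide norm_axis_1)
  qed
  ultimately have "(\<lambda>m. norm ((\<phi> (x + \<epsilon> m *\<^sub>R ?e) - \<phi> x) / of_real (\<epsilon> m) - D ?e)) \<longlonglongrightarrow> 0" by simp
  then have "(\<lambda>m. (\<phi> (x + \<epsilon> m *\<^sub>R ?e) - \<phi> x) / of_real (\<epsilon> m) - D ?e) \<longlonglongrightarrow> 0"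
    by (rule tendsto_norm_zero_cancel)
  then show ?thesis unfolding partial_deriv_def D_def[symmetric] by (rule LIM_zero_cancel)
qed

text \<open>Supplies a majorant for the difference quotients that does not depend on their
  step.\<close>

lemma norm_diff_axis_le_partial_deriv_bound:
  fixes \<phi> :: "real^'n \<Rightarrow> complex"
  assumes diff: "\<And>z. \<phi> differentiable (at z)" and "\<epsilon> \<ge> 0"
    and K: "\<And>t. t \<in> {0..\<epsilon>} \<Longrightarrow> cmod (partial_deriv i \<phi> (x + t *\<^sub>R axis i 1)) \<le> K"
  shows "cmod (\<phi> (x + \<epsilon> *\<^sub>R axis i 1) - \<phi> x) \<le> K * \<epsilon>"
proof -
  let ?e = "axis i 1 :: real^'n"
  have der: "((\<lambda>t. \<phi> (x + t *\<^sub>R ?e)) has_derivative (\<lambda>s. s *\<^sub>R partial_deriv i \<phi> (x + t *\<^sub>R ?e)))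
      (at t within {0..\<epsilon>})" for t
  proof -
    define D where "D = frechet_derivative \<phi> (at (x + t *\<^sub>R ?e))"
    have D: "(\<phi> has_derivative D) (at (x + t *\<^sub>R ?e))"
      unfolding D_def using diff by (simp add: frechet_derivative_works)
    then interpret bounded_linear D by (rule has_derivative_bounded_linear)
    have "((\<lambda>t. x + t *\<^sub>R ?e) has_derivative (\<lambda>s. s *\<^sub>R ?e)) (at t within {0..\<epsilon>})"
      by (auto intro!: derivative_eq_intros)
    from has_derivative_compose[OF this D] show ?thesis
      by (simp add: scaleR partial_deriv_def flip: D_def)
  qed
  have "norm (\<phi> (x + \<epsilon> *\<^sub>R ?e) - \<phi> (x + 0 *\<^sub>R ?e)) \<le> K * norm (\<epsilon> - 0)"
  proof (rule differentiable_bound[where S="{0..\<epsilon>}", OF _ der])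
    show "onorm (\<lambda>s. s *\<^sub>R partial_deriv i \<phi> (x + t *\<^sub>R ?e)) \<le> K" if "t \<in> {0..\<epsilon>}" for t
      using K[OF that] by (intro onorm_le) (auto simp: mult.commute[of K] intro!: mult_left_mono)
  qed (use assms in auto)
  then show ?thesis using assms by simp
qed

text \<open>The factor \<open>f i\<close> is Lipschitz but may have kinks, so partial integration is
  done with difference quotients: translation invariance moves the quotient exactly from the test
  function to the product, and both sides converge by dominated convergence as the step tends to 0.
  One majorant comes from the continuous derivative of the test function on a box, the other from
  the Lipschitz bound.\<close>

lemma tensor_weak_deriv:
  fixes f :: "'n::finite \<Rightarrow> real \<Rightarrow> real"
  assumes m: "\<And>j. f j \<in> borel_measurable borel" and b: "\<And>j t. \<bar>f j t\<bar> \<le> M"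
    and supp: "\<And>j t. t \<notin> {0..r} \<Longrightarrow> f j t = 0"
    and lip: "\<And>s t. \<bar>f i s - f i t\<bar> \<le> L * \<bar>s - t\<bar>"
    and N: "finite N" and der: "\<And>t. t \<notin> N \<Longrightarrow> (f i has_real_derivative f' t) (at t)"
    and f'm: "f' \<in> borel_measurable borel"
  shows "is_weak_deriv i (\<lambda>x. of_real (tensor f x)) (\<lambda>x. of_real (tensor (f(i := f')) x))"
  unfolding is_weak_deriv_def
proof (intro allI impI)
  fix \<phi> :: "real^'n \<Rightarrow> complex" assume \<phi>: "test_function \<phi>"
  let ?e = "axis i 1 :: real^'n"
  define h where "h x = (of_real (tensor f x) :: complex)" for x
  define h' where "h' x = (of_real (tensor (f(i := f')) x) :: complex)" for x
  define T where "T x = (\<Prod>j\<in>UNIV - {i}. f j (x $ j))" for x :: "real^'n"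
  define \<epsilon> where "\<epsilon> m = inverse (real (Suc m))" for m
  have \<epsilon>: "\<epsilon> \<longlonglongrightarrow> 0" "\<And>m. \<epsilon> m > 0" "\<And>m. \<epsilon> m \<le> 1"
    unfolding \<epsilon>_def using LIMSEQ_inverse_real_of_nat by (auto simp: inverse_le_1_iff)
  have [measurable]: "tensor f \<in> borel_measurable borel" using m by (rule tensor_measurable)
  have [measurable]: "tensor (f(i := f')) \<in> borel_measurable borel"
    using m f'm by (intro tensor_measurable) auto
  have hm[measurable]: "h \<in> borel_measurable borel" "h' \<in> borel_measurable borel"
    unfolding h_def h'_def by measurable
  have C1: "C_k 1 \<phi>" using \<phi> unfolding test_function_def by blast
  then have diff: "\<phi> differentiable (at z)" for z by (simp add: differentiable_on_def)
  from C1 have pc: "continuous_on UNIV (partial_deriv i \<phi>)" by simp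
  have \<phi>c: "continuous_on UNIV \<phi>" using \<phi> unfolding test_function_def by (metis C_k.simps(1))
  have [measurable]: "\<phi> \<in> borel_measurable borel" "partial_deriv i \<phi> \<in> borel_measurable borel"
    using \<phi>c pc by (auto intro: borel_measurable_continuous_onI)
  have hint: "integrable lborel h"
    unfolding h_def by (intro integrable_of_real tensor_integrable[OF m b supp])
  have Tb: "\<bar>T x\<bar> \<le> M ^ card (UNIV - {i})" for x
  proof -
    have "\<bar>T x\<bar> \<le> (\<Prod>j\<in>UNIV - {i}. M)"
      unfolding T_def abs_prod by (intro prod_mono) (use b in auto)
    then show ?thesis by simp
  qed
  have L0: "0 \<le> L" using lip[of 1 0] by simp
  have Tinv: "T (x + s *\<^sub>R ?e) = T x" for x s
    unfolding T_def by (rule prod.cong) (auto simp: axis_def)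
  have hsplit: "h x = of_real (f i (x $ i) * T x)" "h' x = of_real (f' (x $ i) * T x)" for x
    unfolding h_def h'_def T_def tensor_upd by (simp_all add: tensor_split[of f x i])
  define A where "A m = (LINT x|lborel. h x * ((\<phi> (x + \<epsilon> m *\<^sub>R ?e) - \<phi> x) / of_real (\<epsilon> m)))" for m
  have A: "A \<longlonglongrightarrow> (LINT x|lborel. h x * partial_deriv i \<phi> x)"
  proof -
    \<comment> \<open>Steps are at most 1, so the box enlarged by 1 contains every segment that
      starts in the cube outside which \<open>h\<close> vanishes.\<close>
    let ?C = "cbox 0 (vec (r + 1)) :: (real^'n) set"
    have "compact (partial_deriv i \<phi> ` ?C)"
      by (intro compact_continuous_image continuous_on_subset[OF pc]) auto
    then obtain K where K: "\<And>z. z \<in> ?C \<Longrightarrow> cmod (partial_deriv i \<phi> z) \<le> K"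
      using compact_imp_bounded bounded_iff by (metis imageI)
    show ?thesis unfolding A_def
    proof (rule integral_dominated_convergence)
      show "integrable lborel (\<lambda>x. cmod (h x) * \<bar>K\<bar>)" using hint by auto
      show "AE x in lborel. (\<lambda>m. h x * ((\<phi> (x + \<epsilon> m *\<^sub>R ?e) - \<phi> x) / of_real (\<epsilon> m)))
          \<longlonglongrightarrow> h x * partial_deriv i \<phi> x"
        by (intro AE_I2 tendsto_mult tendsto_const difference_quotient_tendsto_partial_deriv diff \<epsilon>)
      show "AE x in lborel. norm (h x * ((\<phi> (x + \<epsilon> m *\<^sub>R ?e) - \<phi> x) / of_real (\<epsilon> m))) \<le> cmod (h x) * \<bar>K\<bar>" for m
      proof (intro AE_I2)
        fix x
        show "norm (h x * ((\<phi> (x + \<epsilon> m *\<^sub>R ?e) - \<phi> x) / of_real (\<epsilon> m))) \<le> cmod (h x) * \<bar>K\<bar>"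
        proof (cases "x \<in> cbox 0 (vec r)")
          case True
          have "x + t *\<^sub>R ?e \<in> ?C" if "t \<in> {0..\<epsilon> m}" for t
          proof -
            have "0 \<le> x $ j" "x $ j \<le> r" for j using True by (auto simp: mem_box_cart)
            then show ?thesis using that \<epsilon>(3)[of m] unfolding mem_box_cart
              by (auto simp: axis_def intro!: add_mono) (meson add_increasing2 zero_le_one)
          qed
          then have "cmod (\<phi> (x + \<epsilon> m *\<^sub>R ?e) - \<phi> x) \<le> K * \<epsilon> m"
            using \<epsilon>(2)[of m] by (intro norm_diff_axis_le_partial_deriv_bound diff K) auto
          then have "cmod (\<phi> (x + \<epsilon> m *\<^sub>R ?e) - \<phi> x) / \<epsilon> m \<le> \<bar>K\<bar>"
            using \<epsilon>(2)[of m] by (simp add: divide_le_eq) (smt (verit) mult_right_mono)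
          then have "cmod (h x) * (cmod (\<phi> (x + \<epsilon> m *\<^sub>R ?e) - \<phi> x) / \<epsilon> m) \<le> cmod (h x) * \<bar>K\<bar>"
            by (rule mult_left_mono) simp
          then show ?thesis using \<epsilon>(2)[of m] by (simp add: norm_mult norm_divide)
        next
          case False
          then have "h x = 0" unfolding h_def using tensor_outside[of r f x, OF supp] by simp
          then show ?thesis by simp
        qed
      qed
    qed measurable
  qed
  define B where "B m = (LINT x|lborel. ((h (x - \<epsilon> m *\<^sub>R ?e) - h x) / of_real (\<epsilon> m)) * \<phi> x)" for m
  have B: "B \<longlonglongrightarrow> (LINT x|lborel. (- h' x) * \<phi> x)"
    unfolding B_def
  proof (rule integral_dominated_convergence)
    show "integrable lborel (\<lambda>x. (L * M ^ card (UNIV - {i})) * cmod (\<phi> x))"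
      using test_function_L2(2)[OF \<phi>] by auto
    \<comment> \<open>The kinks lie on finitely many hyperplanes, which are null sets.\<close>
    have "AE x in lborel. x \<bullet> ?e \<noteq> c" for c
      by (rule AE_lborel_inner_neq) (simp add: axis_in_Basis_iff)
    then have "AE x in lborel. \<forall>c\<in>N. (x::real^'n) $ i \<noteq> c"
      using N by (intro AE_finite_allI) (auto simp: inner_axis)
    then show "AE x in lborel. (\<lambda>m. (h (x - \<epsilon> m *\<^sub>R ?e) - h x) / of_real (\<epsilon> m) * \<phi> x) \<longlonglongrightarrow> - h' x * \<phi> x"
    proof eventually_elim
      case (elim x)
      then have "(f i has_real_derivative f' (x $ i)) (at (x $ i))" by (intro der) auto
      then have "((\<lambda>s. (f i (x $ i + s) - f i (x $ i)) / s) \<longlongrightarrow> f' (x $ i)) (at 0)"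
        by (simp only: DERIV_def)
      moreover have "filterlim (\<lambda>m. - \<epsilon> m) (at 0) sequentially"
        unfolding filterlim_at using tendsto_minus[OF \<epsilon>(1)] \<epsilon>(2) by (auto simp: less_imp_neq[THEN not_sym])
      ultimately have "(\<lambda>m. (f i (x $ i + - \<epsilon> m) - f i (x $ i)) / - \<epsilon> m) \<longlonglongrightarrow> f' (x $ i)"
        by (rule filterlim_compose)
      then have "(\<lambda>m. complex_of_real (- ((f i (x $ i + - \<epsilon> m) - f i (x $ i)) / - \<epsilon> m) * T x) * \<phi> x)
          \<longlonglongrightarrow> complex_of_real (- f' (x $ i) * T x) * \<phi> x"
        by (intro tendsto_intros)
      moreover have "complex_of_real (- ((f i (x $ i + - \<epsilon> m) - f i (x $ i)) / - \<epsilon> m) * T x) =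
          (h (x - \<epsilon> m *\<^sub>R ?e) - h x) / of_real (\<epsilon> m)" for m
        using Tinv[of x "- \<epsilon> m"] unfolding hsplit
        by (simp add: algebra_simps diff_divide_distrib)
      moreover have "complex_of_real (- f' (x $ i) * T x) = - h' x" unfolding hsplit by simp
      ultimately show ?case by (simp only:)
    qed
    show "AE x in lborel. norm ((h (x - \<epsilon> m *\<^sub>R ?e) - h x) / of_real (\<epsilon> m) * \<phi> x) \<le>
        (L * M ^ card (UNIV - {i})) * cmod (\<phi> x)" for m
    proof (intro AE_I2)
      fix x
      have "h (x - \<epsilon> m *\<^sub>R ?e) - h x = of_real ((f i (x $ i - \<epsilon> m) - f i (x $ i)) * T x)"
        using Tinv[of x "- \<epsilon> m"] unfolding hsplit by (simp add: algebra_simps)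
      then have "cmod (h (x - \<epsilon> m *\<^sub>R ?e) - h x) = \<bar>f i (x $ i - \<epsilon> m) - f i (x $ i)\<bar> * \<bar>T x\<bar>"
        by (simp only: norm_of_real abs_mult)
      also have "\<dots> \<le> (L * \<epsilon> m) * M ^ card (UNIV - {i})"
        using lip[of "x $ i - \<epsilon> m" "x $ i"] \<epsilon>(2)[of m] L0 by (intro mult_mono Tb) auto
      finally have "cmod (h (x - \<epsilon> m *\<^sub>R ?e) - h x) / \<epsilon> m \<le> L * M ^ card (UNIV - {i})"
        using \<epsilon>(2)[of m] by (simp add: divide_le_eq mult_ac)
      then show "norm ((h (x - \<epsilon> m *\<^sub>R ?e) - h x) / of_real (\<epsilon> m) * \<phi> x) \<le>
        (L * M ^ card (UNIV - {i})) * cmod (\<phi> x)"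
        using \<epsilon>(2)[of m] mult_right_mono[OF _ norm_ge_zero[of "\<phi> x"]]
        by (simp add: norm_mult norm_divide) fastforce
    qed
  qed measurable
  \<comment> \<open>The discrete partial integration: a shift of the variable moves the difference
    quotient to the other factor.\<close>
  have "A m = B m" for m
  proof -
    obtain K where K: "\<And>x. cmod (\<phi> x) \<le> K"
    proof -
      let ?S = "closure {x. \<phi> x \<noteq> 0}"
      have "compact (\<phi> ` ?S)"
        using \<phi> by (intro compact_continuous_image continuous_on_subset[OF \<phi>c]) (auto simp: test_function_def)
      then obtain K where "\<And>x. x \<in> ?S \<Longrightarrow> cmod (\<phi> x) \<le> K"
        using compact_imp_bounded bounded_iff by (metis imageI)
      then have "cmod (\<phi> x) \<le> max K 0" for x
        using closure_subset[of "{x. \<phi> x \<noteq> 0}"] by (cases "\<phi> x = 0") (auto intro: max.coboundedI1)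
      then show ?thesis by (rule that)
    qed
    have int1: "integrable lborel (\<lambda>x. h x * \<phi> (x + s))" for s
    proof (rule Bochner_Integration.integrable_bound)
      show "integrable lborel (\<lambda>x. cmod (h x) * K)" using hint by auto
      show "AE x in lborel. norm (h x * \<phi> (x + s)) \<le> norm (cmod (h x) * K)"
        using K order_trans[OF norm_ge_zero K] by (auto simp: norm_mult abs_mult intro!: mult_left_mono)
    qed measurable
    have int2: "integrable lborel (\<lambda>x. h (x - s) * \<phi> x)" for s
    proof -
      have "integrable (distr lborel borel ((+) s)) (\<lambda>x. h (x - s) * \<phi> x)"
        using int1[of s] by (subst integrable_distr_eq) (auto simp: add.commute)
      then show ?thesis by (simp add: lborel_distr_plus)
    qed
    have shift: "(LINT x|lborel. h x * \<phi> (x + s)) = (LINT x|lborel. h (x - s) * \<phi> x)" for s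
      using lborel_integral_translate[of "\<lambda>x. h (x - s) * \<phi> x" s] by (simp add: add.commute)
    have "A m = (LINT x|lborel. (h x * \<phi> (x + \<epsilon> m *\<^sub>R ?e) - h x * \<phi> (x + 0)) / of_real (\<epsilon> m))"
      unfolding A_def by (simp add: right_diff_distrib)
    also have "\<dots> = (LINT x|lborel. (h (x - \<epsilon> m *\<^sub>R ?e) * \<phi> x - h (x - 0) * \<phi> x) / of_real (\<epsilon> m))"
      by (simp only: integral_divide_zero Bochner_Integration.integral_diff[OF int1 int1]
          Bochner_Integration.integral_diff[OF int2 int2] shift)
    also have "\<dots> = B m" unfolding B_def by (simp add: left_diff_distrib)
    finally show ?thesis .
  qed
  then have "A = B" by (simp add: fun_eq_iff)
  then have "(LINT x|lborel. h x * partial_deriv i \<phi> x) = (LINT x|lborel. (- h' x) * \<phi> x)"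
    using A B LIMSEQ_unique by blast
  then show "(LINT x|lborel. of_real (tensor f x) * partial_deriv i \<phi> x) =
      - (LINT x|lborel. of_real (tensor (f(i := f')) x) * \<phi> x)"
    unfolding h_def h'_def by simp
qed

section \<open>Sine sums\<close>

definition sine_sum :: "real \<Rightarrow> nat \<Rightarrow> (nat \<Rightarrow> real) \<Rightarrow> real \<Rightarrow> real" where
  "sine_sum l N a t = indicator {0..l} t * (\<Sum>j=1..N. a j * sin (real j * (pi / l) * t))"

definition cosine_sum :: "real \<Rightarrow> nat \<Rightarrow> (nat \<Rightarrow> real) \<Rightarrow> real \<Rightarrow> real" where
  "cosine_sum l N a t =
     indicator {0..l} t * (\<Sum>j=1..N. a j * (real j * (pi / l)) * cos (real j * (pi / l) * t))"

lemma sine_sum_measurable[measurable]: "sine_sum l N a \<in> borel_measurable borel"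
  unfolding sine_sum_def[abs_def] by measurable

lemma cosine_sum_measurable[measurable]: "cosine_sum l N a \<in> borel_measurable borel"
  unfolding cosine_sum_def[abs_def] by measurable

lemma sine_sum_outside: "t \<notin> {0..l} \<Longrightarrow> sine_sum l N a t = 0"
  by (simp add: sine_sum_def)

lemma cosine_sum_outside: "t \<notin> {0..l} \<Longrightarrow> cosine_sum l N a t = 0"
  by (simp add: cosine_sum_def)

lemma sine_sum_bounded: "\<bar>sine_sum l N a t\<bar> \<le> (\<Sum>j=1..N. \<bar>a j\<bar>)"
proof -
  have "\<bar>\<Sum>j=1..N. a j * sin (real j * (pi / l) * t)\<bar> \<le> (\<Sum>j=1..N. \<bar>a j\<bar>)"
    by (rule order_trans[OF sum_abs]) (auto intro!: sum_mono simp: abs_mult mult_left_le)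
  then show ?thesis by (auto simp: sine_sum_def indicator_def sum_nonneg)
qed

lemma abs_mult_cos_le: "\<bar>c * cos x\<bar> \<le> \<bar>c\<bar>" for c x :: real
  by (simp add: abs_mult mult_left_le)

lemma cosine_sum_bounded: "\<bar>cosine_sum l N a t\<bar> \<le> (\<Sum>j=1..N. \<bar>a j * (real j * (pi / l))\<bar>)"
proof -
  have "\<bar>\<Sum>j=1..N. a j * (real j * (pi / l)) * cos (real j * (pi / l) * t)\<bar>
      \<le> (\<Sum>j=1..N. \<bar>a j * (real j * (pi / l))\<bar>)"
    by (rule order_trans[OF sum_abs], rule sum_mono, rule abs_mult_cos_le)
  then show ?thesis by (auto simp: cosine_sum_def indicator_def sum_nonneg)
qed

lemma sine_sum_has_derivative:
  assumes "t \<notin> {0, l}"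
  shows "(sine_sum l N a has_real_derivative cosine_sum l N a t) (at t)"
proof -
  let ?S = "\<lambda>t. \<Sum>j=1..N. a j * sin (real j * (pi / l) * t)"
  show ?thesis
  proof (cases "t \<in> {0<..<l}")
    case True
    have "(?S has_real_derivative cosine_sum l N a t) (at t)"
      using True unfolding cosine_sum_def
      by (auto intro!: derivative_eq_intros sum.cong simp: mult_ac)
    then show ?thesis
      by (rule has_field_derivative_transform_within_open[where S="{0<..<l}"])
        (use True in \<open>auto simp: sine_sum_def\<close>)
  next
    case False
    then have t: "t \<in> {..<0} \<union> {l<..}" using assms by auto
    have 0: "((\<lambda>_. 0) has_real_derivative 0) (at t)" by simp
    consider "t < 0" | "t > l" using t by auto
    then have "(sine_sum l N a has_real_derivative 0) (at t)"
    proof cases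
      case 1
      then show ?thesis
        by (intro has_field_derivative_transform_within_open[where S="{..<0}", OF 0])
          (auto simp: sine_sum_def)
    next
      case 2
      then show ?thesis
        by (intro has_field_derivative_transform_within_open[where S="{l<..}", OF 0])
          (auto simp: sine_sum_def)
    qed
    moreover have "cosine_sum l N a t = 0"
      using t by (auto simp: cosine_sum_def)
    ultimately show ?thesis by simp
  qed
qed

text \<open>Since the sines vanish at both end points, cutting off amounts to clamping the argument.\<close>

lemma sine_sum_lipschitz:
  assumes "l > 0"
  shows "\<bar>sine_sum l N a s - sine_sum l N a t\<bar> \<le> (\<Sum>j=1..N. \<bar>a j * (real j * (pi / l))\<bar>) * \<bar>s - t\<bar>"
proof -
  let ?S = "\<lambda>t. \<Sum>j=1..N. a j * sin (real j * (pi / l) * t)"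
  let ?L = "\<Sum>j=1..N. \<bar>a j * (real j * (pi / l))\<bar>"
  define cl where "cl t = max 0 (min l t)" for t :: real
  have end0: "?S l = 0"
    using assms by (intro sum.neutral) auto
  have eq: "sine_sum l N a t = ?S (cl t)" for t
  proof -
    consider "t < 0" | "t > l" | "t \<in> {0..l}" by fastforce
    then show ?thesis
    proof cases
      case 2
      then have "cl t = l" using assms by (simp add: cl_def)
      then show ?thesis using 2 end0 by (simp add: sine_sum_def)
    qed (auto simp: sine_sum_def cl_def)
  qed
  have der: "(?S has_real_derivative (\<Sum>j=1..N. a j * (real j * (pi / l)) * cos (real j * (pi / l) * x))) (at x)" for x
    using assms by (auto intro!: derivative_eq_intros sum.cong simp: mult_ac)
  have "norm (\<Sum>j=1..N. a j * (real j * (pi / l)) * cos (real j * (pi / l) * x)) \<le> ?L" for x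
    by (rule order_trans[OF norm_sum], rule sum_mono, unfold real_norm_def, rule abs_mult_cos_le)
  then have "norm (?S (cl s) - ?S (cl t)) \<le> ?L * norm (cl s - cl t)"
    by (intro field_differentiable_bound[where S=UNIV and f'="\<lambda>x. \<Sum>j=1..N. a j * (real j * (pi / l)) * cos (real j * (pi / l) * x)"] der)
      auto
  also have "\<dots> \<le> ?L * \<bar>s - t\<bar>"
    by (intro mult_left_mono sum_nonneg) (auto simp: cl_def)
  finally show ?thesis by (simp add: eq)
qed

text \<open>The product formulas lead to the frequencies j - k and j + k, hence an integer
  \<open>m\<close>. For nonzero \<open>m\<close> the antiderivative is a multiple of sin(m pi t /
  l), which vanishes at both ends.\<close>

lemma integral_cos_period:
  fixes m :: int
  assumes "l > 0"
  shows "(LINT t|lborel. indicator {0..l} t * cos (real_of_int m * (pi / l) * t)) = (if m = 0 then l else 0)"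
    and "integrable lborel (\<lambda>t. indicator {0..l} t * cos (real_of_int m * (pi / l) * t))"
proof -
  have "set_integrable lborel {0..l} (\<lambda>t. cos (real_of_int m * (pi / l) * t))"
    by (intro borel_integrable_atLeastAtMost' continuous_intros)
  then show "integrable lborel (\<lambda>t. indicator {0..l} t * cos (real_of_int m * (pi / l) * t))"
    by (simp add: set_integrable_def)
  show "(LINT t|lborel. indicator {0..l} t * cos (real_of_int m * (pi / l) * t)) = (if m = 0 then l else 0)"
  proof (cases "m = 0")
    case True
    then show ?thesis using assms by simp
  next
    case False
    let ?b = "real_of_int m * (pi / l)"
    have b: "?b \<noteq> 0" using False assms by simp
    have "(LINT t|lborel. indicator {0..l} t *\<^sub>R cos (?b * t)) = sin (?b * l) / ?b - sin (?b * 0) / ?b"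
    proof (rule integral_FTC_atLeastAtMost)
      show "((\<lambda>t. sin (?b * t) / ?b) has_vector_derivative cos (?b * t)) (at t within {0..l})" for t
        unfolding has_real_derivative_iff_has_vector_derivative[symmetric]
        using b by (auto intro!: derivative_eq_intros)
    qed (use assms in \<open>auto intro!: continuous_intros\<close>)
    also have "sin (?b * l) = 0" using assms by (simp add: sin_zero_iff_int2)
    finally show ?thesis using False by simp
  qed
qed

lemma
  assumes l: "l > 0" and jk: "j \<ge> 1" "k \<ge> 1"
  shows integral_sin_sin: "(LINT t|lborel. indicator {0..l} t * (sin (real j * (pi / l) * t) * sin (real k * (pi / l) * t)))
      = (if j = k then l / 2 else 0)"
    and integral_cos_cos: "(LINT t|lborel. indicator {0..l} t * (cos (real j * (pi / l) * t) * cos (real k * (pi / l) * t)))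
      = (if j = k then l / 2 else 0)"
proof -
  let ?c = "\<lambda>m t. indicator {0..l} t * cos (real_of_int m * (pi / l) * t)"
  have arg: "real_of_int (int j - int k) * (pi / l) * t = real j * (pi / l) * t - real k * (pi / l) * t"
    "real_of_int (int j + int k) * (pi / l) * t = real j * (pi / l) * t + real k * (pi / l) * t" for t
    by (simp_all add: algebra_simps diff_divide_distrib add_divide_distrib)
  have s: "indicator {0..l} t * (sin (real j * (pi / l) * t) * sin (real k * (pi / l) * t)) =
      (?c (int j - int k) t - ?c (int j + int k) t) / 2" for t
    unfolding arg cos_diff cos_add by (simp add: algebra_simps)
  have c: "indicator {0..l} t * (cos (real j * (pi / l) * t) * cos (real k * (pi / l) * t)) =
      (?c (int j - int k) t + ?c (int j + int k) t) / 2" for t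
    unfolding arg cos_diff cos_add by (simp add: algebra_simps)
  note I = integral_cos_period[OF l]
  \<comment> \<open>Positive indices exclude j + k = 0, so only the frequency j - k can
    contribute.\<close>
  have nz: "int j + int k \<noteq> 0" using jk by simp
  show "(LINT t|lborel. indicator {0..l} t * (sin (real j * (pi / l) * t) * sin (real k * (pi / l) * t)))
      = (if j = k then l / 2 else 0)"
    unfolding s integral_divide_zero Bochner_Integration.integral_diff[OF I(2) I(2)] I(1) using nz by auto
  show "(LINT t|lborel. indicator {0..l} t * (cos (real j * (pi / l) * t) * cos (real k * (pi / l) * t)))
      = (if j = k then l / 2 else 0)"
    unfolding c integral_divide_zero Bochner_Integration.integral_add[OF I(2) I(2)] I(1) using nz by auto
qed

lemma integral_square_orthogonal_sum:
  fixes u :: "nat \<Rightarrow> real \<Rightarrow> real"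
  assumes cont: "\<And>j. continuous_on UNIV (u j)"
    and orth: "\<And>j k. j \<in> {1..N} \<Longrightarrow> k \<in> {1..N} \<Longrightarrow>
      (LINT t|lborel. indicator {0..l} t * (u j t * u k t)) = (if j = k then q else 0)"
  shows "(LINT t|lborel. (indicator {0..l} t * (\<Sum>j=1..N. c j * u j t))\<^sup>2) = q * (\<Sum>j=1..N. (c j)\<^sup>2)"
proof -
  have int: "integrable lborel (\<lambda>t. indicator {0..l} t * (u j t * u k t))" for j k
  proof -
    have "set_integrable lborel {0..l} (\<lambda>t. u j t * u k t)"
      by (intro borel_integrable_atLeastAtMost' continuous_intros continuous_on_subset[OF cont]) auto
    then show ?thesis by (simp add: set_integrable_def)
  qed
  have "(indicator {0..l} t * (\<Sum>j=1..N. c j * u j t))\<^sup>2 =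
      (\<Sum>j=1..N. \<Sum>k=1..N. c j * c k * (indicator {0..l} t * (u j t * u k t)))" for t
    by (simp add: power2_eq_square indicator_def sum_product mult_ac)
  then have "(LINT t|lborel. (indicator {0..l} t * (\<Sum>j=1..N. c j * u j t))\<^sup>2) =
      (\<Sum>j=1..N. \<Sum>k=1..N. c j * c k * (LINT t|lborel. indicator {0..l} t * (u j t * u k t)))"
    using int by (simp add: Bochner_Integration.integral_sum Bochner_Integration.integrable_sum)
  also have "\<dots> = (\<Sum>j=1..N. \<Sum>k=1..N. if k = j then q * (c j)\<^sup>2 else 0)"
    by (intro sum.cong refl) (auto simp: orth power2_eq_square)
  also have "\<dots> = q * (\<Sum>j=1..N. (c j)\<^sup>2)"
    by (simp add: sum_distrib_left)
  finally show ?thesis .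
qed

lemma integral_sine_sum_square:
  assumes "l > 0"
  shows "(LINT t|lborel. (sine_sum l N a t)\<^sup>2) = l / 2 * (\<Sum>j=1..N. (a j)\<^sup>2)"
  unfolding sine_sum_def
proof (rule integral_square_orthogonal_sum)
  show "continuous_on UNIV (\<lambda>t. sin (real j * (pi / l) * t))" for j by (intro continuous_intros)
qed (rule integral_sin_sin[OF assms], auto)

text \<open>A Bernstein inequality: the cosines are orthogonal too, and differentiation multiplies
  the j-th coefficient by j pi / l, which is at most N pi / l.\<close>

lemma integral_cosine_sum_square_le:
  assumes "l > 0"
  shows "(LINT t|lborel. (cosine_sum l N a t)\<^sup>2) \<le> (real N * (pi / l))\<^sup>2 * (l / 2 * (\<Sum>j=1..N. (a j)\<^sup>2))"
proof -
  have "(LINT t|lborel. (cosine_sum l N a t)\<^sup>2) = l / 2 * (\<Sum>j=1..N. (a j * (real j * (pi / l)))\<^sup>2)"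
    unfolding cosine_sum_def
  proof (rule integral_square_orthogonal_sum)
    show "continuous_on UNIV (\<lambda>t. cos (real j * (pi / l) * t))" for j by (intro continuous_intros)
  qed (rule integral_cos_cos[OF assms], auto)
  also have "\<dots> \<le> l / 2 * (\<Sum>j=1..N. (real N * (pi / l))\<^sup>2 * (a j)\<^sup>2)"
  proof (intro mult_left_mono sum_mono)
    fix j assume "j \<in> {1..N}"
    then have "(real j * (pi / l))\<^sup>2 \<le> (real N * (pi / l))\<^sup>2"
      using assms by (intro power_mono mult_right_mono) auto
    then show "(a j * (real j * (pi / l)))\<^sup>2 \<le> (real N * (pi / l))\<^sup>2 * (a j)\<^sup>2"
      unfolding power_mult_distrib[of "a j"] by (subst mult.commute) (rule mult_right_mono, auto)
  qed (use assms in auto)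
  also have "\<dots> = (real N * (pi / l))\<^sup>2 * (l / 2 * (\<Sum>j=1..N. (a j)\<^sup>2))"
    by (simp add: sum_distrib_left mult_ac)
  finally show ?thesis .
qed

lemma sine_sum_integrable: "integrable lborel (sine_sum l N a)"
proof -
  have "set_integrable lborel {0..l} (\<lambda>t. \<Sum>j=1..N. a j * sin (real j * (pi / l) * t))"
    by (intro borel_integrable_atLeastAtMost' continuous_intros)
  then show ?thesis by (simp add: set_integrable_def sine_sum_def[abs_def])
qed

text \<open>On the interval |s| is at most (1 + s^2)/2, and the integral of s^2 is known from
  orthogonality.\<close>

lemma integral_abs_sine_sum_le:
  assumes "0 < l" "l \<le> 1" "(\<Sum>j=1..N. (a j)\<^sup>2) \<le> 1"
  shows "(LINT t|lborel. \<bar>sine_sum l N a t\<bar>) \<le> 1"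
proof -
  have sq: "integrable lborel (\<lambda>t. (sine_sum l N a t)\<^sup>2)"
  proof -
    have "set_integrable lborel {0..l} (\<lambda>t. (\<Sum>j=1..N. a j * sin (real j * (pi / l) * t))\<^sup>2)"
      by (intro borel_integrable_atLeastAtMost' continuous_intros)
    moreover have "indicator {0..l} t *\<^sub>R (\<Sum>j=1..N. a j * sin (real j * (pi / l) * t))\<^sup>2 =
        (sine_sum l N a t)\<^sup>2" for t
      by (simp add: sine_sum_def power_mult_distrib indicator_def)
    ultimately show ?thesis by (simp add: set_integrable_def)
  qed
  have ind: "integrable lborel (indicator {0..l} :: real \<Rightarrow> real)"
    by (rule integrable_real_indicator) (auto simp: emeasure_lborel_Icc_eq)
  have "(LINT t|lborel. \<bar>sine_sum l N a t\<bar>) \<le>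
      (LINT t|lborel. (indicator {0..l} t + (sine_sum l N a t)\<^sup>2) / 2)"
  proof (rule integral_mono)
    show "integrable lborel (\<lambda>t. \<bar>sine_sum l N a t\<bar>)" using sine_sum_integrable by simp
    show "integrable lborel (\<lambda>t. (indicator {0..l} t + (sine_sum l N a t)\<^sup>2) / 2)" using sq ind by auto
    show "\<bar>sine_sum l N a t\<bar> \<le> (indicator {0..l} t + (sine_sum l N a t)\<^sup>2) / 2" for t
      using sum_squares_bound[of 1 "\<bar>sine_sum l N a t\<bar>"] sine_sum_outside[of t l N a]
      by (cases "t \<in> {0..l}") auto
  qed
  also have "\<dots> = (l + l / 2 * (\<Sum>j=1..N. (a j)\<^sup>2)) / 2"
    using sq ind assms by (simp add: integral_sine_sum_square)
  also have "\<dots> \<le> 1"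
    using mult_mono[of "l / 2" 1 "\<Sum>j=1..N. (a j)\<^sup>2" 1] assms by (simp add: sum_nonneg)
  finally show ?thesis .
qed

section \<open>Fourier transforms on the line and vanishing moments\<close>

lemma fourier_vanishing_moments_le:
  fixes g :: "real \<Rightarrow> real"
  assumes g: "integrable lborel g" and supp: "\<And>t. t \<notin> {0..l} \<Longrightarrow> g t = 0" and l: "l \<le> 1"
    and mom: "\<And>i. i \<le> k \<Longrightarrow> (LINT t|lborel. g t * t ^ i) = 0"
  shows "cmod (LINT t|lborel. of_real (g t) * exp (\<i> * of_real (\<xi> * t))) \<le>
    \<bar>\<xi>\<bar> ^ Suc k / fact k * (LINT t|lborel. \<bar>g t\<bar>)"
proof -
  have [measurable]: "g \<in> borel_measurable borel" using g by auto
  have gt: "integrable lborel (\<lambda>t. g t * t ^ i)" for i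
  proof (rule Bochner_Integration.integrable_bound[OF g])
    have "\<bar>t\<bar> ^ i \<le> 1" if "t \<in> {0..l}" for t using that l by (intro power_le_one) auto
    then have "\<bar>g t\<bar> * \<bar>t\<bar> ^ i \<le> \<bar>g t\<bar>" for t
      using supp[of t] by (cases "t \<in> {0..l}") (auto intro!: mult_left_le)
    then show "AE t in lborel. norm (g t * t ^ i) \<le> norm (g t)"
      by (simp add: abs_mult power_abs)
  qed measurable
  define p where "p t = (\<Sum>i\<le>k. (\<i> * of_real (\<xi> * t)) ^ i / fact i)" for t :: real
  have ptE: "of_real (g t) * p t = (\<Sum>i\<le>k. ((\<i> * of_real \<xi>) ^ i / fact i) * of_real (g t * t ^ i))" for t
    by (simp add: p_def sum_distrib_left power_mult_distrib mult_ac)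
  have gp: "integrable lborel (\<lambda>t. of_real (g t) * p t)"
    unfolding ptE using gt by (intro Bochner_Integration.integrable_sum integrable_mult_right integrable_of_real)
  have "(LINT t|lborel. of_real (g t) * p t) =
      (\<Sum>i\<le>k. ((\<i> * of_real \<xi>) ^ i / fact i) * (LINT t|lborel. complex_of_real (g t * t ^ i)))"
    unfolding ptE using gt
    by (subst Bochner_Integration.integral_sum)
      (auto intro!: integrable_mult_right integrable_of_real simp del: of_real_mult of_real_power)
  also have "\<dots> = 0"
    by (intro sum.neutral) (auto simp: mom integral_of_real simp del: of_real_mult of_real_power)
  finally have gp0: "(LINT t|lborel. of_real (g t) * p t) = 0" .
  have ge: "integrable lborel (\<lambda>t. of_real (g t) * exp (\<i> * of_real (\<xi> * t)))"
    by (rule Bochner_Integration.integrable_bound[OF g]) (auto simp: norm_mult)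
  have "(LINT t|lborel. of_real (g t) * exp (\<i> * of_real (\<xi> * t))) =
      (LINT t|lborel. of_real (g t) * (exp (\<i> * of_real (\<xi> * t)) - p t))"
    using ge gp gp0 by (simp add: right_diff_distrib)
  also have "cmod \<dots> \<le> (LINT t|lborel. cmod (of_real (g t) * (exp (\<i> * of_real (\<xi> * t)) - p t)))"
    by (rule integral_norm_bound)
  also have "\<dots> \<le> (LINT t|lborel. \<bar>\<xi>\<bar> ^ Suc k / fact k * \<bar>g t\<bar>)"
  proof (rule integral_mono)
    show "integrable lborel (\<lambda>t. cmod (of_real (g t) * (exp (\<i> * of_real (\<xi> * t)) - p t)))"
      using ge gp by (intro integrable_norm) (simp add: right_diff_distrib)
    show "integrable lborel (\<lambda>t. \<bar>\<xi>\<bar> ^ Suc k / fact k * \<bar>g t\<bar>)" using g by simp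
    fix t
    show "cmod (of_real (g t) * (exp (\<i> * of_real (\<xi> * t)) - p t)) \<le> \<bar>\<xi>\<bar> ^ Suc k / fact k * \<bar>g t\<bar>"
    proof (cases "t \<in> {0..l}")
      case True
      \<comment> \<open>The remainder bound \<open>Taylor_exp\<close> carries the factor exp |Re z|,
        which is 1 for an imaginary argument, and its denominator is \<open>fact k\<close>, not
        \<open>fact (Suc k)\<close>.\<close>
      have "cmod (exp (\<i> * of_real (\<xi> * t)) - p t) \<le> \<bar>\<xi> * t\<bar> ^ Suc k / fact k"
        using Taylor_exp[of "\<i> * of_real (\<xi> * t)" k] by (simp add: p_def norm_mult abs_mult)
      also have "\<dots> \<le> \<bar>\<xi>\<bar> ^ Suc k / fact k"
        using True l by (intro divide_right_mono power_mono) (auto simp: abs_mult intro!: mult_left_le)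
      finally have "\<bar>g t\<bar> * cmod (exp (\<i> * of_real (\<xi> * t)) - p t) \<le> \<bar>g t\<bar> * (\<bar>\<xi>\<bar> ^ Suc k / fact k)"
        by (rule mult_left_mono) simp
      then show ?thesis by (simp only: norm_mult norm_of_real mult.commute)
    qed (simp add: supp)
  qed
  also have "\<dots> = \<bar>\<xi>\<bar> ^ Suc k / fact k * (LINT t|lborel. \<bar>g t\<bar>)" by simp
  finally show ?thesis .
qed

text \<open>Two bounds are squared and added: the integral is at most 1 in modulus, because the
  interval has length at most 1, and |xi| times it is at most pi, by partial integration. The
  boundary terms vanish with the sine, and the cosine that remains contributes at most pi / l times
  the length l.\<close>

lemma fourier_sine_decay:
  assumes l: "0 < l" "l \<le> 1"
  defines "s \<equiv> \<lambda>t. indicator {0..l} t * sin (pi / l * t)"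
  shows "(cmod (LINT t|lborel. of_real (s t) * exp (\<i> * of_real (\<xi> * t))))\<^sup>2 \<le> (1 + pi\<^sup>2) / (1 + \<xi>\<^sup>2)"
proof -
  have [simp]: "l \<noteq> 0" using l by simp
  define E where "E t = exp (\<i> * of_real (\<xi> * t))" for t
  define I where "I = (LINT t|lborel. of_real (s t) * E t)"
  define c where "c t = indicator {0..l} t * cos (pi / l * t)" for t
  have E1: "cmod (E t) = 1" for t by (simp add: E_def)
  have Ec: "continuous_on A E" for A unfolding E_def by (intro continuous_intros)
  have intl: "(LINT t|lborel. indicator {0..l} t) = (l::real)" using l by simp
  have ind: "integrable lborel (indicator {0..l} :: real \<Rightarrow> real)"
    by (rule integrable_real_indicator) (auto simp: emeasure_lborel_Icc_eq)
  have int: "integrable lborel (\<lambda>t. complex_of_real (indicator {0..l} t * u t) * E t)"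
    if "continuous_on {0..l} u" for u
  proof -
    have "set_integrable lborel {0..l} (\<lambda>t. complex_of_real (u t) * E t)"
      using that by (intro borel_integrable_atLeastAtMost' continuous_intros Ec)
    then show ?thesis by (simp add: set_integrable_def scaleR_conv_of_real mult.assoc)
  qed
  have b: "cmod (LINT t|lborel. complex_of_real (indicator {0..l} t * u t) * E t) \<le> l"
    if u: "\<And>t. \<bar>u t\<bar> \<le> 1" and uc: "continuous_on {0..l} u" for u
  proof -
    have "cmod (LINT t|lborel. complex_of_real (indicator {0..l} t * u t) * E t) \<le>
        (LINT t|lborel. cmod (complex_of_real (indicator {0..l} t * u t) * E t))"
      by (rule integral_norm_bound)
    also have "\<dots> \<le> (LINT t|lborel. indicator {0..l} t)"
      by (rule integral_mono[OF integrable_norm[OF int[OF uc]] ind])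
        (use u in \<open>auto simp: norm_mult E1 indicator_def\<close>)
    finally show ?thesis using intl by simp
  qed
  have I1: "cmod I \<le> 1"
    unfolding I_def s_def using l by (intro order_trans[OF b]) (auto intro!: continuous_intros)
  have "(LINT t|lborel. indicator {0..l} t *\<^sub>R
      (of_real (pi / l * cos (pi / l * t)) * E t + of_real (sin (pi / l * t)) * (\<i> * of_real \<xi> * E t))) =
      of_real (sin (pi / l * l)) * E l - of_real (sin (pi / l * 0)) * E 0"
  proof (rule integral_FTC_atLeastAtMost)
    fix t
    have 1: "((\<lambda>t. complex_of_real (sin (pi / l * t))) has_vector_derivative of_real (pi / l * cos (pi / l * t))) (at t within {0..l})"
      by (rule has_vector_derivative_of_real)
        (auto intro!: derivative_eq_intros simp flip: has_real_derivative_iff_has_vector_derivative)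
    have 2: "(E has_vector_derivative (\<i> * of_real \<xi> * E t)) (at t within {0..l})"
    proof -
      have "((\<lambda>z. exp (\<i> * of_real \<xi> * z)) has_field_derivative
          \<i> * of_real \<xi> * exp (\<i> * of_real \<xi> * of_real t)) (at (of_real t))"
        by (auto intro!: derivative_eq_intros)
      from has_vector_derivative_real_field[OF this] show ?thesis
        by (simp add: E_def[abs_def] mult.assoc)
    qed
    from has_vector_derivative_mult[OF 1 2]
    show "((\<lambda>t. of_real (sin (pi / l * t)) * E t) has_vector_derivative
        (of_real (pi / l * cos (pi / l * t)) * E t + of_real (sin (pi / l * t)) * (\<i> * of_real \<xi> * E t)))
        (at t within {0..l})"
      by (simp add: add.commute)
  qed (use l in \<open>auto intro!: continuous_intros Ec\<close>)
  also have "\<dots> = 0" using l by simp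
  also have "(\<lambda>t. indicator {0..l} t *\<^sub>R
      (of_real (pi / l * cos (pi / l * t)) * E t + of_real (sin (pi / l * t)) * (\<i> * of_real \<xi> * E t))) =
      (\<lambda>t. of_real (pi / l) * (complex_of_real (c t) * E t) + \<i> * of_real \<xi> * (of_real (s t) * E t))"
    by (auto simp: fun_eq_iff c_def s_def indicator_def)
  finally have sum0: "(LINT t|lborel. of_real (pi / l) * (complex_of_real (c t) * E t) +
      \<i> * of_real \<xi> * (of_real (s t) * E t)) = 0" .
  have ci: "integrable lborel (\<lambda>t. complex_of_real (c t) * E t)"
    unfolding c_def by (intro int continuous_intros)
  have si: "integrable lborel (\<lambda>t. complex_of_real (s t) * E t)"
    unfolding s_def by (intro int continuous_intros)
  have "of_real (pi / l) * (LINT t|lborel. complex_of_real (c t) * E t) + \<i> * of_real \<xi> * I = 0"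
    using sum0 unfolding I_def
      Bochner_Integration.integral_add[OF integrable_mult_right[OF ci] integrable_mult_right[OF si]]
      integral_mult_right_zero .
  then have "\<i> * of_real \<xi> * I = - (of_real (pi / l) * (LINT t|lborel. complex_of_real (c t) * E t))"
    by (simp add: eq_neg_iff_add_eq_0 add.commute)
  then have "cmod (\<i> * of_real \<xi> * I) = cmod (of_real (pi / l) * (LINT t|lborel. complex_of_real (c t) * E t))"
    by simp
  also have "\<dots> \<le> pi / l * l"
    unfolding norm_mult norm_of_real c_def using l
    by (intro mult_mono b) (auto intro!: continuous_intros)
  finally have I2: "\<bar>\<xi>\<bar> * cmod I \<le> pi" using l by (simp add: norm_mult)
  have "(1 + \<xi>\<^sup>2) * (cmod I)\<^sup>2 = (cmod I)\<^sup>2 + (\<bar>\<xi>\<bar> * cmod I)\<^sup>2"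
    by (simp add: power_mult_distrib algebra_simps)
  also have "\<dots> \<le> 1\<^sup>2 + pi\<^sup>2"
    by (intro add_mono power_mono I1 I2) auto
  finally have "(cmod I)\<^sup>2 \<le> (1 + pi\<^sup>2) / (1 + \<xi>\<^sup>2)"
    by (subst pos_le_divide_eq) (auto simp: add_pos_nonneg mult.commute)
  then show ?thesis unfolding I_def E_def .
qed

text \<open>Gaussian elimination: if equation \<open>i0\<close> involves the unknown
  \<open>j0\<close>, solve it for \<open>j0\<close> and eliminate that unknown from the rest; one
  equation and one unknown disappear together.\<close>

lemma homogeneous_system_nontrivial:
  fixes c :: "'i \<Rightarrow> 'j \<Rightarrow> real"
  assumes "finite I" "finite J" "card I < card J"
  shows "\<exists>a. (\<exists>j\<in>J. a j \<noteq> 0) \<and> (\<forall>i\<in>I. (\<Sum>j\<in>J. a j * c i j) = 0)"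
  using assms
proof (induction I arbitrary: J c rule: finite_induct)
  case empty
  then have "J \<noteq> {}" by auto
  then show ?case by (intro exI[of _ "\<lambda>_. 1"]) auto
next
  case (insert i0 I)
  show ?case
  proof (cases "\<forall>j\<in>J. c i0 j = 0")
    case True
    obtain a where "\<exists>j\<in>J. a j \<noteq> 0" "\<forall>i\<in>I. (\<Sum>j\<in>J. a j * c i j) = 0"
      using insert.IH[of J c] insert.prems insert.hyps by auto
    then show ?thesis using True by (intro exI[of _ a]) auto
  next
    case False
    then obtain j0 where j0: "j0 \<in> J" "c i0 j0 \<noteq> 0" by blast
    define J' where "J' = J - {j0}"
    have J': "finite J'" "card I < card J'" "j0 \<notin> J'" "J = insert j0 J'"
      using insert.prems insert.hyps j0 by (auto simp: J'_def)
    define c' where "c' i j = c i j - c i0 j * (c i j0 / c i0 j0)" for i j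
    obtain a where a: "\<exists>j\<in>J'. a j \<noteq> 0" "\<forall>i\<in>I. (\<Sum>j\<in>J'. a j * c' i j) = 0"
      using insert.IH[of J' c'] J' by blast
    define x where "x = - (\<Sum>j\<in>J'. a j * c i0 j) / c i0 j0"
    define a' where "a' = a(j0 := x)"
    have sum': "(\<Sum>j\<in>J. a' j * c i j) = x * c i j0 + (\<Sum>j\<in>J'. a j * c i j)" for i
    proof -
      have "(\<Sum>j\<in>J'. a' j * c i j) = (\<Sum>j\<in>J'. a j * c i j)"
        using J'(3) by (intro sum.cong) (auto simp: a'_def)
      then show ?thesis using J' by (simp add: a'_def)
    qed
    have "(\<Sum>j\<in>J. a' j * c i j) = 0" if "i \<in> insert i0 I" for i
    proof (cases "i = i0")
      case True
      then show ?thesis using j0 by (simp add: sum' x_def)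
    next
      case False
      then have "0 = (\<Sum>j\<in>J'. a j * c' i j)" using a that by simp
      also have "\<dots> = (\<Sum>j\<in>J'. a j * c i j) - (\<Sum>j\<in>J'. a j * c i0 j) * (c i j0 / c i0 j0)"
        by (simp only: c'_def right_diff_distrib sum_subtractf sum_distrib_right mult.assoc)
      also have "\<dots> = (\<Sum>j\<in>J. a' j * c i j)" by (simp add: sum' x_def)
      finally show ?thesis by simp
    qed
    moreover have "\<exists>j\<in>J. a' j \<noteq> 0" using a(1) J' by (auto simp: a'_def)
    ultimately show ?thesis by blast
  qed
qed

lemma sine_sum_vanishing_moments:
  "\<exists>a. (\<Sum>j=1..k+2. (a j)\<^sup>2) = 1 \<and> (\<forall>i\<le>k. (LINT t|lborel. sine_sum l (k + 2) a t * t ^ i) = 0)"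
proof -
  let ?J = "{1..k+2}"
  let ?s = "\<lambda>j t. indicator {0..l} t * (sin (real j * (pi / l) * t))"
  define c where "c i j = (LINT t|lborel. ?s j t * t ^ i)" for i j :: nat
  \<comment> \<open>The moments of order 0 to k give k + 1 equations for k + 2 unknowns.\<close>
  obtain a where a: "\<exists>j\<in>?J. a j \<noteq> 0" "\<And>i. i \<le> k \<Longrightarrow> (\<Sum>j\<in>?J. a j * c i j) = 0"
    using homogeneous_system_nontrivial[of "{..k}" ?J c] by auto
  define r where "r = (\<Sum>j\<in>?J. (a j)\<^sup>2)"
  have r: "r > 0"
  proof -
    obtain j where "j \<in> ?J" "a j \<noteq> 0" using a(1) by blast
    then show ?thesis unfolding r_def by (intro sum_pos2[of _ j]) auto
  qed
  define a' where "a' j = a j / sqrt r" for j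
  have int: "integrable lborel (\<lambda>t. ?s j t * t ^ i)" for i j
  proof -
    have "set_integrable lborel {0..l} (\<lambda>t. sin (real j * (pi / l) * t) * t ^ i)"
      by (intro borel_integrable_atLeastAtMost' continuous_intros)
    then show ?thesis by (simp add: set_integrable_def mult.assoc)
  qed
  have "(\<Sum>j\<in>?J. (a' j)\<^sup>2) = 1"
    unfolding a'_def power_divide sum_divide_distrib[symmetric] r_def[symmetric] using r by simp
  moreover have "(LINT t|lborel. sine_sum l (k + 2) a' t * t ^ i) = 0" if "i \<le> k" for i
  proof -
    have "sine_sum l (k + 2) a' t * t ^ i = (\<Sum>j\<in>?J. (a j / sqrt r) * (?s j t * t ^ i))" for t
      by (simp only: sine_sum_def sum_distrib_left sum_distrib_right a'_def mult_ac)
    then have "(LINT t|lborel. sine_sum l (k + 2) a' t * t ^ i) = (\<Sum>j\<in>?J. (a j / sqrt r) * c i j)"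
      unfolding c_def using int
      by (simp only:) (subst Bochner_Integration.integral_sum, auto)
    also have "\<dots> = (\<Sum>j\<in>?J. a j * c i j) / sqrt r"
      by (simp only: sum_divide_distrib times_divide_eq_left)
    finally show ?thesis using a(2)[OF that] by simp
  qed
  ultimately show ?thesis by blast
qed

section \<open>Witnesses\<close>

lemma L2_norm_tensor_square:
  fixes f :: "'n::finite \<Rightarrow> real \<Rightarrow> real"
  assumes "\<And>j. integrable lborel (\<lambda>t. (f j t)\<^sup>2)"
  shows "(L2_norm lborel (\<lambda>x. complex_of_real (tensor f x)))\<^sup>2 = (\<Prod>j\<in>UNIV. (LINT t|lborel. (f j t)\<^sup>2))"
proof -
  have "(L2_norm lborel (\<lambda>x. complex_of_real (tensor f x)))\<^sup>2 =
      (LINT x|lborel. (cmod (complex_of_real (tensor f x)))\<^sup>2)"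
    by (simp add: L2_norm_def)
  also have "\<dots> = (LINT x|lborel. (\<Prod>j\<in>UNIV. (f j (x $ j))\<^sup>2))"
    unfolding norm_of_real power2_abs by (simp add: tensor_def prod_power_distrib)
  also have "\<dots> = (\<Prod>j\<in>UNIV. (LINT t|lborel. (f j t)\<^sup>2))"
    by (rule integral_lborel_cart_prod[OF assms])
  finally show ?thesis .
qed

lemma integrable_square_bounded_support:
  fixes g :: "real \<Rightarrow> real"
  assumes [measurable]: "g \<in> borel_measurable borel" and b: "\<And>t. \<bar>g t\<bar> \<le> M"
    and supp: "\<And>t. t \<notin> {0..l} \<Longrightarrow> g t = 0"
  shows "integrable lborel (\<lambda>t. (g t)\<^sup>2)"
proof (rule Bochner_Integration.integrable_bound)
  show "integrable lborel (\<lambda>t. M\<^sup>2 * indicator {0..l} t :: real)"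
    by (intro integrable_mult_right integrable_real_indicator) (auto simp: emeasure_lborel_Icc_eq)
  have "(g t)\<^sup>2 \<le> M\<^sup>2" for t using power_mono[OF b[of t], of 2] by simp
  then show "AE t in lborel. norm ((g t)\<^sup>2) \<le> norm (M\<^sup>2 * indicator {0..l} t :: real)"
    using supp by (auto simp: indicator_def)
qed measurable

text \<open>Common frame of both witnesses: the j-th factor is a sine sum with coefficients
  \<open>\<alpha> j\<close>. By \<open>l_small\<close> the cube of side \<open>l\<close> lies in the
  open unit ball, as the Euclidean norm is at most the sum of the absolute coordinates.\<close>

locale sine_tensor =
  fixes l :: real and N :: nat and \<alpha> :: "'n::finite \<Rightarrow> nat \<Rightarrow> real"
  assumes l_pos: "0 < l" and l_small: "l * real CARD('n) < 1"
begin

definition f :: "'n \<Rightarrow> real \<Rightarrow> real" where "f j = sine_sum l N (\<alpha> j)"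

definition h :: "real^'n \<Rightarrow> complex" where "h x = of_real (tensor f x)"

text \<open>One bound for all factors and their derivatives, in the form that the lemmas on
  \<open>tensor\<close> ask for. It secures integrability; the constants of the witnesses do not
  depend on it.\<close>

definition M :: real where
  "M = (\<Sum>j\<in>UNIV. \<Sum>k=1..N. \<bar>\<alpha> j k\<bar>) + (\<Sum>j\<in>UNIV. \<Sum>k=1..N. \<bar>\<alpha> j k * (real k * (pi / l))\<bar>)"

lemma f_measurable: "f j \<in> borel_measurable borel"
  unfolding f_def by measurable

lemma f_bounded: "\<bar>f j t\<bar> \<le> M"
proof -
  have "\<bar>f j t\<bar> \<le> (\<Sum>k=1..N. \<bar>\<alpha> j k\<bar>)" unfolding f_def by (rule sine_sum_bounded)
  also have "\<dots> \<le> (\<Sum>j\<in>UNIV. \<Sum>k=1..N. \<bar>\<alpha> j k\<bar>)"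
    by (rule member_le_sum) (auto intro: sum_nonneg)
  also have "\<dots> \<le> M" unfolding M_def by (simp add: sum_nonneg)
  finally show ?thesis .
qed

lemma f'_bounded: "\<bar>cosine_sum l N (\<alpha> j) t\<bar> \<le> M"
proof -
  have "\<bar>cosine_sum l N (\<alpha> j) t\<bar> \<le> (\<Sum>k=1..N. \<bar>\<alpha> j k * (real k * (pi / l))\<bar>)"
    by (rule cosine_sum_bounded)
  also have "\<dots> \<le> (\<Sum>j\<in>UNIV. \<Sum>k=1..N. \<bar>\<alpha> j k * (real k * (pi / l))\<bar>)"
    by (rule member_le_sum[where f="\<lambda>j. \<Sum>k=1..N. \<bar>\<alpha> j k * (real k * (pi / l))\<bar>"]) (auto intro: sum_nonneg)
  also have "\<dots> \<le> M" unfolding M_def by (simp add: sum_nonneg)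
  finally show ?thesis .
qed

lemma f_outside: "t \<notin> {0..l} \<Longrightarrow> f j t = 0"
  unfolding f_def by (rule sine_sum_outside)

lemma f_upd:
  "(f(i := cosine_sum l N (\<alpha> i))) j \<in> borel_measurable borel"
  "\<bar>(f(i := cosine_sum l N (\<alpha> i))) j t\<bar> \<le> M"
  "t \<notin> {0..l} \<Longrightarrow> (f(i := cosine_sum l N (\<alpha> i))) j t = 0"
  using f_measurable f_bounded f'_bounded f_outside cosine_sum_outside by auto

lemma h_integrable: "integrable lborel h"
  unfolding h_def[abs_def]
  by (intro integrable_of_real tensor_integrable[OF f_measurable f_bounded f_outside])

lemma h_L2: "h \<in> L2 lborel"
  unfolding h_def[abs_def] by (rule tensor_L2[OF f_measurable f_bounded f_outside])

lemma cube_subset_ball: "(cbox 0 (vec l) :: (real^'n) set) \<subseteq> ball 0 1"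
proof
  fix x :: "real^'n" assume x: "x \<in> cbox 0 (vec l)"
  have "norm x \<le> (\<Sum>j\<in>UNIV. \<bar>x $ j\<bar>)" by (rule norm_le_l1_cart)
  also have "\<dots> \<le> (\<Sum>j\<in>(UNIV::'n set). l)"
    using x by (intro sum_mono) (auto simp: mem_box_cart)
  also have "\<dots> < 1" using l_small by (simp add: mult.commute)
  finally show "x \<in> ball 0 1" by simp
qed

lemma h_outside: "x \<notin> ball 0 1 \<Longrightarrow> h x = 0"
  using tensor_outside[of l f x, OF f_outside] cube_subset_ball unfolding h_def by (metis of_real_0 subsetD)

lemma h_weak_deriv:
  "is_weak_deriv i h (\<lambda>x. of_real (tensor (f(i := cosine_sum l N (\<alpha> i))) x))"
  unfolding h_def[abs_def]
proof (rule tensor_weak_deriv[OF f_measurable f_bounded f_outside])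
  show "\<bar>f i s - f i t\<bar> \<le> (\<Sum>j=1..N. \<bar>\<alpha> i j * (real j * (pi / l))\<bar>) * \<bar>s - t\<bar>" for s t
    unfolding f_def by (rule sine_sum_lipschitz[OF l_pos])
  show "(f i has_real_derivative cosine_sum l N (\<alpha> i) t) (at t)" if "t \<notin> {0, l}" for t
    unfolding f_def using that by (rule sine_sum_has_derivative)
qed auto

lemma h_deriv_L2: "(\<lambda>x. of_real (tensor (f(i := cosine_sum l N (\<alpha> i))) x)) \<in> L2 lborel"
  by (rule tensor_L2[OF f_upd])

lemma h_H1_ball: "h \<in> H1_ball"
proof -
  have "h \<in> H1" unfolding H1_def using h_L2 h_weak_deriv h_deriv_L2 by blast
  moreover have "- cball 0 1 \<subseteq> \<Union>{U. open U \<and> (AE x in lborel. x \<in> U \<longrightarrow> h x = 0)}"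
    by (rule Union_upper) (auto intro!: h_outside)
  then have "ess_support h \<subseteq> cball 0 1" unfolding ess_support_def by blast
  ultimately show ?thesis unfolding H1_ball_def by blast
qed

lemma h_norm_square: "(L2_norm lborel h)\<^sup>2 = (\<Prod>j\<in>UNIV. l / 2 * (\<Sum>k=1..N. (\<alpha> j k)\<^sup>2))"
proof -
  have "integrable lborel (\<lambda>t. (f j t)\<^sup>2)" for j
    by (rule integrable_square_bounded_support[OF f_measurable f_bounded f_outside])
  from L2_norm_tensor_square[of f, OF this] show ?thesis
    unfolding h_def[abs_def] by (simp add: f_def integral_sine_sum_square[OF l_pos])
qed

lemma h_weak_deriv_norm_le:
  "(L2_norm lborel (weak_deriv i h))\<^sup>2 \<le> (real N * (pi / l))\<^sup>2 * (L2_norm lborel h)\<^sup>2"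
proof -
  let ?g = "f(i := cosine_sum l N (\<alpha> i))"
  let ?a = "\<lambda>j. l / 2 * (\<Sum>k=1..N. (\<alpha> j k)\<^sup>2)"
  have "integrable lborel (\<lambda>t. (?g j t)\<^sup>2)" for j
    by (rule integrable_square_bounded_support[OF f_upd])
  from L2_norm_tensor_square[of ?g, OF this]
  have "(L2_norm lborel (weak_deriv i h))\<^sup>2 = (\<Prod>j\<in>UNIV. (LINT t|lborel. (?g j t)\<^sup>2))"
    using L2_norm_weak_deriv[OF h_deriv_L2 h_weak_deriv, of i] by (simp only:)
  also have "\<dots> = (LINT t|lborel. (cosine_sum l N (\<alpha> i) t)\<^sup>2) * (\<Prod>j\<in>UNIV - {i}. (LINT t|lborel. (?g j t)\<^sup>2))"
    by (subst prod.remove[of UNIV i]) auto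
  also have "(\<Prod>j\<in>UNIV - {i}. (LINT t|lborel. (?g j t)\<^sup>2)) = (\<Prod>j\<in>UNIV - {i}. ?a j)"
    by (rule prod.cong) (auto simp: f_def integral_sine_sum_square[OF l_pos])
  also have "(LINT t|lborel. (cosine_sum l N (\<alpha> i) t)\<^sup>2) * (\<Prod>j\<in>UNIV - {i}. ?a j) \<le>
      ((real N * (pi / l))\<^sup>2 * ?a i) * (\<Prod>j\<in>UNIV - {i}. ?a j)"
    using l_pos by (intro mult_right_mono integral_cosine_sum_square_le prod_nonneg) (auto simp: sum_nonneg)
  also have "\<dots> = (real N * (pi / l))\<^sup>2 * (\<Prod>j\<in>UNIV. ?a j)"
    by (subst prod.remove[of UNIV i]) (auto simp: mult.assoc)
  finally show ?thesis unfolding h_norm_square .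
qed

text \<open>Each derivative costs at most N pi / l times the norm of \<open>h\<close>, and N^2 >= 1
  absorbs the term of order zero as well. So the loss is linear in \<open>N\<close>, with a constant
  that depends only on the dimension and \<open>l\<close>.\<close>

lemma h_H1_norm_le:
  assumes "N \<ge> 1"
  shows "H1_norm h \<le> real N * sqrt (1 + real CARD('n) * (pi / l)\<^sup>2) * L2_norm lborel h"
proof -
  let ?n = "real CARD('n)" and ?q = "L2_norm lborel h"
  define b where "b = pi / l"
  have "?q\<^sup>2 + (\<Sum>i\<in>UNIV. (L2_norm lborel (weak_deriv i h))\<^sup>2) \<le>
      ?q\<^sup>2 + (\<Sum>i\<in>(UNIV::'n set). (real N * b)\<^sup>2 * ?q\<^sup>2)"
    unfolding b_def by (intro add_left_mono sum_mono h_weak_deriv_norm_le)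
  also have "\<dots> = (1 + ?n * (real N)\<^sup>2 * b\<^sup>2) * ?q\<^sup>2"
    by (simp add: power_mult_distrib algebra_simps)
  also have "\<dots> \<le> ((real N)\<^sup>2 * (1 + ?n * b\<^sup>2)) * ?q\<^sup>2"
  proof (intro mult_right_mono)
    have "1 \<le> (real N)\<^sup>2" using assms by (simp add: one_le_power)
    then show "1 + ?n * (real N)\<^sup>2 * b\<^sup>2 \<le> (real N)\<^sup>2 * (1 + ?n * b\<^sup>2)" by (simp add: algebra_simps)
  qed simp
  finally have "H1_norm h \<le> sqrt (((real N)\<^sup>2 * (1 + ?n * b\<^sup>2)) * ?q\<^sup>2)"
    unfolding H1_norm_def by (rule real_sqrt_le_mono)
  then show ?thesis unfolding b_def[symmetric] by (simp add: real_sqrt_mult L2_norm_nonneg)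
qed

lemma F_kernel_h:
  "F_kernel \<kappa> h y \<theta> = of_real (\<kappa> powr ((real CARD('n) - 1) / 2)) *
    (\<Prod>j\<in>UNIV. (LINT t|lborel. of_real (sine_sum l N (\<alpha> j) t) * exp (\<i> * of_real ((\<kappa> * (\<theta> $ j - y $ j)) * t))))"
proof -
  let ?g = "\<lambda>j t. complex_of_real (f j t) * exp (\<i> * of_real ((\<kappa> * (\<theta> $ j - y $ j)) * t))"
  have int: "integrable lborel (?g j)" for j
    by (rule Bochner_Integration.integrable_bound[OF sine_sum_integrable[of l N "\<alpha> j"]])
      (auto simp: norm_mult f_def)
  have "h x * exp (\<i> * of_real (\<kappa> * ((\<theta> - y) \<bullet> x))) = (\<Prod>j\<in>UNIV. ?g j (x $ j))" for x
  proof -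
    have "\<i> * of_real (\<kappa> * ((\<theta> - y) \<bullet> x)) = (\<Sum>j\<in>UNIV. \<i> * of_real ((\<kappa> * (\<theta> $ j - y $ j)) * x $ j))"
      by (simp add: inner_vec_def sum_distrib_left mult.assoc)
    then show ?thesis
      by (simp add: h_def tensor_def prod.distrib exp_sum)
  qed
  then have "(LINT x|lborel. h x * exp (\<i> * of_real (\<kappa> * ((\<theta> - y) \<bullet> x)))) = (\<Prod>j\<in>UNIV. (LINT t|lborel. ?g j t))"
    using integral_lborel_cart_prod[OF int] by simp
  then show ?thesis unfolding F_kernel_def f_def by simp
qed

end

section \<open>Witness for the linear bound\<close>

lemma sine_sum_scale: "sine_sum l N (\<lambda>k. c * a k) t = c * sine_sum l N a t"
  by (simp add: sine_sum_def sum_distrib_left mult_ac)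

lemma sum_indicator_1: "N \<ge> 1 \<Longrightarrow> (\<Sum>k=1..N. (if k = (1::nat) then 1 else 0 :: real)\<^sup>2) = 1"
  by (simp add: if_distrib[of "\<lambda>x. x\<^sup>2"] cong: if_cong)

lemma prod_scaled_delta:
  "(\<Prod>j\<in>(UNIV::'n::finite set). r * (if j = i then x else 1)) = r ^ CARD('n) * (x::real)"
  unfolding prod.distrib by simp

text \<open>The witness is a fixed function times t / R; the point is that \<open>R\<close> can be
  taken independent of \<kappa>.\<close>

lemma exists_linear_witness:
  "\<exists>c>0. \<forall>\<kappa>\<ge>1. \<forall>t. 0 < t \<and> t \<le> 1 \<longrightarrow>
    (\<exists>h :: real^'n \<Rightarrow> complex. h \<in> H1_ball \<and> H1_norm h \<le> 1 \<and>
      HS_norm sphere_measure (F_op \<kappa> h) \<le> t \<and> c * t \<le> L2_norm lborel h)"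
proof -
  define n where "n = CARD('n)"
  have n: "n \<ge> 1" unfolding n_def by (simp add: Suc_leI)
  define l where "l = 1 / (2 * real n)"
  have l: "0 < l" "l * real n < 1" using n by (auto simp: l_def)
  have l1: "l \<le> 1" using n by (simp add: l_def)
  define \<sigma> where "\<sigma> = measure (sphere_measure :: (real^'n) measure) (sphere 0 1)"
  define q where "q = (l / 2) ^ n"
  define B where "B = sqrt (1 + real n * (pi / l)\<^sup>2)"
  \<comment> \<open>1 + pi^2 comes from \<open>fourier_sine_decay\<close>, 3 pi from the integral
    over the sphere, and \<sigma> from the integration over the second variable of the
    kernel.\<close>
  define C1 where "C1 = sqrt (((1 + pi\<^sup>2) * (3 * pi)) ^ n * \<sigma>)"
  \<comment> \<open>Large enough that scaling by t / R gives both the Hilbert-Schmidt bound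
    \<open>t\<close> and the \<open>H1\<close> bound 1.\<close>
  define R where "R = 1 + C1 + B * sqrt q"
  have q: "q > 0" using l by (simp add: q_def)
  have \<sigma>: "\<sigma> \<ge> 0" by (simp add: \<sigma>_def)
  have BC: "B \<ge> 0" "C1 \<ge> 0" using \<sigma> by (auto simp: B_def C1_def)
  then have R: "R > 0" "C1 \<le> R" "B * sqrt q \<le> R" using q by (auto simp: R_def add_pos_nonneg)
  define i0 :: 'n where "i0 = undefined"
  show ?thesis
  proof (intro exI[of _ "sqrt q / R"] conjI allI impI)
    show "sqrt q / R > 0" using q R by simp
    fix \<kappa> t :: real assume \<kappa>: "\<kappa> \<ge> 1" and t: "0 < t \<and> t \<le> 1"
    define c where "c = t / R"
    have c: "c > 0" using t R by (simp add: c_def)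
    \<comment> \<open>Every factor is a multiple of the first sine; only the factor
      \<open>i0\<close> carries the scale, so \<open>h\<close> is linear in
      \<open>c\<close>.\<close>
    define \<alpha> where "\<alpha> j k = (if j = i0 then c else 1) * (if k = 1 then 1 else 0)" for j :: 'n and k :: nat
    interpret sine_tensor l 1 \<alpha> using l by unfold_locales (auto simp: n_def)
    have "(L2_norm lborel h)\<^sup>2 = (\<Prod>j\<in>UNIV. l / 2 * (if j = i0 then c\<^sup>2 else 1))"
      unfolding h_norm_square by (intro prod.cong) (auto simp: \<alpha>_def)
    also have "\<dots> = (c * sqrt q)\<^sup>2"
      unfolding prod_scaled_delta using q by (simp add: power_mult_distrib flip: n_def q_def)
    finally have L2: "L2_norm lborel h = c * sqrt q"
      using c q by (simp add: L2_norm_nonneg)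
    have "H1_norm h \<le> c * (B * sqrt q)"
      using h_H1_norm_le unfolding L2 by (simp add: B_def n_def mult_ac)
    also have "\<dots> \<le> c * R" using R c by (intro mult_left_mono) auto
    also have "\<dots> \<le> 1" using t R by (simp add: c_def)
    finally have H1: "H1_norm h \<le> 1" .
    have kernel: "(cmod (F_kernel \<kappa> h y \<theta>))\<^sup>2 \<le>
        \<kappa> powr (real n - 1) * (c\<^sup>2 * (1 + pi\<^sup>2) ^ n) * decay \<kappa> y \<theta>" for y \<theta>
    proof -
      let ?\<xi> = "\<lambda>j. \<kappa> * (\<theta> $ j - y $ j)"
      let ?s = "\<lambda>t. indicator {0..l} t * sin (pi / l * t)"
      let ?c = "\<lambda>j. if j = i0 then c else 1"
      have I: "(cmod (LINT t|lborel. of_real (sine_sum l 1 (\<alpha> j) t) * exp (\<i> * of_real (?\<xi> j * t))))\<^sup>2 \<le>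
          (?c j)\<^sup>2 * ((1 + pi\<^sup>2) * (1 / (1 + (?\<xi> j)\<^sup>2)))" for j
      proof -
        have "complex_of_real (sine_sum l 1 (\<alpha> j) t) * exp (\<i> * of_real (?\<xi> j * t)) =
            of_real (?c j) * (of_real (?s t) * exp (\<i> * of_real (?\<xi> j * t)))" for t
          by (simp add: sine_sum_def \<alpha>_def)
        then have "(cmod (LINT t|lborel. of_real (sine_sum l 1 (\<alpha> j) t) * exp (\<i> * of_real (?\<xi> j * t))))\<^sup>2 =
            (?c j)\<^sup>2 * (cmod (LINT t|lborel. of_real (?s t) * exp (\<i> * of_real (?\<xi> j * t))))\<^sup>2"
          by (simp only: integral_mult_right_zero norm_mult power_mult_distrib norm_of_real power2_abs)
        also have "\<dots> \<le> (?c j)\<^sup>2 * ((1 + pi\<^sup>2) / (1 + (?\<xi> j)\<^sup>2))"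
          by (intro mult_left_mono fourier_sine_decay l l1) auto
        finally show ?thesis by simp
      qed
      have "(cmod (F_kernel \<kappa> h y \<theta>))\<^sup>2 = (\<kappa> powr ((real n - 1) / 2))\<^sup>2 *
          (\<Prod>j\<in>UNIV. (cmod (LINT t|lborel. of_real (sine_sum l 1 (\<alpha> j) t) * exp (\<i> * of_real (?\<xi> j * t))))\<^sup>2)"
        by (simp only: F_kernel_h norm_mult power_mult_distrib prod_norm[symmetric] prod_power_distrib
            norm_of_real power2_abs n_def)
      also have "\<dots> \<le> (\<kappa> powr ((real n - 1) / 2))\<^sup>2 *
          (\<Prod>j\<in>UNIV. (?c j)\<^sup>2 * ((1 + pi\<^sup>2) * (1 / (1 + (?\<xi> j)\<^sup>2))))"
        by (intro mult_left_mono prod_mono) (use I in auto)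
      also have "(\<kappa> powr ((real n - 1) / 2))\<^sup>2 = \<kappa> powr (real n - 1)"
        by (simp add: power2_eq_square flip: powr_add)
      also have "(\<Prod>j\<in>UNIV. (?c j)\<^sup>2 * ((1 + pi\<^sup>2) * (1 / (1 + (?\<xi> j)\<^sup>2)))) =
          c\<^sup>2 * ((1 + pi\<^sup>2) ^ n * decay \<kappa> y \<theta>)"
      proof -
        have "(\<Prod>j\<in>UNIV. (?c j)\<^sup>2) = c\<^sup>2"
          by (simp add: if_distrib[of "\<lambda>x. x\<^sup>2"] cong: if_cong)
        then show ?thesis by (simp only: prod.distrib prod_constant decay_def n_def)
      qed
      finally show ?thesis by (simp only: mult.assoc)
    qed
    have kint: "(LINT \<theta>|sphere_measure. (cmod (F_kernel \<kappa> h y \<theta>))\<^sup>2) \<le>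
        c\<^sup>2 * ((1 + pi\<^sup>2) * (3 * pi)) ^ n" for y
    proof -
      have "(LINT \<theta>|sphere_measure. (cmod (F_kernel \<kappa> h y \<theta>))\<^sup>2) \<le>
          (LINT \<theta>|sphere_measure. \<kappa> powr (real n - 1) * (c\<^sup>2 * (1 + pi\<^sup>2) ^ n) * decay \<kappa> y \<theta>)"
        using \<kappa> integral_sphere_decay_le(2)[of \<kappa> y] kernel decay_nonneg
        by (intro Bochner_Integration.integral_mono') (auto intro!: mult_nonneg_nonneg)
      also have "\<dots> = \<kappa> powr (real n - 1) * (c\<^sup>2 * (1 + pi\<^sup>2) ^ n) * (LINT \<theta>|sphere_measure. decay \<kappa> y \<theta>)"
        by simp
      also have "\<dots> \<le> \<kappa> powr (real n - 1) * (c\<^sup>2 * (1 + pi\<^sup>2) ^ n) * (\<kappa> * (3 * pi / \<kappa>) ^ n)"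
        using integral_sphere_decay_le(1)[of \<kappa> y] \<kappa> by (intro mult_left_mono) (auto simp: n_def)
      also have "\<dots> = (\<kappa> powr (real n - 1) * \<kappa> / \<kappa> ^ n) * (c\<^sup>2 * ((1 + pi\<^sup>2) ^ n * (3 * pi) ^ n))"
        by (simp add: power_divide)
      \<comment> \<open>The powers of \<kappa> cancel: the normalisation of the operator matches the
        decay on a sphere of dimension n - 1.\<close>
      also have "\<kappa> powr (real n - 1) * \<kappa> = \<kappa> ^ n"
        using \<kappa> by (simp add: powr_diff powr_realpow)
      finally show ?thesis using \<kappa> by (simp add: power_mult_distrib)
    qed
    have "HS_norm sphere_measure (F_op \<kappa> h) \<le> sqrt (c\<^sup>2 * ((1 + pi\<^sup>2) * (3 * pi)) ^ n * \<sigma>)"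
      unfolding \<sigma>_def by (rule HS_norm_F_op_le[OF h_integrable h_outside kint]) auto
    also have "\<dots> = c * C1" using c by (simp add: C1_def real_sqrt_mult)
    also have "\<dots> \<le> c * R" using R c by (intro mult_left_mono) auto
    also have "\<dots> = t" using R by (simp add: c_def)
    finally have HS: "HS_norm sphere_measure (F_op \<kappa> h) \<le> t" .
    show "\<exists>h :: real^'n \<Rightarrow> complex. h \<in> H1_ball \<and> H1_norm h \<le> 1 \<and>
        HS_norm sphere_measure (F_op \<kappa> h) \<le> t \<and> sqrt q / R * t \<le> L2_norm lborel h"
      using h_H1_ball H1 HS L2 by (intro exI[of _ h]) (simp add: c_def mult.commute)
  qed
qed

section \<open>Witness for the logarithmic bound\<close>

lemma power_fact_le_exp:
  fixes \<kappa> :: real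
  assumes "\<kappa> \<ge> 1"
  shows "(2 * \<kappa>) ^ Suc k / fact k \<le> exp (8 * \<kappa> - real k)"
proof -
  \<comment> \<open>A single term of the exponential series gives x^k / k! <= exp x; for x = 2 e
    \<kappa> this bounds (2 \<kappa>)^k / k! by exp (2 e \<kappa> - k). The remaining factor 2
    \<kappa> is at most exp (2 \<kappa>), and 2 e + 2 is at most 8 because e is at most 3.\<close>
  let ?x = "2 * exp 1 * \<kappa>"
  have x0: "0 \<le> ?x" using assms by simp
  have "(\<Sum>i\<in>{k}. inverse (fact i) *\<^sub>R ?x ^ i) \<le> (\<Sum>i. inverse (fact i) *\<^sub>R ?x ^ i)"
    using x0 by (intro sum_le_suminf summable_exp_generic) auto
  then have 1: "?x ^ k / fact k \<le> exp ?x" by (simp add: exp_def divide_inverse mult.commute)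
  have "?x ^ k = (2 * \<kappa>) ^ k * exp (real k)"
    by (simp add: power_mult_distrib exp_of_nat_mult[symmetric])
  with 1 have 2: "(2 * \<kappa>) ^ k / fact k \<le> exp (?x - real k)"
    by (simp add: exp_diff pos_le_divide_eq)
  have "(2 * \<kappa>) ^ Suc k / fact k = (2 * \<kappa>) * ((2 * \<kappa>) ^ k / fact k)" by simp
  also have "\<dots> \<le> exp (2 * \<kappa>) * exp (?x - real k)"
    using assms exp_ge_add_one_self[of "2 * \<kappa>"] by (intro mult_mono 2) (linarith | simp)+
  also have "\<dots> = exp (2 * \<kappa> + (?x - real k))" by (rule exp_add[symmetric])
  also have "\<dots> \<le> exp (8 * \<kappa> - real k)"
    using mult_right_mono[OF exp_le, of \<kappa>] assms by simp
  finally show ?thesis .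
qed

text \<open>Vanishing moments are imposed on a single factor. The transforms of the others are
  bounded by 1, so the small factor makes the whole kernel small. The scale is fixed by the
  \<open>H1\<close> norm, and \<open>k\<close> is chosen so large that the Hilbert-Schmidt norm
  falls below \<open>t\<close>.\<close>

lemma exists_logarithmic_witness:
  "\<exists>c>0. \<forall>\<kappa>\<ge>1. \<forall>t. 0 < t \<and> t \<le> exp (- 1) \<longrightarrow>
    (\<exists>h :: real^'n \<Rightarrow> complex. h \<in> H1_ball \<and> H1_norm h \<le> 1 \<and>
      HS_norm sphere_measure (F_op \<kappa> h) \<le> t \<and>
      c * (1 / (\<kappa> * (ln \<kappa> + ln (1 / t))\<^sup>2)) \<le> L2_norm lborel h)"
proof -
  interpret S: finite_measure "sphere_measure :: (real^'n) measure"
    by (rule finite_measure_sphere_measure)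
  define n where "n = CARD('n)"
  have n: "n \<ge> 1" unfolding n_def by (simp add: Suc_leI)
  define l where "l = 1 / (2 * real n)"
  have l: "0 < l" "l * real n < 1" using n by (auto simp: l_def)
  have l1: "l \<le> 1" using n by (simp add: l_def)
  define \<sigma> where "\<sigma> = measure (sphere_measure :: (real^'n) measure) (sphere 0 1)"
  define q where "q = (l / 2) ^ n"
  define B where "B = sqrt (1 + real n * (pi / l)\<^sup>2)"
  \<comment> \<open>Scaling by \<open>c1 / N\<close> makes the bound in \<open>h_H1_norm_le\<close>
    equal to 1.\<close>
  define c1 where "c1 = 1 / (B * sqrt q)"
  \<comment> \<open>Chosen so that exp A absorbs the constant factor c1 \<sigma> in the
    Hilbert-Schmidt bound.\<close>
  define A where "A = ln (1 + c1 * \<sigma>)"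
  have q: "q > 0" using l by (simp add: q_def)
  have \<sigma>: "\<sigma> \<ge> 0" by (simp add: \<sigma>_def)
  have B: "B > 0" unfolding B_def by (simp add: add_pos_nonneg)
  have c1: "c1 > 0" using B q by (simp add: c1_def)
  have A: "A \<ge> 0" "c1 * \<sigma> \<le> exp A" using c1 \<sigma> by (auto simp: A_def add_pos_nonneg)
  define R where "R = B * (11 + real n + A)"
  have R: "R > 0" using B A by (simp add: R_def)
  define i0 :: 'n where "i0 = undefined"
  show ?thesis
  proof (intro exI[of _ "1 / R"] conjI allI impI)
    show "1 / R > 0" using R by simp
    fix \<kappa> t :: real assume \<kappa>: "\<kappa> \<ge> 1" and t: "0 < t \<and> t \<le> exp (- 1)"
    define L where "L = ln \<kappa> + ln (1 / t)"
    have "ln t \<le> ln (exp (- 1))" using t by (subst ln_le_cancel_iff) auto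
    then have lnt: "ln (1 / t) \<ge> 1" using t by (simp add: ln_div)
    have ln\<kappa>: "ln \<kappa> \<ge> 0" using \<kappa> by simp
    have L: "L \<ge> 1" using lnt ln\<kappa> by (simp add: L_def)
    \<comment> \<open>8 \<kappa> offsets the growth in \<open>power_fact_le_exp\<close>, n L pays
      for the power of \<kappa> and for the target \<open>t\<close>, and A for the
      constants.\<close>
    define k where "k = nat \<lceil>8 * \<kappa> + real n * L + A\<rceil>"
    have pos: "0 \<le> 8 * \<kappa> + real n * L + A" using \<kappa> L A by simp
    have k: "8 * \<kappa> + real n * L + A \<le> real k" "real k \<le> 8 * \<kappa> + real n * L + A + 1"
      using pos unfolding k_def by linarith+
    define N where "N = k + 2"
    have N1: "N \<ge> 1" by (simp add: N_def)
    obtain a where a: "(\<Sum>j=1..N. (a j)\<^sup>2) = 1"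
      "\<And>i. i \<le> k \<Longrightarrow> (LINT t|lborel. sine_sum l N a t * t ^ i) = 0"
      using sine_sum_vanishing_moments[of k l] unfolding N_def by blast
    define c where "c = c1 / real N"
    have c: "c > 0" "c \<le> c1" using c1 N1 by (auto simp: c_def divide_le_eq mult_le_cancel_left1)
    define \<delta> where "\<delta> m = (if m = 1 then 1 else 0 :: real)" for m :: nat
    have \<delta>: "(\<Sum>m=1..N. (\<delta> m)\<^sup>2) = 1" unfolding \<delta>_def by (rule sum_indicator_1[OF N1])
    define \<alpha> where "\<alpha> j = (if j = i0 then (\<lambda>m. c * a m) else \<delta>)" for j :: 'n
    interpret sine_tensor l N \<alpha> using l by unfold_locales (auto simp: n_def)
    have "(L2_norm lborel h)\<^sup>2 = (\<Prod>j\<in>UNIV. l / 2 * (if j = i0 then c\<^sup>2 else 1))"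
      unfolding h_norm_square
    proof (intro prod.cong refl)
      fix j
      have "(\<Sum>m=1..N. (c * a m)\<^sup>2) = c\<^sup>2"
        by (simp only: power_mult_distrib sum_distrib_left[symmetric] a(1) mult_1_right)
      then show "l / 2 * (\<Sum>m=1..N. (\<alpha> j m)\<^sup>2) = l / 2 * (if j = i0 then c\<^sup>2 else 1)"
        using \<delta> by (simp add: \<alpha>_def)
    qed
    also have "\<dots> = (c * sqrt q)\<^sup>2"
      unfolding prod_scaled_delta using q by (simp add: power_mult_distrib flip: n_def q_def)
    finally have L2: "L2_norm lborel h = c * sqrt q"
      using c q by (simp add: L2_norm_nonneg)
    also have "\<dots> = 1 / (real N * B)" using q B by (simp add: c_def c1_def)
    finally have L2N: "L2_norm lborel h = 1 / (real N * B)" .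
    have "H1_norm h \<le> real N * B * L2_norm lborel h"
      using h_H1_norm_le[OF N1] by (simp add: B_def n_def)
    also have "\<dots> = 1" unfolding L2N using B N1 by simp
    finally have H1: "H1_norm h \<le> 1" .
    \<comment> \<open>A pointwise bound on the kernel suffices here: the power of \<kappa> left in
      it is beaten by exp (- k).\<close>
    define D where "D = \<kappa> powr ((real n - 1) / 2) * (c * ((2 * \<kappa>) ^ Suc k / fact k))"
    have D0: "D \<ge> 0" using c \<kappa> by (simp add: D_def)
    have kernel: "cmod (F_kernel \<kappa> h y \<theta>) \<le> D" if y: "y \<in> sphere 0 1" and \<theta>: "\<theta> \<in> sphere 0 1" for y \<theta>
    proof -
      let ?\<xi> = "\<lambda>j. \<kappa> * (\<theta> $ j - y $ j)"
      let ?I = "\<lambda>j. LINT t|lborel. complex_of_real (sine_sum l N (\<alpha> j) t) * exp (\<i> * of_real (?\<xi> j * t))"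
      have other: "cmod (?I j) \<le> 1" if "j \<noteq> i0" for j
      proof -
        have "cmod (?I j) \<le> (LINT t|lborel. \<bar>sine_sum l N (\<alpha> j) t\<bar>)"
          by (rule order_trans[OF integral_norm_bound]) (simp add: norm_mult)
        also have "\<dots> \<le> 1"
          using that \<delta> by (intro integral_abs_sine_sum_le l l1) (simp add: \<alpha>_def)
        finally show ?thesis .
      qed
      have "\<bar>\<theta> $ i0 - y $ i0\<bar> \<le> \<bar>\<theta> $ i0\<bar> + \<bar>y $ i0\<bar>" by (rule abs_triangle_ineq4)
      also have "\<dots> \<le> 2"
        using component_le_norm_cart[of \<theta> i0] component_le_norm_cart[of y i0] y \<theta> by simp
      finally have "\<kappa> * \<bar>\<theta> $ i0 - y $ i0\<bar> \<le> \<kappa> * 2" using \<kappa> by (intro mult_left_mono) auto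
      then have \<xi>: "\<bar>?\<xi> i0\<bar> \<le> 2 * \<kappa>" using \<kappa> by (simp add: abs_mult)
      have main: "cmod (?I i0) \<le> c * ((2 * \<kappa>) ^ Suc k / fact k)"
      proof -
        have "?I i0 = of_real c *
            (LINT t|lborel. complex_of_real (sine_sum l N a t) * exp (\<i> * of_real (?\<xi> i0 * t)))"
          by (simp only: \<alpha>_def simp_thms if_True sine_sum_scale of_real_mult[of c] mult.assoc integral_mult_right_zero)
        then have "cmod (?I i0) = c *
            cmod (LINT t|lborel. complex_of_real (sine_sum l N a t) * exp (\<i> * of_real (?\<xi> i0 * t)))"
          using c by (simp only: norm_mult norm_of_real abs_of_pos)
        also have "\<dots> \<le> c * (\<bar>?\<xi> i0\<bar> ^ Suc k / fact k * (LINT t|lborel. \<bar>sine_sum l N a t\<bar>))"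
          using c by (intro mult_left_mono fourier_vanishing_moments_le[of _ l] sine_sum_integrable
              sine_sum_outside l1 a(2)) auto
        also have "\<dots> \<le> c * ((2 * \<kappa>) ^ Suc k / fact k * 1)"
          using c \<xi> \<kappa> a(1)
          by (intro mult_left_mono mult_mono divide_right_mono power_mono integral_abs_sine_sum_le l l1)
            (auto intro!: divide_nonneg_nonneg)
        finally show ?thesis by simp
      qed
      have "cmod (\<Prod>j\<in>UNIV. ?I j) = cmod (?I i0) * (\<Prod>j\<in>UNIV - {i0}. cmod (?I j))"
        by (simp only: prod_norm[symmetric]) (rule prod.remove, auto)
      also have "\<dots> \<le> cmod (?I i0) * 1"
        using other by (intro mult_left_mono prod_le_1) auto
      also have "\<dots> \<le> c * ((2 * \<kappa>) ^ Suc k / fact k)" using main by simp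
      finally have "\<kappa> powr ((real n - 1) / 2) * cmod (\<Prod>j\<in>UNIV. ?I j) \<le> D"
        unfolding D_def by (intro mult_left_mono) auto
      moreover have "cmod (F_kernel \<kappa> h y \<theta>) = \<kappa> powr ((real n - 1) / 2) * cmod (\<Prod>j\<in>UNIV. ?I j)"
        by (simp only: F_kernel_h norm_mult norm_of_real n_def abs_of_nonneg[OF powr_ge_zero])
      ultimately show ?thesis by simp
    qed
    have kint: "(LINT \<theta>|sphere_measure. (cmod (F_kernel \<kappa> h y \<theta>))\<^sup>2) \<le> D\<^sup>2 * \<sigma>"
      if y: "y \<in> sphere 0 1" for y
    proof -
      have "(LINT \<theta>|sphere_measure. (cmod (F_kernel \<kappa> h y \<theta>))\<^sup>2) \<le>
          (LINT \<theta>|(sphere_measure :: (real^'n) measure). D\<^sup>2)"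
        using kernel[OF y] by (intro Bochner_Integration.integral_mono' power_mono)
          (auto simp: space_sphere_measure)
      also have "\<dots> = D\<^sup>2 * \<sigma>" by (simp add: \<sigma>_def space_sphere_measure mult.commute)
      finally show ?thesis .
    qed
    have "HS_norm sphere_measure (F_op \<kappa> h) \<le> sqrt (D\<^sup>2 * \<sigma> * \<sigma>)"
      using HS_norm_F_op_le[OF h_integrable h_outside kint] \<sigma> unfolding \<sigma>_def by simp
    also have "\<dots> = D * \<sigma>" using D0 \<sigma> by (simp add: real_sqrt_mult mult.assoc)
    also have "\<dots> \<le> exp (real n * ln \<kappa>) * (c1 * exp (8 * \<kappa> - real k)) * \<sigma>"
    proof -
      \<comment> \<open>Crude, but it brings the power of \<kappa> into the form n log \<kappa>,
        which is part of n L.\<close>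
      have "\<kappa> powr ((real n - 1) / 2) \<le> \<kappa> powr real n" using \<kappa> by (intro powr_mono) auto
      also have "\<dots> = exp (real n * ln \<kappa>)" using \<kappa> by (simp add: powr_def)
      finally show ?thesis unfolding D_def
        using \<kappa> c c1 \<sigma> by (intro mult_right_mono mult_mono power_fact_le_exp) auto
    qed
    also have "\<dots> = exp (real n * ln \<kappa>) * exp (8 * \<kappa> - real k) * (c1 * \<sigma>)" by simp
    also have "\<dots> \<le> exp (real n * ln \<kappa>) * exp (8 * \<kappa> - real k) * exp A"
      using A by (intro mult_left_mono) auto
    also have "\<dots> = exp (real n * ln \<kappa> + (8 * \<kappa> - real k) + A)" by (simp add: exp_add)
    also have "\<dots> \<le> exp (- ln (1 / t))"
    proof -
      have "ln (1 / t) \<le> real n * ln (1 / t)" using n lnt by (simp add: mult_le_cancel_right1)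
      then have "real n * ln \<kappa> + ln (1 / t) \<le> real n * L" by (simp add: L_def distrib_left)
      then show ?thesis using k by simp
    qed
    also have "\<dots> = t" using t by (simp add: ln_div)
    finally have HS: "HS_norm sphere_measure (F_op \<kappa> h) \<le> t" .
    have "real N * B \<le> R * (\<kappa> * L\<^sup>2)"
    proof -
      have "1 \<le> L\<^sup>2" using L by (simp add: one_le_power)
      have kL: "\<kappa> \<le> \<kappa> * L\<^sup>2" using \<kappa> \<open>1 \<le> L\<^sup>2\<close> by (simp add: mult_le_cancel_left1)
      have "L \<le> L\<^sup>2" using L by (simp add: power2_eq_square mult_le_cancel_left1)
      also have "\<dots> \<le> \<kappa> * L\<^sup>2" using \<kappa> by (simp add: mult_le_cancel_right1)
      finally have LL: "L \<le> \<kappa> * L\<^sup>2" .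
      have "1 \<le> \<kappa> * L\<^sup>2" using kL \<kappa> by linarith
      \<comment> \<open>Rounding up and N = k + 2 cost 3, whence 8 + 3 = 11 in \<open>R\<close>.
        Then \<kappa>, L and 1 are each replaced by \<kappa> L^2.\<close>
      have "real N \<le> 8 * \<kappa> + real n * L + A * 1 + 3 * 1" using k by (simp add: N_def)
      also have "\<dots> \<le> 8 * (\<kappa> * L\<^sup>2) + real n * (\<kappa> * L\<^sup>2) + A * (\<kappa> * L\<^sup>2) + 3 * (\<kappa> * L\<^sup>2)"
        using kL LL \<open>1 \<le> \<kappa> * L\<^sup>2\<close> A by (intro add_mono mult_left_mono) auto
      also have "\<dots> = (11 + real n + A) * (\<kappa> * L\<^sup>2)" by (simp add: algebra_simps)
      finally have "real N * B \<le> (11 + real n + A) * (\<kappa> * L\<^sup>2) * B"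
        using B by (intro mult_right_mono) auto
      then show ?thesis by (simp add: R_def mult_ac)
    qed
    then have "1 / (R * (\<kappa> * L\<^sup>2)) \<le> L2_norm lborel h"
      unfolding L2N using B N1 R \<kappa> L by (intro divide_left_mono) auto
    then have "1 / R * (1 / (\<kappa> * (ln \<kappa> + ln (1 / t))\<^sup>2)) \<le> L2_norm lborel h"
      by (simp add: L_def)
    with h_H1_ball H1 HS show "\<exists>h :: real^'n \<Rightarrow> complex. h \<in> H1_ball \<and> H1_norm h \<le> 1 \<and>
        HS_norm sphere_measure (F_op \<kappa> h) \<le> t \<and>
        1 / R * (1 / (\<kappa> * (ln \<kappa> + ln (1 / t))\<^sup>2)) \<le> L2_norm lborel h"
      by blast
  qed
qed

section \<open>From the witnesses to the theorem\<close>

lemma HS_norm_nonneg: "0 \<le> HS_norm M T"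
  by (simp add: HS_norm_def Let_def infsum_nonneg)

theorem theorem1p5:
  assumes "CARD('n::finite) \<ge> 2"
  shows "\<exists>c c0 :: real. c > 0 \<and> c0 > 0 \<and>
    (\<forall>\<kappa>\<ge>1. \<forall>\<omega> :: real \<Rightarrow> real.
       \<omega> \<in> {0..} \<rightarrow> {0..} \<and> mono_on {0..} \<omega> \<and>
       (\<forall>h :: real^'n \<Rightarrow> complex. h \<in> H1_ball \<and> H1_norm h \<le> 1 \<longrightarrow>
          L2_norm lborel h \<le> \<omega> (HS_norm sphere_measure (F_op \<kappa> h))) \<longrightarrow>
       (\<forall>t. 0 < t \<and> t \<le> c0 \<longrightarrow>
          \<omega> t \<ge> c * max t (1 / (\<kappa> * (ln \<kappa> + ln (1 / t))\<^sup>2))))"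
proof -
  obtain c1 where c1: "c1 > 0" and lin: "\<And>\<kappa> t. \<kappa> \<ge> 1 \<Longrightarrow> 0 < t \<Longrightarrow> t \<le> 1 \<Longrightarrow>
    (\<exists>h :: real^'n \<Rightarrow> complex. h \<in> H1_ball \<and> H1_norm h \<le> 1 \<and>
      HS_norm sphere_measure (F_op \<kappa> h) \<le> t \<and> c1 * t \<le> L2_norm lborel h)"
    using exists_linear_witness[where 'n='n] by blast
  obtain c2 where c2: "c2 > 0" and log: "\<And>\<kappa> t. \<kappa> \<ge> 1 \<Longrightarrow> 0 < t \<Longrightarrow> t \<le> exp (- 1) \<Longrightarrow>
    (\<exists>h :: real^'n \<Rightarrow> complex. h \<in> H1_ball \<and> H1_norm h \<le> 1 \<and>
      HS_norm sphere_measure (F_op \<kappa> h) \<le> t \<and>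
      c2 * (1 / (\<kappa> * (ln \<kappa> + ln (1 / t))\<^sup>2)) \<le> L2_norm lborel h)"
    using exists_logarithmic_witness[where 'n='n] by blast
  show ?thesis
  \<comment> \<open>\<open>exp (- 1)\<close> is the range of the logarithmic witness; it is below 1,
    so the linear witness is available as well.\<close>
  proof (rule exI[of _ "min c1 c2"], rule exI[of _ "exp (- 1)"], intro conjI allI impI)
    fix \<kappa> t :: real and \<omega> :: "real \<Rightarrow> real"
    assume \<kappa>: "\<kappa> \<ge> 1" and t: "0 < t \<and> t \<le> exp (- 1)"
      and \<omega>: "\<omega> \<in> {0..} \<rightarrow> {0..} \<and> mono_on {0..} \<omega> \<and>
       (\<forall>h :: real^'n \<Rightarrow> complex. h \<in> H1_ball \<and> H1_norm h \<le> 1 \<longrightarrow>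
          L2_norm lborel h \<le> \<omega> (HS_norm sphere_measure (F_op \<kappa> h)))"
    let ?s = "1 / (\<kappa> * (ln \<kappa> + ln (1 / t))\<^sup>2)"
    have *: "x \<le> \<omega> t" if "h \<in> H1_ball" "H1_norm h \<le> 1" "HS_norm sphere_measure (F_op \<kappa> h) \<le> t"
      "x \<le> L2_norm lborel h" for h :: "real^'n \<Rightarrow> complex" and x
    proof -
      have "L2_norm lborel h \<le> \<omega> (HS_norm sphere_measure (F_op \<kappa> h))" using \<omega> that by blast
      \<comment> \<open>\<omega> is monotone on the nonnegative reals only, hence the appeal to
        \<open>HS_norm_nonneg\<close>.\<close>
      also have "\<dots> \<le> \<omega> t"
        using \<omega> that HS_norm_nonneg[of sphere_measure "F_op \<kappa> h"] t by (intro mono_onD[of "{0..}" \<omega>]) auto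
      finally show ?thesis using that by linarith
    qed
    have "exp (- 1) \<le> (1::real)" by simp
    then have "c1 * t \<le> \<omega> t" using lin[OF \<kappa>, of t] t * by (meson order_trans)
    moreover have "c2 * ?s \<le> \<omega> t" using log[OF \<kappa>, of t] t * by meson
    moreover have "min c1 c2 * t \<le> c1 * t"
      using t by (intro mult_right_mono) auto
    moreover have "min c1 c2 * ?s \<le> c2 * ?s"
      using \<kappa> by (intro mult_right_mono) auto
    ultimately show "min c1 c2 * max t ?s \<le> \<omega> t" by (auto simp: max_def)
  qed (use c1 c2 in auto)
qed

end
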